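(* Let $$\begin{array}{ccc}K&\xrightarrow{k^1}&M_1\\ {\scriptstyle k^0}\downarrow&&\downarrow{\scriptstyle l^1}\\ M_0&\xrightarrow{l^0}&M\end{array}$$ be a pushout square in the category $\mathbf{CDA}$ of augmented directed complexes such that $K,M_0,M_1,M$ all admit unitary loop-free bases and all four morphisms $k^0,k^1,l^0,l^1$ are quasi-rigid. Then the induced square of $\omega$-categories $$\begin{array}{ccc}\nu K&\xrightarrow{\nu k^1}&\nu M_1\\ {\scriptstyle \nu k^0}\downarrow&&\downarrow{\scriptstyle \nu l^1}\\ \nu M_0&\xrightarrow{\nu l^0}&\nu M\end{array}$$ is a pushout square in the category of strict $\omega$-categories.
   Context: **Augmented directed complexes.** An augmented directed complex $K$ is a chain complex of abelian groups $K_0\xleftarrow{\partial_0}K_1\xleftarrow{\partial_1}K_2\leftarrow\cdots$ with an augmentation $e:K_0\to\mathbb Z$ ($e\partial_0=0$) and submonoids $K_n^*\subset K_n$; morphisms are augmentation-preserving chain maps $f$ with $f(K_n^* )\subset L_n^*$. A basis of $K$ is a graded set $B=(B_n)$ such that $B_n$ is a basis of the monoid $K_n^*$ and of the group $K_n$. For $x=\sum_b\lambda_bb$: $(x)_+=\sum_{\lambda_b>0}\lambda_bb$, $(x)_-=\sum_{\lambda_b<0}-\lambda_bb$, and $\partial_n^\pm(x)=(\partial_nx)_\pm$; $x\wedge y$ is the coefficientwise minimum. For $a\in K_n^*$, $\alpha\in\{-,+\}$: $\langle a\rangle_n^\alpha=a$ and $\langle a\rangle_k^\alpha=\partial_k^\alpha\langle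 a\rangle_{k+1}^\alpha$ for $k<n$; $\langle a\rangle$ denotes the family $(\langle a\rangle_k^\alpha)_{k\le n,\alpha}$. The basis is unitary if $e(\langle b\rangle_0^-)=e(\langle b\rangle_0^+)=1$ for all $b\in B$. Let $\odot_n$ be the smallest reflexive transitive relation on $B$ with $a\odot_nb$ whenever $a,b$ have degree $\ge n$ and $\langle a\rangle_n^-\wedge\langle b\rangle_n^+\ne0$; the basis is loop-free if every $\odot_n$ is a partial order. **The functor $\nu$** (Steiner) from augmented directed complexes to strict $\omega$-categories. The $n$-cells of $\nu K$ are families $x=(x_k^\alpha)_{0\le k\le n,\alpha\in\{-,+\}}$ with $x_k^\alpha\in K_k^*$, $x_n^-=x_n^+$, $\partial_{k-1}(x_k^\alpha)=x_{k-1}^+-x_{k-1}^-$ for $0<k\le n$, $e(x_0^\pm)=1$. $d_k^\alpha x$ keeps the entries of index $<k$ and has both entries of index $k$ equal to $x_k^\alpha$; units add zero entries; if $d_k^-x=d_k^+y=z$ then $x*_ky=x-z+y$. On morphisms $\nu f$ applies $f$ entrywise. **Quasi-rigid.** A morphism $f:M\to N$ between augmented directed complexes with unitary loop-free bases $B_M,B_N$ is quasi-rigid if for all $n$ and all $b\in(B_M)_n$ with $f_n(b)\neq0$, one has $f_n(b)\in B_N$ and $\nu(f)\langle b\rangle=\langle f_n(b)\rangle$. *)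

theory Defs
  imports "HOL-Algebra.Elementary_Groups" "HOL-Algebra.FiniteProduct"
begin

text \<open>Abelian groups are multiplicative records of HOL-Algebra, so sums of chains are written
  \<open>\<otimes>\<close>, differences \<open>x \<otimes> inv y\<close>, integer multiples \<open>b [^] n\<close>, and the zero chain is \<open>\<one>\<close>.
  All structures carry explicit carrier sets; functions are relevant only on these carriers, and
  equality of morphisms means agreement on them.\<close>

datatype sign = Minus | Plus

section \<open>Augmented directed complexes\<close>

text \<open>\<open>bd K n\<close> is the boundary map from degree \<open>Suc n\<close> to degree \<open>n\<close>.\<close>

record 'a adc =
  grp :: "nat \<Rightarrow> 'a monoid"
  bd :: "nat \<Rightarrow> 'a \<Rightarrow> 'a"
  aug :: "'a \<Rightarrow> int"
  pos :: "nat \<Rightarrow> 'a set"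

locale aug_dir_complex =
  fixes K :: "'a adc"
  assumes comm_group_grp: "comm_group (grp K n)"
    and bd_hom: "bd K n \<in> hom (grp K (Suc n)) (grp K n)"
    and bd_bd: "x \<in> carrier (grp K (Suc (Suc n))) \<Longrightarrow> bd K n (bd K (Suc n) x) = \<one>\<^bsub>grp K n\<^esub>"
    and aug_hom: "aug K \<in> hom (grp K 0) integer_group"
    and aug_bd: "x \<in> carrier (grp K 1) \<Longrightarrow> aug K (bd K 0 x) = 0"
    and pos_submonoid: "submonoid (pos K n) (grp K n)"

definition adc_mor :: "'a adc \<Rightarrow> 'b adc \<Rightarrow> (nat \<Rightarrow> 'a \<Rightarrow> 'b) \<Rightarrow> bool" where
  "adc_mor K L f \<longleftrightarrow>
     aug_dir_complex K \<and> aug_dir_complex L \<and>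
     (\<forall>n. f n \<in> hom (grp K n) (grp L n)) \<and>
     (\<forall>n. \<forall>x\<in>carrier (grp K (Suc n)). f n (bd K n x) = bd L n (f (Suc n) x)) \<and>
     (\<forall>x\<in>carrier (grp K 0). aug L (f 0 x) = aug K x) \<and>
     (\<forall>n. f n ` pos K n \<subseteq> pos L n)"

definition adc_mor_eq :: "'a adc \<Rightarrow> (nat \<Rightarrow> 'a \<Rightarrow> 'b) \<Rightarrow> (nat \<Rightarrow> 'a \<Rightarrow> 'b) \<Rightarrow> bool" where
  "adc_mor_eq K f g \<longleftrightarrow> (\<forall>n. \<forall>x\<in>carrier (grp K n). f n x = g n x)"

text \<open>The square \<open>l0 \<circ> k0 = l1 \<circ> k1\<close> is a pushout. The type argument bounds the carriers of
  the complexes \<open>X\<close> that the universal property is tested against. If all complexes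
  involved live on one and the same infinite type \<open>'a\<close>, then testing on \<open>'a\<close> is no
  restriction: the pushout of the three given complexes is a quotient of a direct sum in every
  degree, hence has a copy with carriers in \<open>'a\<close>.\<close>

definition adc_pushout ::
  "'x itself \<Rightarrow> 'a adc \<Rightarrow> 'b adc \<Rightarrow> 'c adc \<Rightarrow> 'd adc \<Rightarrow> (nat \<Rightarrow> 'a \<Rightarrow> 'b) \<Rightarrow> (nat \<Rightarrow> 'a \<Rightarrow> 'c) \<Rightarrow>
   (nat \<Rightarrow> 'b \<Rightarrow> 'd) \<Rightarrow> (nat \<Rightarrow> 'c \<Rightarrow> 'd) \<Rightarrow> bool" where
  "adc_pushout (_ :: 'x itself) K M0 M1 M k0 k1 l0 l1 \<longleftrightarrow>
     adc_mor K M0 k0 \<and> adc_mor K M1 k1 \<and> adc_mor M0 M l0 \<and> adc_mor M1 M l1 \<and>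
     adc_mor_eq K (\<lambda>n. l0 n \<circ> k0 n) (\<lambda>n. l1 n \<circ> k1 n) \<and>
     (\<forall>(X :: 'x adc) g0 g1.
        adc_mor M0 X g0 \<and> adc_mor M1 X g1 \<and>
        adc_mor_eq K (\<lambda>n. g0 n \<circ> k0 n) (\<lambda>n. g1 n \<circ> k1 n) \<longrightarrow>
        (\<exists>h. adc_mor M X h \<and>
             adc_mor_eq M0 (\<lambda>n. h n \<circ> l0 n) g0 \<and> adc_mor_eq M1 (\<lambda>n. h n \<circ> l1 n) g1 \<and>
             (\<forall>h'. adc_mor M X h' \<and>
                   adc_mor_eq M0 (\<lambda>n. h' n \<circ> l0 n) g0 \<and> adc_mor_eq M1 (\<lambda>n. h' n \<circ> l1 n) g1 \<longrightarrow>
                   adc_mor_eq M h' h)))"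

section \<open>Bases\<close>

definition lincomb :: "'a monoid \<Rightarrow> ('a \<Rightarrow> int) \<Rightarrow> 'a" where
  "lincomb G c = finprod G (\<lambda>b. b [^]\<^bsub>G\<^esub> c b) {b. c b \<noteq> 0}"

definition group_basis :: "'a monoid \<Rightarrow> 'a set \<Rightarrow> bool" where
  "group_basis G S \<longleftrightarrow> S \<subseteq> carrier G \<and>
     (\<forall>x\<in>carrier G. \<exists>!c :: 'a \<Rightarrow> int.
        finite {b. c b \<noteq> 0} \<and> {b. c b \<noteq> 0} \<subseteq> S \<and> x = lincomb G c)"

definition monoid_basis :: "'a monoid \<Rightarrow> 'a set \<Rightarrow> 'a set \<Rightarrow> bool" where
  "monoid_basis G P S \<longleftrightarrow> S \<subseteq> P \<and>
     (\<forall>x\<in>P. \<exists>!c :: 'a \<Rightarrow> nat.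
        finite {b. c b \<noteq> 0} \<and> {b. c b \<noteq> 0} \<subseteq> S \<and> x = lincomb G (\<lambda>b. int (c b)))"

definition adc_basis :: "'a adc \<Rightarrow> (nat \<Rightarrow> 'a set) \<Rightarrow> bool" where
  "adc_basis K B \<longleftrightarrow>
     (\<forall>n. monoid_basis (grp K n) (pos K n) (B n) \<and> group_basis (grp K n) (B n))"

definition coeff :: "'a monoid \<Rightarrow> 'a set \<Rightarrow> 'a \<Rightarrow> 'a \<Rightarrow> int" where
  "coeff G S x = (THE c. finite {b. c b \<noteq> 0} \<and> {b. c b \<noteq> 0} \<subseteq> S \<and> x = lincomb G c)"

fun sign_part :: "'a monoid \<Rightarrow> 'a set \<Rightarrow> sign \<Rightarrow> 'a \<Rightarrow> 'a" where
  "sign_part G S Plus x = lincomb G (\<lambda>b. max 0 (coeff G S x b))"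
| "sign_part G S Minus x = lincomb G (\<lambda>b. max 0 (- coeff G S x b))"

definition meet :: "'a monoid \<Rightarrow> 'a set \<Rightarrow> 'a \<Rightarrow> 'a \<Rightarrow> 'a" where
  "meet G S x y = lincomb G (\<lambda>b. min (coeff G S x b) (coeff G S y b))"

definition bd_sign :: "'a adc \<Rightarrow> (nat \<Rightarrow> 'a set) \<Rightarrow> sign \<Rightarrow> nat \<Rightarrow> 'a \<Rightarrow> 'a" where
  "bd_sign K B \<alpha> n x = sign_part (grp K n) (B n) \<alpha> (bd K n x)"

text \<open>\<open>atom K B n a k \<alpha>\<close> is the entry of index \<open>k\<close> and sign \<open>\<alpha>\<close> of the family generated by the
  chain \<open>a\<close> of degree \<open>n\<close>. As for all cells below, families are padded by zero entries above
  index \<open>n\<close>.\<close>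

function atom :: "'a adc \<Rightarrow> (nat \<Rightarrow> 'a set) \<Rightarrow> nat \<Rightarrow> 'a \<Rightarrow> nat \<Rightarrow> sign \<Rightarrow> 'a" where
  "atom K B n a k \<alpha> =
     (if k < n then bd_sign K B \<alpha> k (atom K B n a (Suc k) \<alpha>)
      else if k = n then a
      else \<one>\<^bsub>grp K k\<^esub>)"
  by pat_completeness auto
termination
  by (relation "measure (\<lambda>(K, B, n, a, k, \<alpha>). n - k)") auto

declare atom.simps [simp del]

definition unitary :: "'a adc \<Rightarrow> (nat \<Rightarrow> 'a set) \<Rightarrow> bool" where
  "unitary K B \<longleftrightarrow>
     (\<forall>n. \<forall>b\<in>B n. aug K (atom K B n b 0 Minus) = 1 \<and> aug K (atom K B n b 0 Plus) = 1)"

text \<open>Elements of the graded set \<open>B\<close> are pairs of a degree and an element of that degree, as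
  the carriers of different degrees may overlap.\<close>

definition odot_gen :: "'a adc \<Rightarrow> (nat \<Rightarrow> 'a set) \<Rightarrow> nat \<Rightarrow> (nat \<times> 'a) rel" where
  "odot_gen K B n = {((p, a), (q, b)). a \<in> B p \<and> b \<in> B q \<and> n \<le> p \<and> n \<le> q \<and>
     meet (grp K n) (B n) (atom K B p a n Minus) (atom K B q b n Plus) \<noteq> \<one>\<^bsub>grp K n\<^esub>}"

definition odot :: "'a adc \<Rightarrow> (nat \<Rightarrow> 'a set) \<Rightarrow> nat \<Rightarrow> (nat \<times> 'a) rel" where
  "odot K B n = Restr ((odot_gen K B n)\<^sup>*) (Sigma UNIV B)"

definition loop_free :: "'a adc \<Rightarrow> (nat \<Rightarrow> 'a set) \<Rightarrow> bool" where
  "loop_free K B \<longleftrightarrow> (\<forall>n. partial_order_on (Sigma UNIV B) (odot K B n))"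

definition unitary_loop_free_basis :: "'a adc \<Rightarrow> (nat \<Rightarrow> 'a set) \<Rightarrow> bool" where
  "unitary_loop_free_basis K B \<longleftrightarrow> adc_basis K B \<and> unitary K B \<and> loop_free K B"

section \<open>Strict omega-categories\<close>

text \<open>For an \<open>n\<close>-cell \<open>x\<close> and \<open>k < n\<close>, \<open>face C n k Minus x\<close> and \<open>face C n k Plus x\<close> are its
  iterated source and target \<open>k\<close>-cells; \<open>composite C n k x y\<close> is defined if the \<open>k\<close>-source of \<open>x\<close> is
  the \<open>k\<close>-target of \<open>y\<close>. The sets of cells of different dimensions need not be disjoint.\<close>

record 'c omega_cat =
  cells :: "nat \<Rightarrow> 'c set"
  face :: "nat \<Rightarrow> nat \<Rightarrow> sign \<Rightarrow> 'c \<Rightarrow> 'c"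
  unit_cell :: "nat \<Rightarrow> 'c \<Rightarrow> 'c"
  composite :: "nat \<Rightarrow> nat \<Rightarrow> 'c \<Rightarrow> 'c \<Rightarrow> 'c"

primrec iter_unit :: "'c omega_cat \<Rightarrow> nat \<Rightarrow> nat \<Rightarrow> 'c \<Rightarrow> 'c" where
  "iter_unit C k 0 x = x"
| "iter_unit C k (Suc m) x = unit_cell C (k + m) (iter_unit C k m x)"

definition composable :: "'c omega_cat \<Rightarrow> nat \<Rightarrow> nat \<Rightarrow> 'c \<Rightarrow> 'c \<Rightarrow> bool" where
  "composable C n k x y \<longleftrightarrow>
     k < n \<and> x \<in> cells C n \<and> y \<in> cells C n \<and> face C n k Minus x = face C n k Plus y"

locale omega_category =
  fixes C :: "'c omega_cat"
  assumes face_cell: "\<lbrakk>k < n; x \<in> cells C n\<rbrakk> \<Longrightarrow> face C n k \<alpha> x \<in> cells C k"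
    and face_face: "\<lbrakk>j < k; k < n; x \<in> cells C n\<rbrakk> \<Longrightarrow>
      face C k j \<alpha> (face C n k \<beta> x) = face C n j \<alpha> x"
    and unit_cell: "x \<in> cells C n \<Longrightarrow> unit_cell C n x \<in> cells C (Suc n)"
    and face_unit: "x \<in> cells C n \<Longrightarrow> face C (Suc n) n \<alpha> (unit_cell C n x) = x"
    and comp_cell: "composable C n k x y \<Longrightarrow> composite C n k x y \<in> cells C n"
    and source_comp: "composable C n k x y \<Longrightarrow>
      face C n k Minus (composite C n k x y) = face C n k Minus y"
    and target_comp: "composable C n k x y \<Longrightarrow>
      face C n k Plus (composite C n k x y) = face C n k Plus x"
    and face_comp: "\<lbrakk>composable C n k x y; k < j; j < n\<rbrakk> \<Longrightarrow>
      face C n j \<alpha> (composite C n k x y) = composite C j k (face C n j \<alpha> x) (face C n j \<alpha> y)"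
    and comp_assoc: "\<lbrakk>composable C n k x y; composable C n k y z\<rbrakk> \<Longrightarrow>
      composite C n k (composite C n k x y) z = composite C n k x (composite C n k y z)"
    and comp_unit_left: "\<lbrakk>k < n; x \<in> cells C n\<rbrakk> \<Longrightarrow>
      composite C n k (iter_unit C k (n - k) (face C n k Plus x)) x = x"
    and comp_unit_right: "\<lbrakk>k < n; x \<in> cells C n\<rbrakk> \<Longrightarrow>
      composite C n k x (iter_unit C k (n - k) (face C n k Minus x)) = x"
    and unit_comp: "composable C n k x y \<Longrightarrow>
      unit_cell C n (composite C n k x y) = composite C (Suc n) k (unit_cell C n x) (unit_cell C n y)"
    and interchange:
      "\<lbrakk>j < k; composable C n k x y; composable C n k z w;
        composable C n j x z; composable C n j y w\<rbrakk> \<Longrightarrow>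
       composite C n j (composite C n k x y) (composite C n k z w) = composite C n k (composite C n j x z) (composite C n j y w)"

definition omega_functor :: "'c omega_cat \<Rightarrow> 'd omega_cat \<Rightarrow> (nat \<Rightarrow> 'c \<Rightarrow> 'd) \<Rightarrow> bool" where
  "omega_functor C D F \<longleftrightarrow>
     omega_category C \<and> omega_category D \<and>
     (\<forall>n. F n ` cells C n \<subseteq> cells D n) \<and>
     (\<forall>n k \<alpha>. \<forall>x\<in>cells C n. k < n \<longrightarrow> F k (face C n k \<alpha> x) = face D n k \<alpha> (F n x)) \<and>
     (\<forall>n. \<forall>x\<in>cells C n. F (Suc n) (unit_cell C n x) = unit_cell D n (F n x)) \<and>
     (\<forall>n k x y. composable C n k x y \<longrightarrow> F n (composite C n k x y) = composite D n k (F n x) (F n y))"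

definition omega_functor_eq ::
  "'c omega_cat \<Rightarrow> (nat \<Rightarrow> 'c \<Rightarrow> 'd) \<Rightarrow> (nat \<Rightarrow> 'c \<Rightarrow> 'd) \<Rightarrow> bool" where
  "omega_functor_eq C F G \<longleftrightarrow> (\<forall>n. \<forall>x\<in>cells C n. F n x = G n x)"

definition omega_pushout ::
  "'x itself \<Rightarrow> 'a omega_cat \<Rightarrow> 'b omega_cat \<Rightarrow> 'c omega_cat \<Rightarrow> 'd omega_cat \<Rightarrow>
   (nat \<Rightarrow> 'a \<Rightarrow> 'b) \<Rightarrow> (nat \<Rightarrow> 'a \<Rightarrow> 'c) \<Rightarrow> (nat \<Rightarrow> 'b \<Rightarrow> 'd) \<Rightarrow> (nat \<Rightarrow> 'c \<Rightarrow> 'd) \<Rightarrow> bool" where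
  "omega_pushout (_ :: 'x itself) A C0 C1 D F0 F1 G0 G1 \<longleftrightarrow>
     omega_functor A C0 F0 \<and> omega_functor A C1 F1 \<and>
     omega_functor C0 D G0 \<and> omega_functor C1 D G1 \<and>
     omega_functor_eq A (\<lambda>n. G0 n \<circ> F0 n) (\<lambda>n. G1 n \<circ> F1 n) \<and>
     (\<forall>(X :: 'x omega_cat) H0 H1.
        omega_functor C0 X H0 \<and> omega_functor C1 X H1 \<and>
        omega_functor_eq A (\<lambda>n. H0 n \<circ> F0 n) (\<lambda>n. H1 n \<circ> F1 n) \<longrightarrow>
        (\<exists>H. omega_functor D X H \<and>
             omega_functor_eq C0 (\<lambda>n. H n \<circ> G0 n) H0 \<and>
             omega_functor_eq C1 (\<lambda>n. H n \<circ> G1 n) H1 \<and>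
             (\<forall>H'. omega_functor D X H' \<and>
                   omega_functor_eq C0 (\<lambda>n. H' n \<circ> G0 n) H0 \<and>
                   omega_functor_eq C1 (\<lambda>n. H' n \<circ> G1 n) H1 \<longrightarrow>
                   omega_functor_eq D H' H)))"

section \<open>The functor from augmented directed complexes to omega-categories\<close>

text \<open>An \<open>n\<close>-cell is a family of entries of index at most \<open>n\<close>, padded by zero entries above \<open>n\<close>;
  with this padding, forming a unit leaves the underlying function unchanged.\<close>

type_synonym 'a family = "nat \<Rightarrow> sign \<Rightarrow> 'a"

definition nu_cells :: "'a adc \<Rightarrow> nat \<Rightarrow> 'a family set" where
  "nu_cells K n = {x.
     (\<forall>k\<le>n. \<forall>\<alpha>. x k \<alpha> \<in> pos K k) \<and>
     (\<forall>k>n. \<forall>\<alpha>. x k \<alpha> = \<one>\<^bsub>grp K k\<^esub>) \<and>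
     x n Minus = x n Plus \<and>
     (\<forall>k<n. \<forall>\<alpha>. bd K k (x (Suc k) \<alpha>) = x k Plus \<otimes>\<^bsub>grp K k\<^esub> inv\<^bsub>grp K k\<^esub> (x k Minus)) \<and>
     (\<forall>\<alpha>. aug K (x 0 \<alpha>) = 1)}"

definition nu_face :: "'a adc \<Rightarrow> nat \<Rightarrow> sign \<Rightarrow> 'a family \<Rightarrow> 'a family" where
  "nu_face K k \<alpha> x = (\<lambda>j \<beta>. if j < k then x j \<beta> else if j = k then x k \<alpha> else \<one>\<^bsub>grp K j\<^esub>)"

definition nu_comp :: "'a adc \<Rightarrow> nat \<Rightarrow> 'a family \<Rightarrow> 'a family \<Rightarrow> 'a family" where
  "nu_comp K k x y =
     (\<lambda>j \<beta>. x j \<beta> \<otimes>\<^bsub>grp K j\<^esub> inv\<^bsub>grp K j\<^esub> (nu_face K k Minus x j \<beta>) \<otimes>\<^bsub>grp K j\<^esub> y j \<beta>)"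

definition nu :: "'a adc \<Rightarrow> 'a family omega_cat" where
  "nu K = \<lparr>cells = nu_cells K,
           face = (\<lambda>n. nu_face K),
           unit_cell = (\<lambda>n x. x),
           composite = (\<lambda>n. nu_comp K)\<rparr>"

definition nu_map :: "(nat \<Rightarrow> 'a \<Rightarrow> 'b) \<Rightarrow> nat \<Rightarrow> 'a family \<Rightarrow> 'b family" where
  "nu_map f n x = (\<lambda>k \<alpha>. f k (x k \<alpha>))"

section \<open>Quasi-rigid morphisms\<close>

definition quasi_rigid ::
  "'a adc \<Rightarrow> (nat \<Rightarrow> 'a set) \<Rightarrow> 'b adc \<Rightarrow> (nat \<Rightarrow> 'b set) \<Rightarrow> (nat \<Rightarrow> 'a \<Rightarrow> 'b) \<Rightarrow> bool" where
  "quasi_rigid M BM N BN f \<longleftrightarrow>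
     adc_mor M N f \<and>
     (\<forall>n. \<forall>b\<in>BM n. f n b \<noteq> \<one>\<^bsub>grp N n\<^esub> \<longrightarrow>
        f n b \<in> BN n \<and> nu_map f n (atom M BM n b) = atom N BN n (f n b))"

end

theory Submission
  imports Defs "HOL-Library.Multiset" "HOL-Library.Function_Algebras" "HOL-Library.Countable"
begin

text \<open>
  The cells of \<open>\<nu>K\<close> are freely generated by the atoms of the basis elements, and this is proved in the form:
  if some \<open>n\<close>-cells of an omega-category \<open>X\<close> are chosen as values of the atoms, and the relation between
  cells of \<open>\<nu>K\<close> and cells of \<open>X\<close> that they generate under composition is closed under faces, then that
  relation is a function. The cells are treated level by level. Above level \<open>k\<close>, a cell is a composite
  along dimension \<open>k\<close> of cells with a single basis element; these fire one after the other, consuming the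
  source and producing the target of that element, as the transitions of a Petri net whose places are the
  basis elements of degree \<open>k\<close>. Loop-freeness makes this net acyclic, hence safe, and in a safe acyclic
  net any two firing sequences with the same transitions differ by exchanges of neighbours that are
  independent. Two independent cells can be separated along dimension \<open>k - 1\<close>, and the interchange law of
  \<open>X\<close> exchanges their values.

  For a pushout square, test complexes show that every basis element of \<open>M\<close> is the image of a basis
  element of \<open>M0\<close> or \<open>M1\<close>, that preimages of the same element are identified through
  basis elements of \<open>K\<close>, and that an element which is sent to zero is identified with one whose image
  in \<open>M0\<close> or \<open>M1\<close> is zero. By quasi-rigidity two compatible functors on \<open>\<nu>M0\<close> and \<open>\<nu>M1\<close> therefore
  prescribe consistent values of the atoms of \<open>\<nu>M\<close>.
\<close>

section \<open>Safe acyclic Petri nets\<close>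

text \<open>A cell has many decompositions, and a functor defined through a chosen one could not be
  seen to respect composition. \<open>lifts\<close> therefore relates a cell to the values of all
  its decompositions: compatibility with composition is built in, and single-valuedness becomes the
  theorem. Induction on dimension alone does not reach it, because cutting an n-cell along dimension
  k can leave factors of dimension n. The induction runs over the level \<open>k\<close> of the
  classes \<open>cells_above k ob\<close>, whose cells agree above degree \<open>k\<close> with zero
  or with a single atom. Level 0 contains only atoms, level \<open>N\<close> contains all
  \<open>N\<close>-cells.

  In the pushout the delicate basis elements are those that die in \<open>M\<close>. The image of
  such an atom is a cell of lower dimension, for which no value was chosen. It has to be treated
  before uniqueness is available, since uniqueness rests on closure under faces, which in turn rests
  on this case. \<open>lifts_image\<close> therefore works with the relation alone: lower dimensions
  serve as induction hypothesis, and a functional that is 1 on violating elements and 0 at zero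
  shows that no killed element violates the claim.\<close>

lemma sum_list_fun_apply: "(\<Sum>t\<leftarrow>ts. g t) f = (\<Sum>t\<leftarrow>ts. g t f)"
  by (induction ts) auto

text \<open>Markings take integer values, so that the effects \<open>post t - pre t\<close> can be
  summed before anything is known about enabledness; order and sign conditions are pointwise.
  Acyclicity concerns \<open>t\<close> producing on a place from which \<open>t'\<close>
  consumes.\<close>

locale petri =
  fixes T :: "'t set" and pre post :: "'t \<Rightarrow> 'p \<Rightarrow> int"
  assumes pre_nonneg: "t \<in> T \<Longrightarrow> 0 \<le> pre t"
    and post_nonneg: "t \<in> T \<Longrightarrow> 0 \<le> post t"
    and pre_post_disjoint: "t \<in> T \<Longrightarrow> pre t f = 0 \<or> post t f = 0"
    and pre_nonzero: "t \<in> T \<Longrightarrow> \<exists>f. 0 < pre t f"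
    and acyclic_feeds:
      "acyclic {(t, t'). t \<in> T \<and> t' \<in> T \<and> (\<exists>f. 0 < post t f \<and> 0 < pre t' f)}"
begin

definition feeds :: "'t rel" where
  "feeds = {(t, t'). t \<in> T \<and> t' \<in> T \<and> (\<exists>f. 0 < post t f \<and> 0 < pre t' f)}"

definition step :: "('p \<Rightarrow> int) \<Rightarrow> 't \<Rightarrow> 'p \<Rightarrow> int" where
  "step s t = s - pre t + post t"

fun fires :: "('p \<Rightarrow> int) \<Rightarrow> 't list \<Rightarrow> bool" where
  "fires s [] \<longleftrightarrow> True"
| "fires s (t # ts) \<longleftrightarrow> pre t \<le> s \<and> fires (step s t) ts"

text \<open>Makes sense for every list, whether or not it fires, and depends only on the multiset of
  \<open>ts\<close>: all orders of the same transitions end in the same marking.\<close>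

definition after :: "('p \<Rightarrow> int) \<Rightarrow> 't list \<Rightarrow> 'p \<Rightarrow> int" where
  "after s ts = s + (\<Sum>t\<leftarrow>ts. post t - pre t)"

definition safe :: "('p \<Rightarrow> int) \<Rightarrow> bool" where
  "safe s \<longleftrightarrow> (\<forall>ts f. set ts \<subseteq> T \<and> fires s ts \<longrightarrow> after s ts f \<le> 1)"

lemma after_Nil [simp]: "after s [] = s"
  by (simp add: after_def)

lemma after_Cons [simp]: "after s (t # ts) = after (step s t) ts"
  by (simp add: after_def step_def algebra_simps)

lemma step_apply: "step s t f = s f - pre t f + post t f"
  by (simp add: step_def)

lemma after_append: "after s (us @ vs) = after (after s us) vs"
  by (induction us arbitrary: s) auto

lemma fires_append: "fires s (us @ vs) \<longleftrightarrow> fires s us \<and> fires (after s us) vs"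
  by (induction us arbitrary: s) auto

lemma acyclic: "acyclic feeds"
  using acyclic_feeds by (simp add: feeds_def)

lemma fed_zero: "\<lbrakk>t \<in> T; t' \<in> T; (t, t') \<notin> feeds; 0 < pre t' f\<rbrakk> \<Longrightarrow> post t f = 0"
  using post_nonneg[of t] unfolding feeds_def le_fun_def
  by (metis (mono_tags, lifting) case_prodI mem_Collect_eq order_less_le zero_fun_apply)

lemma pre_nn: "t \<in> T \<Longrightarrow> 0 \<le> pre t f" and post_nn: "t \<in> T \<Longrightarrow> 0 \<le> post t f"
  using pre_nonneg[of t] post_nonneg[of t] by (auto simp: le_fun_def)

text \<open>Where \<open>u\<close> consumes, \<open>t\<close> produces nothing, so the tokens for
  \<open>u\<close> were already there besides those taken by \<open>t\<close>.\<close>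

lemma independent_enabled:
  assumes "t \<in> T" "u \<in> T" "(t, u) \<notin> feeds" "pre t \<le> s" "pre u \<le> step s t"
  shows "pre t + pre u \<le> s"
proof (rule le_funI)
  fix f
  have "pre t f \<le> s f" "pre u f \<le> s f - pre t f + post t f"
    using assms(4,5) by (auto simp: le_fun_def step_apply)
  moreover have "pre u f = 0 \<or> post t f = 0"
    using fed_zero[OF assms(1-3), of f] pre_nn[OF assms(2), of f] by force
  ultimately show "(pre t + pre u) f \<le> s f" by auto
qed

lemma fires_swap:
  assumes "t \<in> T" "u \<in> T" "(t, u) \<notin> feeds" "fires s (t # u # ws)"
  shows "fires s (u # t # ws)"
proof -
  have "pre t + pre u \<le> s"
    using independent_enabled[OF assms(1-3)] assms(4) by simp
  then have le: "pre t f + pre u f \<le> s f" for f by (auto simp: le_fun_def)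
  have "pre u \<le> s" "pre t \<le> step s u"
    using le pre_nn[OF assms(1)] pre_nn[OF assms(2)] post_nn[OF assms(2)]
    by (auto simp: le_fun_def step_apply; smt (verit))+
  moreover have "step (step s t) u = step (step s u) t"
    by (simp add: step_def algebra_simps)
  ultimately show ?thesis using assms(4) by simp
qed

lemma fires_move:
  assumes "set vs \<subseteq> T" "u \<in> T" "\<And>v. v \<in> set vs \<Longrightarrow> (v, u) \<notin> feeds" "fires s (vs @ u # ws)"
  shows "fires s (u # vs @ ws)"
  using assms
proof (induction vs arbitrary: s)
  case (Cons v vs)
  then have "fires s (v # u # vs @ ws)" by simp
  then show ?case using fires_swap[of v u s "vs @ ws"] Cons.prems by simp
qed simp

lemma safe_step: "\<lbrakk>safe s; t \<in> T; pre t \<le> s\<rbrakk> \<Longrightarrow> safe (step s t)"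
  unfolding safe_def by (metis after_Cons fires.simps(2) insert_subset list.simps(15))

lemma safe_after: "\<lbrakk>safe s; set ts \<subseteq> T; fires s ts\<rbrakk> \<Longrightarrow> safe (after s ts)"
  by (induction ts arbitrary: s) (auto intro: safe_step)

text \<open>If \<open>t\<close> is not a consequence of \<open>d\<close>, everything up to \<open>t\<close> that is not
  a consequence of \<open>d\<close> can fire before \<open>d\<close>, which puts two tokens on one place.\<close>

lemma no_late_production:
  assumes "safe s" "fires s (d # us @ [t])" "d \<in> T" "t \<in> T" "set us \<subseteq> T"
    and "0 < post t f" "0 < pre d f"
  shows False
proof -
  have td: "(t, d) \<in> feeds" using assms by (auto simp: feeds_def)
  have tF: "(d, t) \<notin> feeds\<^sup>*"
    using td acyclic unfolding acyclic_def by (meson rtrancl_into_trancl1)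
  \<comment> \<open>\<open>vs\<close> holds the consequences of \<open>d\<close> met so far. The
    next transition either joins them or, being fed by none of them, moves in front of
    \<open>d\<close> and changes the initial marking; this is why \<open>s\<close> and
    \<open>vs\<close> vary in the induction.\<close>
  have gen: "False" if "safe s" "fires s ((d # vs) @ us @ [t])" "set vs \<subseteq> T"
    "\<forall>v\<in>set (d # vs). (d, v) \<in> feeds\<^sup>*" for s vs
    using that assms(5)
  proof (induction us arbitrary: s vs)
    case Nil
    have nf: "(v, t) \<notin> feeds" if "v \<in> set (d # vs)" for v
      using Nil.prems(4) that tF by (meson rtrancl.rtrancl_into_rtrancl)
    have "fires (step s d) (t # vs @ [])"
      using Nil.prems nf assms(4) by (intro fires_move) auto
    moreover have "pre d \<le> s" using Nil.prems(2) by simp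
    ultimately have "fires s [d, t]" by simp
    then have "pre d + pre t \<le> s"
      using independent_enabled[of d t s] nf[of d] assms(3,4) by simp
    then have le: "pre d g + pre t g \<le> s g" for g by (auto simp: le_fun_def)
    have "pre t \<le> s" using le pre_nn[OF assms(3)] by (auto simp: le_fun_def; smt (verit))
    then have "after s [t] f \<le> 1" using Nil.prems(1) assms(4) unfolding safe_def
      by (metis empty_set empty_subsetI fires.simps insert_subset list.simps(15))
    \<comment> \<open>\<open>s f\<close> covers \<open>pre d f + pre t f\<close>, so after
      \<open>t\<close> alone at least \<open>pre d f + post t f\<close>, hence two tokens, lie on
      \<open>f\<close>.\<close>
    then show False using le[of f] assms(6,7) by (simp add: step_apply)
  next
    case (Cons u us)
    show False
    proof (cases "(d, u) \<in> feeds\<^sup>*")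
      case True
      then show False using Cons.IH[of s "vs @ [u]"] Cons.prems by auto
    next
      case False
      have "(v, u) \<notin> feeds" if "v \<in> set (d # vs)" for v
        using Cons.prems(4) that False by (meson rtrancl.rtrancl_into_rtrancl)
      then have "fires s (u # (d # vs) @ us @ [t])"
        using Cons.prems assms(3) by (intro fires_move) auto
      then show False
        using Cons.IH[of "step s u" vs] Cons.prems safe_step[of s u] by auto
    qed
  qed
  show False using gen[of s "[]"] assms(1,2) by simp
qed

lemma consumed:
  "\<lbrakk>set ts \<subseteq> T; after s ts f < s f\<rbrakk> \<Longrightarrow> \<exists>t\<in>set ts. 0 < pre t f"
proof (induction ts arbitrary: s)
  case (Cons t ts)
  show ?case
  proof (cases "0 < pre t f")
    case False
    then have "after (step s t) ts f < (step s t) f"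
      using Cons.prems pre_nn[of t f] post_nn[of t f] by (simp add: step_apply)
    then show ?thesis using Cons by auto
  qed auto
qed simp

lemma produced:
  "\<lbrakk>set ts \<subseteq> T; s f < after s ts f\<rbrakk> \<Longrightarrow> \<exists>t\<in>set ts. 0 < post t f"
proof (induction ts arbitrary: s)
  case (Cons t ts)
  show ?case
  proof (cases "0 < post t f")
    case False
    then have "(step s t) f < after (step s t) ts f"
      using Cons.prems pre_nn[of t f] post_nn[of t f] by (simp add: step_apply)
    then show ?thesis using Cons by auto
  qed auto
qed simp

text \<open>Safety leaves no room on \<open>f\<close> for a second token, so the one present in
  \<open>s\<close> is consumed before \<open>t\<close> by some \<open>d\<close>. Then
  \<open>t\<close> produces on a place from which \<open>d\<close> consumed earlier, which
  \<open>no_late_production\<close> excludes.\<close>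

lemma no_production_of_available:
  assumes "safe s" "set ts \<subseteq> T" "fires s ts" "t \<in> set ts" "0 < s f" "0 < post t f"
  shows False
proof -
  obtain ts1 ts2 where ts: "ts = ts1 @ t # ts2" using assms(4) by (meson split_list)
  have f1: "fires s ts1" "fires s (ts1 @ [t])" "pre t \<le> after s ts1"
    using assms(3) by (auto simp: ts fires_append)
  have T: "set ts1 \<subseteq> T" "t \<in> T" using assms(2) by (auto simp: ts)
  have "after s (ts1 @ [t]) f \<le> 1" using assms(1) f1 T unfolding safe_def by simp
  then have "after s ts1 f - pre t f + post t f \<le> 1" by (simp add: after_append step_apply)
  moreover have "pre t f = 0" using pre_post_disjoint[OF T(2), of f] assms(6) by auto
  ultimately have "after s ts1 f < s f" using assms(5,6) by simp
  then obtain d where d: "d \<in> set ts1" "0 < pre d f" using consumed[OF T(1)] by blast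
  then obtain us vs where us: "ts1 = us @ d # vs" by (meson split_list)
  have "fires (after s us) (d # vs @ [t])" using f1(2) by (simp add: us fires_append)
  moreover have "safe (after s us)"
    using safe_after[OF assms(1), of us] f1 T by (simp add: us fires_append)
  ultimately show False
    using no_late_production[of "after s us" d vs t f] d assms(6) T by (auto simp: us)
qed

text \<open>The places from which \<open>e\<close> consumes carry tokens in \<open>s\<close>, so
  nothing in \<open>ts\<close> can produce there. Hence an enabled transition can be moved to the
  front of any firing sequence that contains it.\<close>

lemma not_fed_of_enabled:
  assumes "safe s" "set ts \<subseteq> T" "fires s ts" "e \<in> T" "pre e \<le> s" "t \<in> set ts"
  shows "(t, e) \<notin> feeds"
proof
  assume "(t, e) \<in> feeds"
  then obtain f where "0 < post t f" "0 < pre e f" by (auto simp: feeds_def)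
  moreover from this have "0 < s f" using assms(5) unfolding le_fun_def
    by (meson order_less_le_trans)
  ultimately show False using no_production_of_available assms by blast
qed

text \<open>Between two firings of \<open>e\<close>, a place emptied by the earlier one has to be
  refilled by some \<open>t\<close>; that \<open>t\<close> would be a late production after
  \<open>e\<close>.\<close>

lemma distinct_firing:
  assumes "safe s" "set ts \<subseteq> T" "fires s ts"
  shows "distinct ts"
  using assms
proof (induction ts arbitrary: s)
  case (Cons e ts)
  let ?s = "step s e"
  have sf: "safe ?s" "fires ?s ts" "set ts \<subseteq> T" "e \<in> T"
    using Cons.prems safe_step by auto
  have "e \<notin> set ts"
  proof
    assume "e \<in> set ts"
    then obtain us vs where ts: "ts = us @ e # vs" by (meson split_list)
    obtain f where f: "0 < pre e f" using pre_nonzero sf(4) by blast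
    have "post e f = 0" using pre_post_disjoint[OF sf(4), of f] f by auto
    moreover have "s f \<le> 1" using Cons.prems(1) unfolding safe_def
      by (metis after_Nil empty_set empty_subsetI fires.simps(1))
    ultimately have "?s f \<le> 0" using f by (simp add: step_apply)
    moreover have "pre e f \<le> after ?s us f"
      using sf(2) by (auto simp: ts fires_append le_fun_def)
    ultimately have "?s f < after ?s us f" using f by linarith
    then obtain t where t: "t \<in> set us" "0 < post t f" using produced[of us ?s f] sf(3) ts by auto
    then obtain as bs where us: "us = as @ t # bs" by (meson split_list)
    have "fires s (e # as @ [t])" using Cons.prems(3) by (simp add: ts us fires_append)
    then show False
      using no_late_production[of s e as t f] Cons.prems t f by (auto simp: ts us)
  qed
  then show ?case using Cons.IH[of ?s] sf by simp
qed simp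

text \<open>Acyclicity provides an \<open>e\<close> in \<open>ts\<close> that no member of
  \<open>ts\<close> feeds. On the places from which it consumes nothing is ever added, and the final
  marking is nonnegative, so the tokens that \<open>e\<close> requires are present from the start
  and \<open>e\<close> can fire as the head.\<close>

lemma firing_order:
  assumes "set ts \<subseteq> T" "0 \<le> s" "0 \<le> s + (\<Sum>t\<leftarrow>ts. post t - pre t)"
  shows "\<exists>ts'. mset ts' = mset ts \<and> fires s ts'"
  using assms
proof (induction "length ts" arbitrary: s ts)
  case 0
  then show ?case by auto
next
  case (Suc n)
  let ?r = "feeds \<inter> (set ts \<times> set ts)"
  have "wf ?r" using acyclic by (intro finite_acyclic_wf) (auto intro: acyclic_subset)
  moreover obtain t0 where "t0 \<in> set ts" using Suc.hyps(2) by (cases ts) auto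
  ultimately obtain e where e: "e \<in> set ts" "\<And>t. (t, e) \<in> ?r \<Longrightarrow> t \<notin> set ts"
    using wfE_min[of ?r t0 "set ts"] by blast
  then have nf: "(t, e) \<notin> feeds" if "t \<in> set ts" for t using that by blast
  let ?rs = "remove1 e ts"
  have eT: "e \<in> T" using e Suc.prems by blast
  have rsT: "set ?rs \<subseteq> T" using Suc.prems set_remove1_subset by fastforce
  have "pre e \<le> s"
  proof (rule le_funI)
    fix f
    show "pre e f \<le> s f"
    proof (cases "0 < pre e f")
      case True
      have z: "post t f = 0" if "t \<in> set ts" for t
        using fed_zero[OF _ eT nf True] that Suc.prems by blast
      have "0 \<le> s f + (\<Sum>t\<leftarrow>ts. post t f - pre t f)"
        using Suc.prems(3) by (auto simp: le_fun_def sum_list_fun_apply)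
      also have "(\<Sum>t\<leftarrow>ts. post t f - pre t f)
          = post e f - pre e f + (\<Sum>t\<leftarrow>?rs. post t f - pre t f)"
        by (rule sum_list_map_remove1[OF e(1)])
      also have "\<dots> \<le> - pre e f"
      proof -
        have "(\<Sum>t\<leftarrow>?rs. post t f - pre t f) \<le> (\<Sum>t\<leftarrow>?rs. 0)"
          using z rsT pre_nn
          by (intro sum_list_mono) (metis diff_0 neg_le_0_iff_le notin_set_remove1 subsetD)
        then show ?thesis using z[OF e(1)] by simp
      qed
      finally show ?thesis by linarith
    next
      case False
      then show ?thesis using Suc.prems(2) by (auto simp: le_fun_def) (meson dual_order.trans linorder_not_le)
    qed
  qed
  let ?s = "step s e"
  have "0 \<le> ?s" using \<open>pre e \<le> s\<close> post_nonneg[OF eT] by (auto simp: le_fun_def step_apply add.commute add_increasing)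
  moreover have "?s + (\<Sum>t\<leftarrow>?rs. post t - pre t) = s + (\<Sum>t\<leftarrow>ts. post t - pre t)"
    using sum_list_map_remove1[OF e(1), of "\<lambda>t. post t - pre t"] by (simp add: algebra_simps step_def)
  moreover have "length ?rs = n" using e(1) Suc.hyps(2) by (simp add: length_remove1)
  ultimately obtain ts' where "mset ts' = mset ?rs" "fires ?s ts'"
    using Suc.hyps(1)[of ?rs ?s] rsT Suc.prems(3) by auto
  then have "mset (e # ts') = mset ts \<and> fires s (e # ts')"
    using e(1) \<open>pre e \<le> s\<close> by simp
  then show ?case by blast
qed

end

section \<open>Complexes of coefficient functions\<close>

definition single :: "'a \<Rightarrow> 'a \<Rightarrow> int" where
  "single b = (\<lambda>x. if x = b then 1 else 0)"

definition chains :: "'a set \<Rightarrow> ('a \<Rightarrow> int) set" where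
  "chains A = {f. finite {b. f b \<noteq> 0} \<and> {b. f b \<noteq> 0} \<subseteq> A}"

fun signed :: "sign \<Rightarrow> ('a \<Rightarrow> int) \<Rightarrow> 'a \<Rightarrow> int" where
  "signed Plus f = (\<lambda>b. max 0 (f b))"
| "signed Minus f = (\<lambda>b. max 0 (- f b))"

lemma single_nonneg [simp]: "0 \<le> single b" by (auto simp: single_def le_fun_def)
lemma single_self [simp]: "single b b = 1" by (simp add: single_def)
lemma single_other: "x \<noteq> b \<Longrightarrow> single b x = 0" by (simp add: single_def)
lemma single_neq_0 [simp]: "single b \<noteq> 0" by (metis single_self zero_fun_apply zero_neq_one)
lemma single_inj [simp]: "single b = single c \<longleftrightarrow> b = c"
  by (metis single_self single_other zero_neq_one)

lemma chains_0 [simp]: "0 \<in> chains A"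
  by (simp add: chains_def)

lemma chains_single: "b \<in> A \<Longrightarrow> single b \<in> chains A"
  by (simp add: chains_def single_def)

lemma chains_add: "f \<in> chains A \<Longrightarrow> g \<in> chains A \<Longrightarrow> f + g \<in> chains A"
proof -
  assume "f \<in> chains A" "g \<in> chains A"
  moreover have "{b. (f + g) b \<noteq> 0} \<subseteq> {b. f b \<noteq> 0} \<union> {b. g b \<noteq> 0}" by auto
  ultimately show ?thesis unfolding chains_def by (auto intro: finite_subset)
qed

lemma chains_uminus: "f \<in> chains A \<Longrightarrow> - f \<in> chains A"
  by (simp add: chains_def)

lemma chains_diff: "f \<in> chains A \<Longrightarrow> g \<in> chains A \<Longrightarrow> f - g \<in> chains A"
  using chains_add[OF _ chains_uminus[of g A], of f] by simp

lemma chains_signed: "f \<in> chains A \<Longrightarrow> signed \<alpha> f \<in> chains A"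
  unfolding chains_def by (cases \<alpha>) (auto elim: finite_subset[rotated] simp: max_def split: if_splits)

lemma chains_sum_list: "(\<And>t. t \<in> set ts \<Longrightarrow> g t \<in> chains A) \<Longrightarrow> (\<Sum>t\<leftarrow>ts. g t) \<in> chains A"
  by (induction ts) (auto intro: chains_add)

lemma signed_nonneg [simp]: "0 \<le> signed \<alpha> f"
  by (cases \<alpha>) (auto simp: le_fun_def)

lemma signed_diff: "signed Plus f - signed Minus f = f"
  by (auto simp: fun_eq_iff)

lemma signed_le:
  assumes "f = g - h" "0 \<le> g" "0 \<le> h"
  shows "signed Plus f \<le> g" "signed Minus f \<le> h"
  using assms by (auto simp: le_fun_def)

text \<open>Writing a nonnegative chain as a list of basis elements with repetition lets it be
  treated as a multiset of transitions. The induction is on the sum of the coefficients.\<close>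

lemma nonneg_chain_sum:
  assumes "f \<in> chains A" "0 \<le> f"
  shows "\<exists>es. set es \<subseteq> A \<and> f = (\<Sum>e\<leftarrow>es. single e)"
  using assms
proof (induction "nat (\<Sum>b | f b \<noteq> 0. f b)" arbitrary: f rule: less_induct)
  case less
  show ?case
  proof (cases "f = 0")
    case True
    then show ?thesis by (intro exI[of _ "[]"]) auto
  next
    case False
    then obtain b where "f b \<noteq> 0" by (auto simp: fun_eq_iff)
    then have b: "1 \<le> f b" using less.prems(2) by (auto simp: le_fun_def) (smt (verit))
    have bA: "b \<in> A" using less.prems(1) \<open>f b \<noteq> 0\<close> by (auto simp: chains_def)
    let ?g = "f - single b" and ?F = "{b. f b \<noteq> 0}"
    have fin: "finite ?F" using less.prems(1) by (simp add: chains_def)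
    have g: "?g \<in> chains A" using less.prems(1) bA by (intro chains_diff chains_single)
    have g0: "0 \<le> ?g" using b less.prems(2) by (auto simp: le_fun_def single_def)
    have "(\<Sum>b | ?g b \<noteq> 0. ?g b) = (\<Sum>b\<in>?F. ?g b)"
      using fin \<open>f b \<noteq> 0\<close> by (intro sum.mono_neutral_left) (auto simp: single_def)
    also have "\<dots> = (\<Sum>b\<in>?F. f b) - (\<Sum>x\<in>?F. single b x)" by (simp add: sum_subtractf)
    also have "(\<Sum>x\<in>?F. single b x) = 1"
      using fin \<open>f b \<noteq> 0\<close> by (simp add: single_def)
    finally have "nat (\<Sum>b | ?g b \<noteq> 0. ?g b) < nat (\<Sum>b\<in>?F. f b)"
      using sum_mono2[OF fin, of "{b}" f] \<open>f b \<noteq> 0\<close> b less.prems(2)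
      by (auto simp: le_fun_def)
    then obtain es where es: "set es \<subseteq> A" "?g = (\<Sum>e\<leftarrow>es. single e)"
      using less.hyps g g0 by blast
    then have "f = (\<Sum>e\<leftarrow>b # es. single e)"
      by (simp add: algebra_simps flip: es(2))
    then show ?thesis using es(1) bA by (intro exI[of _ "b # es"]) auto
  qed
qed

lemma sum_single_count: "(\<Sum>e\<leftarrow>es. single e) b = int (count (mset es) b)"
  by (induction es) (auto simp: single_def)

lemma sum_single_mset:
  "(\<Sum>e\<leftarrow>es. single e) = (\<Sum>e\<leftarrow>es'. single e) \<Longrightarrow> mset es = mset es'"
  by (intro multiset_eqI) (metis of_nat_eq_iff sum_single_count)

lemma sum_list_mset_cong:
  "mset ts = mset us \<Longrightarrow> (\<Sum>t\<leftarrow>ts. g t) = (\<Sum>t\<leftarrow>us. g t :: 'b :: comm_monoid_add)"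
  by (metis mset_map sum_mset_sum_list)

text \<open>Coefficient vectors of a complex with basis \<open>S\<close>, freed from the carriers of
  abstract groups: addition is pointwise addition of functions. \<open>d\<close> and
  \<open>aug\<close> are constrained on \<open>chains\<close> alone.\<close>

locale chain_complex =
  fixes S :: "nat \<Rightarrow> 'a set"
    and d :: "nat \<Rightarrow> ('a \<Rightarrow> int) \<Rightarrow> 'a \<Rightarrow> int"
    and aug :: "('a \<Rightarrow> int) \<Rightarrow> int"
  assumes d_chain: "f \<in> chains (S (Suc n)) \<Longrightarrow> d n f \<in> chains (S n)"
    and d_add: "\<lbrakk>f \<in> chains (S (Suc n)); g \<in> chains (S (Suc n))\<rbrakk> \<Longrightarrow> d n (f + g) = d n f + d n g"
    and d_d: "f \<in> chains (S (Suc (Suc n))) \<Longrightarrow> d n (d (Suc n) f) = 0"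
    and aug_add: "\<lbrakk>f \<in> chains (S 0); g \<in> chains (S 0)\<rbrakk> \<Longrightarrow> aug (f + g) = aug f + aug g"
    and aug_d: "f \<in> chains (S 1) \<Longrightarrow> aug (d 0 f) = 0"
begin

lemma d_0 [simp]: "d n 0 = 0"
  using d_add[of 0 n 0] by simp

lemma d_diff: "\<lbrakk>f \<in> chains (S (Suc n)); g \<in> chains (S (Suc n))\<rbrakk> \<Longrightarrow> d n (f - g) = d n f - d n g"
  using d_add[OF chains_diff, of f n g g] by simp

lemma aug_0 [simp]: "aug 0 = 0"
  using aug_add[of 0 0] by simp

lemma aug_diff: "\<lbrakk>f \<in> chains (S 0); g \<in> chains (S 0)\<rbrakk> \<Longrightarrow> aug (f - g) = aug f - aug g"
  using aug_add[OF chains_diff, of f g g] by simp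

lemma d_sum_list:
  "(\<And>t. t \<in> set ts \<Longrightarrow> g t \<in> chains (S (Suc n))) \<Longrightarrow> d n (\<Sum>t\<leftarrow>ts. g t) = (\<Sum>t\<leftarrow>ts. d n (g t))"
  by (induction ts) (auto simp: d_add chains_sum_list)

section \<open>Atoms and cells in coefficients\<close>

function atm :: "nat \<Rightarrow> 'a \<Rightarrow> nat \<Rightarrow> sign \<Rightarrow> 'a \<Rightarrow> int" where
  "atm p b k \<alpha> =
     (if k < p then signed \<alpha> (d k (atm p b (Suc k) \<alpha>)) else if k = p then single b else 0)"
  by pat_completeness auto
termination
  by (relation "measure (\<lambda>(p, b, k, \<alpha>). p - k)") auto

declare atm.simps [simp del]

lemma atm_top [simp]: "atm p b p \<alpha> = single b"
  and atm_above [simp]: "p < k \<Longrightarrow> atm p b k \<alpha> = 0"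
  by (simp_all add: atm.simps)

lemma atm_chain: "b \<in> S p \<Longrightarrow> atm p b k \<alpha> \<in> chains (S k)"
proof (induction "p - k" arbitrary: k)
  case 0
  then show ?case by (subst atm.simps) (auto intro: chains_single)
next
  case (Suc n)
  then show ?case by (subst atm.simps) (auto intro!: chains_signed d_chain)
qed

lemma atm_nonneg [simp]: "0 \<le> atm p b k \<alpha>"
  by (subst atm.simps) auto

text \<open>Below the top, the two entries of degree \<open>Suc k\<close> differ by the boundary of
  an entry of degree \<open>Suc (Suc k)\<close>, so they have the same boundary. This is why the
  recursion, which keeps one sign throughout, still produces a globular family.\<close>

lemma d_atm:
  assumes "b \<in> S p"
  shows "d k (atm p b (Suc k) \<alpha>) = atm p b k Plus - atm p b k Minus"
proof (cases "k < p")
  case True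
  have eq: "d k (atm p b (Suc k) Plus) = d k (atm p b (Suc k) Minus)"
    using True
  proof (induction "p - k" arbitrary: k)
    case (Suc n)
    show ?case
    proof (cases "Suc k = p")
      case False
      then have lt: "Suc k < p" using Suc by simp
      let ?f = "\<lambda>\<alpha>. d (Suc k) (atm p b (Suc (Suc k)) \<alpha>)"
      have ch: "?f \<alpha> \<in> chains (S (Suc k))" for \<alpha>
        by (intro d_chain atm_chain assms)
      have "?f Plus = ?f Minus" using Suc.hyps lt by force
      then have "atm p b (Suc k) Plus - atm p b (Suc k) Minus = ?f Plus"
        using lt signed_diff[of "?f Minus"] by (subst (1 2) atm.simps) simp
      then have "d k (atm p b (Suc k) Plus) - d k (atm p b (Suc k) Minus) = d k (?f Plus)"
        by (metis d_diff atm_chain assms)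
      also have "\<dots> = 0" by (intro d_d atm_chain assms)
      finally show ?thesis by simp
    qed auto
  qed simp
  then have "d k (atm p b (Suc k) \<alpha>) = d k (atm p b (Suc k) Plus)"
    and "d k (atm p b (Suc k) \<alpha>) = d k (atm p b (Suc k) Minus)"
    by (cases \<alpha>; simp)+
  then show ?thesis using True signed_diff[of "d k (atm p b (Suc k) \<alpha>)"]
    by (subst (2 3) atm.simps) simp
next
  case False
  then show ?thesis by (cases "k = p") auto
qed

lemma atm_disjoint:
  assumes "b \<in> S p" "k < p"
  shows "atm p b k Minus f = 0 \<or> atm p b k Plus f = 0"
proof -
  have "atm p b k \<alpha> = signed \<alpha> (d k (atm p b (Suc k) Minus))" for \<alpha>
    using assms d_atm[OF assms(1), of k Plus] d_atm[OF assms(1), of k Minus]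
    by (cases \<alpha>) (subst atm.simps, simp)+
  from this[of Minus] this[of Plus] show ?thesis by (auto simp: max_def)
qed

text \<open>Cells without a prescribed dimension: the conditions are imposed in every degree, and
  \<open>cells_above k None\<close> singles out the \<open>k\<close>-cells by vanishing entries
  above \<open>k\<close>. Equality of their two entries at \<open>k\<close> follows from the
  boundary condition.\<close>

definition all_cells :: "('a \<Rightarrow> int) family set" where
  "all_cells = {x. (\<forall>k \<alpha>. x k \<alpha> \<in> chains (S k) \<and> 0 \<le> x k \<alpha>) \<and>
     (\<forall>k \<alpha>. d k (x (Suc k) \<alpha>) = x k Plus - x k Minus) \<and> (\<forall>\<alpha>. aug (x 0 \<alpha>) = 1)}"

definition cface :: "nat \<Rightarrow> sign \<Rightarrow> ('a \<Rightarrow> int) family \<Rightarrow> nat \<Rightarrow> sign \<Rightarrow> 'a \<Rightarrow> int" where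
  "cface k \<alpha> x = (\<lambda>j \<beta>. if j < k then x j \<beta> else if j = k then x k \<alpha> else 0)"

definition ccomp :: "nat \<Rightarrow> ('a \<Rightarrow> int) family \<Rightarrow> ('a \<Rightarrow> int) family \<Rightarrow> nat \<Rightarrow> sign \<Rightarrow> 'a \<Rightarrow> int" where
  "ccomp k x y = x - cface k Minus x + y"

definition opt_atom :: "(nat \<times> 'a) option \<Rightarrow> nat \<Rightarrow> sign \<Rightarrow> 'a \<Rightarrow> int" where
  "opt_atom ob j \<alpha> = (case ob of None \<Rightarrow> 0 | Some (p, b) \<Rightarrow> atm p b j \<alpha>)"

lemma opt_atom_simps [simp]: "opt_atom None j \<alpha> = 0" "opt_atom (Some (p, b)) j \<alpha> = atm p b j \<alpha>"
  by (simp_all add: opt_atom_def)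

text \<open>\<open>cells_above k None\<close> is the set of \<open>k\<close>-cells, and \<open>cells_above k (Some (p, b))\<close> the set of \<open>p\<close>-cells that agree
  above degree \<open>k\<close> with the atom of \<open>b\<close>.\<close>

definition cells_above :: "nat \<Rightarrow> (nat \<times> 'a) option \<Rightarrow> ('a \<Rightarrow> int) family set" where
  "cells_above k ob = {x \<in> all_cells. \<forall>j>k. \<forall>\<alpha>. x j \<alpha> = opt_atom ob j \<alpha>}"

text \<open>The net at level \<open>k\<close>: its places are the basis elements of degree
  \<open>k\<close>, and a basis element of any degree above \<open>k\<close> acts on them by the two
  entries of its atom in degree \<open>k\<close>.\<close>

definition transitions :: "nat \<Rightarrow> (nat \<times> 'a) set" where
  "transitions k = {(q, e). k < q \<and> e \<in> S q}"

abbreviation pre :: "nat \<Rightarrow> nat \<times> 'a \<Rightarrow> 'a \<Rightarrow> int" where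
  "pre k t \<equiv> opt_atom (Some t) k Minus"

abbreviation post :: "nat \<Rightarrow> nat \<times> 'a \<Rightarrow> 'a \<Rightarrow> int" where
  "post k t \<equiv> opt_atom (Some t) k Plus"

lemma all_cells_chain: "x \<in> all_cells \<Longrightarrow> x k \<alpha> \<in> chains (S k)"
  and all_cells_nonneg: "x \<in> all_cells \<Longrightarrow> 0 \<le> x k \<alpha>"
  and all_cells_d: "x \<in> all_cells \<Longrightarrow> d k (x (Suc k) \<alpha>) = x k Plus - x k Minus"
  and all_cells_aug: "x \<in> all_cells \<Longrightarrow> aug (x 0 \<alpha>) = 1"
  unfolding all_cells_def by blast+

lemma cells_aboveD: "x \<in> cells_above k ob \<Longrightarrow> x \<in> all_cells" "x \<in> cells_above k ob \<Longrightarrow> k < j \<Longrightarrow> x j \<alpha> = opt_atom ob j \<alpha>"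
  by (auto simp: cells_above_def)

lemma cells_above_None_mono: "x \<in> cells_above i None \<Longrightarrow> i \<le> k \<Longrightarrow> x \<in> cells_above k None"
  by (simp add: cells_above_def)

lemma cells_above_None_eq: "x \<in> cells_above k None \<Longrightarrow> x k \<alpha> = x k \<beta>"
  using all_cells_d[of x k Plus] cells_aboveD(1)[of x k None] cells_aboveD(2)[of x k None "Suc k" Plus] by (cases \<alpha>; cases \<beta>) auto

lemma cface_id: "x \<in> cells_above j None \<Longrightarrow> j \<le> k \<Longrightarrow> cface k \<alpha> x = x"
  unfolding cface_def using cells_aboveD(2)[of x j None] cells_above_None_eq[of x j]
  by (intro ext) (auto, metis le_neq_implies_less cells_above_None_eq)

lemma cface_cface: "cface j \<alpha> (cface k \<beta> x) = (if j < k then cface j \<alpha> x else cface k \<beta> x)"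
  by (auto simp: cface_def fun_eq_iff)

lemma cface_cls: "x \<in> all_cells \<Longrightarrow> cface k \<alpha> x \<in> cells_above k None"
  by (cases \<alpha>) (auto simp: cells_above_def all_cells_def cface_def)

lemma cface_eqD:
  assumes "cface k Minus x = cface k Plus y"
  shows "j < k \<Longrightarrow> x j \<beta> = y j \<beta>" "x k Minus = y k Plus"
  using fun_cong[OF fun_cong[OF assms, of j], of \<beta>] fun_cong[OF fun_cong[OF assms, of k], of Plus]
  by (auto simp: cface_def)

lemma ccomp_below: "cface k Minus x = cface k Plus y \<Longrightarrow> j < k \<Longrightarrow> ccomp k x y j \<beta> = y j \<beta>"
  and ccomp_Minus: "ccomp k x y k Minus = y k Minus"
  and ccomp_Plus: "cface k Minus x = cface k Plus y \<Longrightarrow> ccomp k x y k Plus = x k Plus"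
  and ccomp_above: "k < j \<Longrightarrow> ccomp k x y j \<beta> = x j \<beta> + y j \<beta>"
  using cface_eqD[where k = k and x = x and y = y] by (auto simp: ccomp_def cface_def)

lemmas ccomp_apply = ccomp_below ccomp_Plus

lemma ccomp_eqI:
  assumes "cface k Minus x = cface k Plus y"
    and "\<And>j \<beta>. j < k \<Longrightarrow> z j \<beta> = y j \<beta>" "z k Minus = y k Minus" "z k Plus = x k Plus"
    and "\<And>j \<beta>. k < j \<Longrightarrow> z j \<beta> = x j \<beta> + y j \<beta>"
  shows "ccomp k x y = z"
proof (intro ext)
  fix j \<beta> f
  show "ccomp k x y j \<beta> f = z j \<beta> f"
    using assms(2-) ccomp_apply[OF assms(1)] ccomp_Minus[of k x y] ccomp_above[of k j x y]
    by (cases j k rule: linorder_cases; cases \<beta>) auto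
qed

lemma all_cells_ccomp:
  assumes "x \<in> all_cells" "y \<in> all_cells" "cface k Minus x = cface k Plus y"
  shows "ccomp k x y \<in> all_cells"
proof -
  note s = ccomp_apply[OF assms(3)] cface_eqD[OF assms(3)]
  have c: "ccomp k x y j \<beta> \<in> chains (S j) \<and> 0 \<le> ccomp k x y j \<beta>" for j \<beta>
    using all_cells_chain[OF assms(1)] all_cells_chain[OF assms(2)] all_cells_nonneg[OF assms(1)] all_cells_nonneg[OF assms(2)]
    by (cases j k rule: linorder_cases; cases \<beta>) (auto simp: s ccomp_Minus ccomp_above chains_add add_nonneg_nonneg le_fun_def)
  have dd: "d j (ccomp k x y (Suc j) \<beta>) = ccomp k x y j Plus - ccomp k x y j Minus" for j \<beta>
  proof (cases "Suc j" k rule: linorder_cases)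
    case less
    then show ?thesis using all_cells_d[OF assms(2)] by (simp add: s)
  next
    case equal
    then show ?thesis using all_cells_d[OF assms(2)] all_cells_d[OF assms(1)]
      by (cases \<beta>) (auto simp: s ccomp_Minus)
  next
    case greater
    then have "d j (ccomp k x y (Suc j) \<beta>) = x j Plus - x j Minus + (y j Plus - y j Minus)"
      using all_cells_chain[OF assms(1)] all_cells_chain[OF assms(2)]
      by (simp add: ccomp_above d_add all_cells_d[OF assms(1)] all_cells_d[OF assms(2)])
    then show ?thesis using greater
      by (cases "j = k") (auto simp: s ccomp_Minus ccomp_above algebra_simps)
  qed
  have "aug (ccomp k x y 0 \<alpha>) = 1" for \<alpha>
    using all_cells_aug[OF assms(1)] all_cells_aug[OF assms(2)] s(2)
    by (cases "k = 0"; cases \<alpha>) (auto simp: s ccomp_Minus)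
  then show ?thesis using c dd unfolding all_cells_def by blast
qed

lemma cface_ccomp:
  assumes "cface k Minus x = cface k Plus y"
  shows "cface k Minus (ccomp k x y) = cface k Minus y"
    and "cface k Plus (ccomp k x y) = cface k Plus x"
    and "k < j \<Longrightarrow> cface j \<alpha> (ccomp k x y) = ccomp k (cface j \<alpha> x) (cface j \<alpha> y)"
    and "j < k \<Longrightarrow> cface j \<alpha> (ccomp k x y) = cface j \<alpha> y"
proof -
  note s = ccomp_apply[OF assms] cface_eqD[OF assms]
  show "cface k Minus (ccomp k x y) = cface k Minus y"
    and "cface k Plus (ccomp k x y) = cface k Plus x"
    and "j < k \<Longrightarrow> cface j \<alpha> (ccomp k x y) = cface j \<alpha> y"
    by (auto simp: cface_def s ccomp_Minus fun_eq_iff)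
  assume "k < j"
  then have e: "cface k Minus (cface j \<alpha> x) = cface k Plus (cface j \<alpha> y)"
    by (simp add: cface_cface assms)
  show "cface j \<alpha> (ccomp k x y) = ccomp k (cface j \<alpha> x) (cface j \<alpha> y)"
    using \<open>k < j\<close> by (intro ccomp_eqI[symmetric] e) (auto simp: cface_def s ccomp_Minus ccomp_above)
qed

lemma ccomp_unit:
  "ccomp k x (cface k Minus x) = x" "ccomp k (cface k Plus x) x = x"
  by (auto simp: ccomp_def cface_cface)

lemma signed_le_Cell:
  assumes "x \<in> all_cells"
  shows "signed \<alpha> (d k (x (Suc k) \<beta>)) \<le> x k \<alpha>"
  using signed_le[OF all_cells_d[OF assms] all_cells_nonneg[OF assms] all_cells_nonneg[OF assms]]
  by (cases \<alpha>) blast+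

lemma signed_d_atm: "b \<in> S p \<Longrightarrow> k < p \<Longrightarrow> signed \<alpha> (d k (atm p b (Suc k) \<beta>)) = atm p b k \<alpha>"
  using d_atm[of b p k Plus] d_atm[of b p k Minus] by (subst (2) atm.simps) (cases \<alpha>; cases \<beta>; simp)

text \<open>\<open>x k Plus - x k Minus\<close> is the boundary of the atom's entry in degree
  \<open>Suc k\<close>. Its positive and negative parts are \<open>post k t\<close> and
  \<open>pre k t\<close>, the least nonnegative pair with this difference. In particular
  \<open>t\<close> is enabled at the source of \<open>x\<close>.\<close>

lemma atm_le_Cell:
  assumes "x \<in> cells_above k (Some t)" "t \<in> transitions k"
  shows "opt_atom (Some t) k \<alpha> \<le> x k \<alpha>"
proof -
  obtain q e where t: "t = (q, e)" "k < q" "e \<in> S q" using assms(2) by (auto simp: transitions_def)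
  then have "x (Suc k) \<alpha> = atm q e (Suc k) \<alpha>" using cells_aboveD(2)[OF assms(1), of "Suc k"] by simp
  then show ?thesis
    using signed_le_Cell[of x \<alpha> k \<alpha>] cells_aboveD(1)[OF assms(1)] signed_d_atm[of e q k] t by simp
qed

lemma d_tr: "t \<in> transitions k \<Longrightarrow> d k (opt_atom (Some t) (Suc k) \<alpha>) = post k t - pre k t"
  using d_atm by (auto simp: transitions_def)

lemma cells_above_trD:
  assumes "x \<in> cells_above k (Some t)" "t \<in> transitions k"
  shows "x k Plus = x k Minus - pre k t + post k t"
  using all_cells_d[OF cells_aboveD(1)[OF assms(1)], of k Plus] cells_aboveD(2)[OF assms(1), of "Suc k"] d_tr[OF assms(2), of Plus]
  by (simp add: algebra_simps)

lemma tr_chain: "t \<in> transitions k \<Longrightarrow> opt_atom (Some t) j \<alpha> \<in> chains (S j)"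
  using atm_chain by (auto simp: transitions_def)

lemma tr_nonneg [simp]: "0 \<le> opt_atom (Some t) j \<alpha>"
  by (cases t) simp

lemma transitions_Suc: "t \<in> transitions (Suc k) \<Longrightarrow> t \<in> transitions k"
  by (auto simp: transitions_def)

section \<open>Cells with a single transition\<close>

definition set_level :: "nat \<Rightarrow> ('a \<Rightarrow> int) family \<Rightarrow> ('a \<Rightarrow> int) \<Rightarrow> nat \<Rightarrow> sign \<Rightarrow> 'a \<Rightarrow> int" where
  "set_level k g s = (\<lambda>j \<beta>. if j = k then s else g j \<beta>)"

definition fire :: "nat \<Rightarrow> ('a \<Rightarrow> int) family \<Rightarrow> nat \<times> 'a \<Rightarrow> nat \<Rightarrow> sign \<Rightarrow> 'a \<Rightarrow> int" where
  "fire k g t = set_level k g (g k Minus - pre k t + post k t)"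

text \<open>The atom of \<open>t\<close> whiskered into the \<open>k\<close>-cell \<open>g\<close>:
  it runs from \<open>g\<close> to \<open>fire k g t\<close> and has only \<open>t\<close> above
  level \<open>k\<close>.\<close>

definition transition_cell :: "nat \<Rightarrow> ('a \<Rightarrow> int) family \<Rightarrow> nat \<times> 'a \<Rightarrow> nat \<Rightarrow> sign \<Rightarrow> 'a \<Rightarrow> int" where
  "transition_cell k g t = (\<lambda>j \<beta>. if j < k then g j \<beta>
     else if j = k then (if \<beta> = Minus then g k Minus else g k Minus - pre k t + post k t)
     else opt_atom (Some t) j \<beta>)"

lemma transition_cell_cls:
  assumes "g \<in> cells_above k None" "t \<in> transitions k" "pre k t \<le> g k Minus"
  shows "transition_cell k g t \<in> cells_above k (Some t)"
proof -
  note g = cells_aboveD(1)[OF assms(1)]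
  have le: "pre k t f \<le> g k Minus f" for f using assms(3) by (auto simp: le_fun_def)
  have p: "0 \<le> g k Minus - pre k t + post k t"
    using le tr_nonneg[of t k Plus] by (auto simp: le_fun_def)
  have "transition_cell k g t j \<beta> \<in> chains (S j) \<and> 0 \<le> transition_cell k g t j \<beta>" for j \<beta>
    using all_cells_chain[OF g] all_cells_nonneg[OF g] tr_chain[OF assms(2)] p
    by (auto simp: transition_cell_def intro!: chains_add chains_diff)
  moreover have "d j (transition_cell k g t (Suc j) \<beta>) = transition_cell k g t j Plus - transition_cell k g t j Minus" for j \<beta>
  proof (cases j k rule: linorder_cases)
    case less
    show ?thesis
    proof (cases "Suc j = k \<and> \<beta> = Plus")
      case True
      then have j: "k = Suc j" by simp
      have "d j (g k Minus - pre k t + post k t) = d j (g k Minus) - d j (pre k t) + d j (post k t)"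
        using all_cells_chain[OF g] tr_chain[OF assms(2)] unfolding j
        by (simp add: d_add d_diff chains_diff)
      \<comment> \<open>Seen from level \<open>j\<close>, one below \<open>k\<close>, both
        \<open>pre k t\<close> and \<open>post k t\<close> have the boundary
        \<open>post j t - pre j t\<close>, so exchanging one for the other keeps the
        boundary.\<close>
      moreover have "t \<in> transitions j" using assms(2) transitions_Suc j by blast
      ultimately have "d j (g k Minus - pre k t + post k t) = d j (g k Minus)"
        using d_tr[of t j] j by simp
      then show ?thesis using True all_cells_d[OF g, of j Minus] by (auto simp: transition_cell_def)
    next
      case False
      then have "transition_cell k g t (Suc j) \<beta> = g (Suc j) \<beta>"
        using less by (cases "Suc j = k"; cases \<beta>) (auto simp: transition_cell_def)
      then show ?thesis using less all_cells_d[OF g] by (simp add: transition_cell_def)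
    qed
  next
    case equal
    then show ?thesis using d_tr[OF assms(2)] by (simp add: transition_cell_def)
  next
    case greater
    obtain q e where t: "t = (q, e)" "e \<in> S q" using assms(2) by (auto simp: transitions_def)
    then show ?thesis using greater d_atm[OF t(2)] by (simp add: transition_cell_def)
  qed
  moreover have "aug (transition_cell k g t 0 \<alpha>) = 1" for \<alpha>
  proof (cases "k = 0 \<and> \<alpha> = Plus")
    case True
    have "t \<in> transitions 0" using assms(2) True by simp
    have "aug (post 0 t - pre 0 t) = 0"
      using aug_d[OF tr_chain[OF assms(2), of 1 Plus]] d_tr[OF \<open>t \<in> transitions 0\<close>, of Plus] by (simp add: One_nat_def[symmetric] del: One_nat_def)
    moreover have "g 0 Minus - pre 0 t + post 0 t = g 0 Minus + (post 0 t - pre 0 t)" by simp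
    ultimately have "aug (g 0 Minus - pre 0 t + post 0 t) = 1"
      using all_cells_aug[OF g] all_cells_chain[OF g] tr_chain[OF assms(2)] by (simp add: aug_add aug_diff chains_diff del: diff_add_cancel)
    then show ?thesis using True by (simp add: transition_cell_def)
  next
    case False
    then show ?thesis using all_cells_aug[OF g] by (cases \<alpha>) (auto simp: transition_cell_def)
  qed
  ultimately have "transition_cell k g t \<in> all_cells" unfolding all_cells_def by blast
  then show ?thesis by (simp add: cells_above_def transition_cell_def)
qed

lemma cface_tcell:
  assumes "g \<in> cells_above k None"
  shows "cface k Minus (transition_cell k g t) = g" "cface k Plus (transition_cell k g t) = fire k g t"
    "j < k \<Longrightarrow> cface j \<alpha> (transition_cell k g t) = cface j \<alpha> g"
  using cells_aboveD(2)[OF assms] cells_above_None_eq[OF assms]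
  by (auto simp: cface_def transition_cell_def fire_def set_level_def fun_eq_iff)

lemma fire_cls:
  "\<lbrakk>g \<in> cells_above k None; t \<in> transitions k; pre k t \<le> g k Minus\<rbrakk> \<Longrightarrow> fire k g t \<in> cells_above k None"
  using cface_tcell(2)[of g k t] cface_cls[OF cells_aboveD(1)[OF transition_cell_cls]] by metis

text \<open>A cell with a single transition is determined by its source in dimension
  \<open>k\<close> and that transition, since the boundary condition forces the entry at
  \<open>k\<close> with sign \<open>Plus\<close>.\<close>

lemma transition_cell_eq:
  assumes "x \<in> cells_above k (Some t)" "t \<in> transitions k"
  shows "x = transition_cell k (cface k Minus x) t" "pre k t \<le> cface k Minus x k Minus"
proof -
  show "x = transition_cell k (cface k Minus x) t"
  proof (intro ext)
    fix j \<beta> f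
    show "x j \<beta> f = transition_cell k (cface k Minus x) t j \<beta> f"
      using cells_above_trD[OF assms] cells_aboveD(2)[OF assms(1)]
      by (cases j k rule: linorder_cases; cases \<beta>) (auto simp: transition_cell_def cface_def)
  qed
  show "pre k t \<le> cface k Minus x k Minus"
    using atm_le_Cell[OF assms, of Minus] by (simp add: cface_def)
qed

end

section \<open>Complexes with a unitary loop-free basis\<close>

locale steiner_complex = chain_complex +
  assumes unitary: "b \<in> S p \<Longrightarrow> aug (atm p b 0 \<alpha>) = 1"
    and loop_free: "acyclic {(t, t'). t \<in> transitions k \<and> t' \<in> transitions k \<and> (\<exists>f. 0 < post k t f \<and> 0 < pre k t' f)}"
begin

text \<open>A zero entry makes all entries below it zero, down to degree 0, where unitarity demands
  augmentation 1. So every transition consumes something.\<close>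

lemma atm_nonzero:
  assumes "b \<in> S p" "k \<le> p"
  shows "\<exists>f. 0 < atm p b k \<alpha> f"
proof (rule ccontr)
  assume "\<not> ?thesis"
  then have z: "atm p b k \<alpha> = 0"
    using atm_nonneg[of p b k \<alpha>] by (auto simp: fun_eq_iff le_fun_def) (meson linorder_not_less nle_le)
  have "atm p b (k - m) \<alpha> = 0" if "m \<le> k" for m
    using that
  proof (induction m)
    case 0
    then show ?case using z by simp
  next
    case (Suc m)
    then have lt: "k - Suc m < p" "Suc (k - Suc m) = k - m" using assms(2) by auto
    have "atm p b (k - m) \<alpha> = 0" using Suc.IH Suc.prems by (meson Suc_leD)
    then have "atm p b (k - Suc m) \<alpha> = signed \<alpha> (d (k - Suc m) 0)"
      by (subst atm.simps) (simp only: lt if_True)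
    then show ?case by (cases \<alpha>) (auto simp: fun_eq_iff)
  qed
  from this[of k] unitary[OF assms(1), of \<alpha>] show False by simp
qed

lemma atm_Cell: "b \<in> S p \<Longrightarrow> atm p b \<in> all_cells"
  using atm_chain d_atm unitary by (simp add: all_cells_def)

lemma atm_cls: "b \<in> S p \<Longrightarrow> atm p b \<in> cells_above k (Some (p, b))" "b \<in> S p \<Longrightarrow> p \<le> k \<Longrightarrow> atm p b \<in> cells_above k None"
  using atm_Cell by (auto simp: cells_above_def)

text \<open>Unitarity for basis elements of degree 0 says that each has augmentation 1, so
  \<open>aug\<close> counts summands. A nonnegative chain of augmentation 1 is thus a single basis
  element, which is what makes level 0 easy.\<close>

lemma aug_nonneg:
  assumes "f \<in> chains (S 0)" "0 \<le> f"
  shows "\<exists>es. set es \<subseteq> S 0 \<and> f = (\<Sum>e\<leftarrow>es. single e) \<and> aug f = int (length es)"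
proof -
  obtain es where es: "set es \<subseteq> S 0" "f = (\<Sum>e\<leftarrow>es. single e)"
    using nonneg_chain_sum[OF assms] by blast
  have "aug (\<Sum>e\<leftarrow>es. single e) = int (length es)"
    using es(1)
  proof (induction es)
    case (Cons e es)
    then have "aug (single e) = 1" using unitary[of e 0 Minus] by simp
    moreover have "aug (single e + (\<Sum>e\<leftarrow>es. single e)) = aug (single e) + aug (\<Sum>e\<leftarrow>es. single e)"
      using Cons by (intro aug_add chains_sum_list chains_single) auto
    moreover have "aug (\<Sum>e\<leftarrow>es. single e) = int (length es)" using Cons by simp
    ultimately have "aug (single e + (\<Sum>e\<leftarrow>es. single e)) = int (length (e # es))"
      by (simp del: plus_fun_apply)
    then show ?case by (simp only: list.map sum_list.Cons)
  qed simp
  then show ?thesis using es by blast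
qed

lemma aug_1_single:
  assumes "f \<in> chains (S 0)" "0 \<le> f" "aug f = 1"
  shows "\<exists>b\<in>S 0. f = single b"
proof -
  obtain es where es: "set es \<subseteq> S 0" "f = (\<Sum>e\<leftarrow>es. single e)" "length es = 1"
    using aug_nonneg[OF assms(1,2)] assms(3) by auto
  then show ?thesis by (cases es) auto
qed

lemma Cell_0_single: "x \<in> all_cells \<Longrightarrow> \<exists>b\<in>S 0. x 0 \<alpha> = single b"
  using aug_1_single all_cells_chain all_cells_nonneg all_cells_aug by metis

sublocale net: petri "transitions k" "pre k" "post k" for k
proof
  show "0 \<le> pre k t" "0 \<le> post k t" for t by simp_all
  show "pre k t f = 0 \<or> post k t f = 0" if "t \<in> transitions k" for t f
    using that atm_disjoint[of "snd t" "fst t" k f] by (cases t) (auto simp: transitions_def)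
  show "\<exists>f. 0 < pre k t f" if "t \<in> transitions k" for t
    using that atm_nonzero by (fastforce simp: transitions_def)
qed (rule loop_free)

lemma fire_at: "fire k g t k \<beta> = net.step k (g k Minus) t"
  by (simp add: fire_def set_level_def net.step_def)

lemma set_level_fire: "set_level k (fire k g t) s = set_level k g s"
  by (simp add: fire_def set_level_def fun_eq_iff)

lemma set_level_id: "g \<in> cells_above k None \<Longrightarrow> set_level k g (g k Minus) = g"
  using cells_above_None_eq by (fastforce simp: set_level_def)

lemma fires_cls:
  assumes "g \<in> cells_above k None" "set ts \<subseteq> transitions k" "net.fires k (g k Minus) ts"
  shows "set_level k g (net.after k (g k Minus) ts) \<in> cells_above k None"
  using assms
proof (induction ts arbitrary: g)
  case Nil
  then show ?case by (simp add: set_level_id)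
next
  case (Cons t ts)
  then have "fire k g t \<in> cells_above k None" by (intro fire_cls) auto
  then show ?case using Cons.IH[of "fire k g t"] Cons.prems by (simp add: fire_at set_level_fire)
qed

lemma sum_d_tr:
  assumes "set ts \<subseteq> transitions k"
  shows "(\<Sum>t\<leftarrow>ts. post k t - pre k t) = d k (\<Sum>t\<leftarrow>ts. opt_atom (Some t) (Suc k) \<alpha>)"
proof -
  have "d k (\<Sum>t\<leftarrow>ts. opt_atom (Some t) (Suc k) \<alpha>) = (\<Sum>t\<leftarrow>ts. d k (opt_atom (Some t) (Suc k) \<alpha>))"
    using assms tr_chain by (intro d_sum_list) blast
  also have "\<dots> = (\<Sum>t\<leftarrow>ts. post k t - pre k t)"
    using assms d_tr by (intro arg_cong[of _ _ sum_list] map_cong) auto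
  finally show ?thesis by simp
qed

text \<open>\<open>ts\<close> lists the transitions of \<open>x\<close> at level \<open>k\<close>
  with multiplicity, in no particular order.\<close>

definition sums :: "nat \<Rightarrow> ('a \<Rightarrow> int) family \<Rightarrow> (nat \<times> 'a) list \<Rightarrow> bool" where
  "sums k x ts \<longleftrightarrow> (\<forall>j>k. \<forall>\<alpha>. x j \<alpha> = (\<Sum>t\<leftarrow>ts. opt_atom (Some t) j \<alpha>))"

lemma sums_after:
  assumes "x \<in> all_cells" "set ts \<subseteq> transitions k" "sums k x ts"
  shows "x k Plus = net.after k (x k Minus) ts"
  using all_cells_d[OF assms(1), of k Plus] sum_d_tr[OF assms(2), of Plus] assms(3)
  by (simp add: sums_def net.after_def)

lemma sums_mset: "mset ts = mset us \<Longrightarrow> sums k x ts \<longleftrightarrow> sums k x us"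
  by (simp only: sums_def sum_list_mset_cong[of ts us])

text \<open>Firing all of \<open>ts\<close> from \<open>x k Minus\<close> ends in
  \<open>x k Plus\<close>, which is nonnegative; \<open>firing_order\<close> turns this into an
  actual order.\<close>

lemma sums_firing:
  assumes "x \<in> all_cells" "set ts \<subseteq> transitions k" "sums k x ts"
  shows "\<exists>us. mset us = mset ts \<and> net.fires k (x k Minus) us"
proof (rule net.firing_order[OF assms(2) all_cells_nonneg[OF assms(1)]])
  show "0 \<le> x k Minus + (\<Sum>t\<leftarrow>ts. post k t - pre k t)"
    using all_cells_nonneg[OF assms(1), of k Plus] unfolding sums_after[OF assms] net.after_def .
qed

lemma pairs_Tr: "set es \<subseteq> S (Suc k) \<Longrightarrow> set (map (Pair (Suc k)) es) \<subseteq> transitions k"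
  by (auto simp: transitions_def)

lemma sum_pairs:
  assumes "k < j"
  shows "(\<Sum>t\<leftarrow>map (Pair (Suc k)) es. opt_atom (Some t) j \<alpha>) = (if j = Suc k then \<Sum>e\<leftarrow>es. single e else 0)"
  using assms by (induction es) auto

lemma safe_of_bound:
  assumes "\<And>g f. g \<in> cells_above k None \<Longrightarrow> g k Minus f \<le> 1" "g \<in> cells_above k None"
  shows "net.safe k (g k Minus)"
  unfolding net.safe_def
proof (intro allI impI)
  fix ts f
  assume "set ts \<subseteq> transitions k \<and> net.fires k (g k Minus) ts"
  then show "net.after k (g k Minus) ts f \<le> 1"
    using assms(1)[OF fires_cls[OF assms(2)], of ts f] by (simp add: set_level_def)
qed

text \<open>The coefficients of the top entry are multiplicities in a firing sequence of the net one
  level below. That net is safe by the induction hypothesis, applied to all cells reachable from the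
  source of \<open>g\<close>, and a safe acyclic net fires no transition twice.\<close>

lemma cell_bound: "g \<in> cells_above k None \<Longrightarrow> g k \<alpha> f \<le> 1"
proof (induction k arbitrary: g \<alpha> f)
  case 0
  then obtain b where "g 0 \<alpha> = single b" using Cell_0_single[of g \<alpha>] cells_aboveD(1) by blast
  then show ?case by (simp add: single_def)
next
  case (Suc k)
  note g = cells_aboveD(1)[OF Suc.prems]
  obtain es where es: "set es \<subseteq> S (Suc k)" "g (Suc k) Minus = (\<Sum>e\<leftarrow>es. single e)"
    using nonneg_chain_sum[OF all_cells_chain[OF g] all_cells_nonneg[OF g]] by blast
  have top: "g (Suc k) \<alpha> = (\<Sum>e\<leftarrow>es. single e)" for \<alpha>
    using es(2) cells_above_None_eq[OF Suc.prems, of \<alpha> Minus] by simp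
  have "sums k g (map (Pair (Suc k)) es)"
    unfolding sums_def
  proof (intro allI impI)
    fix j \<alpha> assume "k < j"
    then show "g j \<alpha> = (\<Sum>t\<leftarrow>map (Pair (Suc k)) es. opt_atom (Some t) j \<alpha>)"
      using top[of \<alpha>] cells_aboveD(2)[OF Suc.prems, of j \<alpha>] unfolding sum_pairs[OF \<open>k < j\<close>] by auto
  qed
  then obtain us where us: "mset us = mset (map (Pair (Suc k)) es)" "net.fires k (g k Minus) us"
    using sums_firing[OF g pairs_Tr[OF es(1)]] by blast
  have "net.safe k (cface k Minus g k Minus)"
    using Suc.IH cface_cls[OF g] by (intro safe_of_bound)
  then have "net.safe k (g k Minus)" by (simp add: cface_def)
  moreover have "set us \<subseteq> transitions k" using pairs_Tr[OF es(1)] us(1) by (metis set_mset_mset)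
  ultimately have "distinct us" using us(2) net.distinct_firing by blast
  then have "distinct es" using us(1) by (metis distinct_map mset_eq_imp_distinct_iff)
  then have "count (mset es) f \<le> 1" by (simp add: distinct_count_atmost_1)
  then show ?case
    using sum_single_count[of es f] top[of \<alpha>] by simp
qed

lemma cell_safe: "g \<in> cells_above k None \<Longrightarrow> net.safe k (g k Minus)"
  using safe_of_bound cell_bound by blast

section \<open>Factorization of cells into atoms\<close>

definition valid :: "nat \<Rightarrow> nat \<Rightarrow> (nat \<times> 'a) option \<Rightarrow> bool" where
  "valid N k ob \<longleftrightarrow> (\<forall>t. ob = Some t \<longrightarrow> t \<in> transitions k \<and> fst t \<le> N)"

text \<open>The transitions at level \<open>k\<close> of a cell in
  \<open>cells_above (Suc k) ob\<close>: the one named by \<open>ob\<close>, if any, and the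
  elements \<open>es\<close> of degree \<open>Suc k\<close>, which are places at level
  \<open>Suc k\<close> but transitions at level \<open>k\<close>.\<close>

definition labels :: "nat \<Rightarrow> (nat \<times> 'a) option \<Rightarrow> 'a list \<Rightarrow> (nat \<times> 'a) list" where
  "labels k ob es = (case ob of None \<Rightarrow> [] | Some t \<Rightarrow> [t]) @ map (Pair (Suc k)) es"

lemma labels_sums:
  assumes "x \<in> cells_above (Suc k) ob"
  shows "sums k x (labels k ob es) \<longleftrightarrow> (\<forall>\<alpha>. x (Suc k) \<alpha> = opt_atom ob (Suc k) \<alpha> + (\<Sum>e\<leftarrow>es. single e))"
proof -
  have "(\<Sum>t\<leftarrow>labels k ob es. opt_atom (Some t) j \<alpha>)
      = opt_atom ob j \<alpha> + (if j = Suc k then \<Sum>e\<leftarrow>es. single e else 0)" if "k < j" for j \<alpha>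
    using sum_pairs[OF that, where es = es and \<alpha> = \<alpha>] by (auto simp: labels_def split: option.split)
  then show ?thesis
    using cells_aboveD(2)[OF assms] unfolding sums_def
    by (auto simp: less_Suc_eq)
qed

lemma valid_None [simp]: "valid N k None"
  and valid_Some: "valid N k (Some t) \<longleftrightarrow> t \<in> transitions k \<and> fst t \<le> N"
  by (simp_all add: valid_def)

lemma labels_Tr:
  assumes "valid N (Suc k) ob" "set es \<subseteq> S (Suc k)" "k < N"
  shows "set (labels k ob es) \<subseteq> {t \<in> transitions k. fst t \<le> N}"
  using assms pairs_Tr[OF assms(2)]
  by (auto simp: labels_def valid_def transitions_Suc split: option.splits)

text \<open>In degree \<open>Suc k\<close> the cell exceeds the atom of \<open>ob\<close> by a
  nonnegative chain, and the boundary condition makes this excess the same for both signs; its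
  summands are \<open>es\<close>.\<close>

lemma cells_above_labels:
  assumes "x \<in> cells_above (Suc k) ob" "valid N (Suc k) ob"
  shows "\<exists>es. set es \<subseteq> S (Suc k) \<and> sums k x (labels k ob es)"
proof -
  note x = cells_aboveD(1)[OF assms(1)]
  let ?c = "x (Suc k) Minus - opt_atom ob (Suc k) Minus"
  have le: "opt_atom ob (Suc k) Minus \<le> x (Suc k) Minus"
    using atm_le_Cell assms all_cells_nonneg[OF x] by (cases ob) (auto simp: valid_def)
  have "?c \<in> chains (S (Suc k))"
    using assms(2) tr_chain all_cells_chain[OF x] by (cases ob) (auto simp: valid_def intro!: chains_diff)
  moreover have "0 \<le> ?c" using le by (auto simp: le_fun_def)
  ultimately obtain es where es: "set es \<subseteq> S (Suc k)" "?c = (\<Sum>e\<leftarrow>es. single e)"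
    using nonneg_chain_sum by blast
  have "x (Suc k) \<alpha> = opt_atom ob (Suc k) \<alpha> + ?c" for \<alpha>
  proof (cases ob)
    case None
    then show ?thesis using cells_above_None_eq[of x "Suc k" \<alpha> Minus] assms(1) by simp
  next
    case (Some t)
    then show ?thesis using cells_above_trD[of x "Suc k" t] assms
      by (cases \<alpha>) (auto simp: valid_def algebra_simps)
  qed
  then show ?thesis using es labels_sums[OF assms(1)] by metis
qed

text \<open>Closed form of the composite along dimension \<open>k\<close> of the cells of the
  transitions \<open>ts\<close>, started at \<open>g\<close>; the recursion is
  \<open>path_cell_Cons\<close>.\<close>

definition path_cell :: "nat \<Rightarrow> ('a \<Rightarrow> int) family \<Rightarrow> (nat \<times> 'a) list \<Rightarrow> nat \<Rightarrow> sign \<Rightarrow> 'a \<Rightarrow> int" where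
  "path_cell k g ts = (\<lambda>j \<beta>. if j < k then g j \<beta>
     else if j = k then (if \<beta> = Minus then g k Minus else net.after k (g k Minus) ts)
     else \<Sum>t\<leftarrow>ts. opt_atom (Some t) j \<beta>)"

lemma path_cell_eq:
  assumes "x \<in> all_cells" "set ts \<subseteq> transitions k" "sums k x ts"
  shows "path_cell k (cface k Minus x) ts = x"
proof (intro ext)
  fix j \<beta> f
  show "path_cell k (cface k Minus x) ts j \<beta> f = x j \<beta> f"
    using assms(3) sums_after[OF assms]
    by (cases j k rule: linorder_cases; cases \<beta>) (auto simp: path_cell_def cface_def sums_def)
qed

lemma path_cell_Nil: "g \<in> cells_above k None \<Longrightarrow> path_cell k g [] = g"
  using cells_aboveD(2)[of g k None] cells_above_None_eq[of g k] by (auto simp: path_cell_def fun_eq_iff)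

lemma cface_pathc: "g \<in> cells_above k None \<Longrightarrow> cface k Minus (path_cell k g ts) = g"
  using cells_aboveD(2)[of g k None] cells_above_None_eq[of g k] by (auto simp: path_cell_def cface_def fun_eq_iff)

lemma path_cell_Cons:
  assumes "g \<in> cells_above k None" "t \<in> transitions k" "pre k t \<le> g k Minus"
  shows "cface k Minus (path_cell k (fire k g t) ts) = cface k Plus (transition_cell k g t)"
    "ccomp k (path_cell k (fire k g t) ts) (transition_cell k g t) = path_cell k g (t # ts)"
proof -
  show e: "cface k Minus (path_cell k (fire k g t) ts) = cface k Plus (transition_cell k g t)"
    using assms by (simp add: cface_pathc fire_cls cface_tcell)
  show "ccomp k (path_cell k (fire k g t) ts) (transition_cell k g t) = path_cell k g (t # ts)"
    by (intro ccomp_eqI e) (auto simp: path_cell_def transition_cell_def fire_at)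
qed

lemma path_induct:
  assumes "\<And>g. g \<in> cells_above k None \<Longrightarrow> P g"
    and "\<And>t x. t \<in> transitions k \<Longrightarrow> fst t \<le> N \<Longrightarrow> x \<in> cells_above k (Some t) \<Longrightarrow> P x"
    and "\<And>x y. \<lbrakk>x \<in> all_cells; y \<in> all_cells; cface k Minus x = cface k Plus y; P x; P y\<rbrakk> \<Longrightarrow> P (ccomp k x y)"
    and "g \<in> cells_above k None" "set ts \<subseteq> {t \<in> transitions k. fst t \<le> N}" "net.fires k (g k Minus) ts"
  shows "path_cell k g ts \<in> all_cells \<and> P (path_cell k g ts)"
  using assms(4-6)
proof (induction ts arbitrary: g)
  case Nil
  then show ?case using assms(1) cells_aboveD(1) by (simp add: path_cell_Nil)
next
  case (Cons t ts)
  then have t: "t \<in> transitions k" "pre k t \<le> g k Minus" "fst t \<le> N" by auto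
  note e = path_cell_Cons[OF Cons.prems(1) t(1,2), of ts]
  have tc: "transition_cell k g t \<in> cells_above k (Some t)" using transition_cell_cls Cons.prems(1) t by blast
  have "path_cell k (fire k g t) ts \<in> all_cells \<and> P (path_cell k (fire k g t) ts)"
    using Cons.prems fire_cls[OF Cons.prems(1) t(1,2)] by (intro Cons.IH) (auto simp: fire_at)
  then have "ccomp k (path_cell k (fire k g t) ts) (transition_cell k g t) \<in> all_cells
      \<and> P (ccomp k (path_cell k (fire k g t) ts) (transition_cell k g t))"
    using e(1) assms(2)[OF t(1,3) tc] cells_aboveD(1)[OF tc]
    by (intro conjI all_cells_ccomp assms(3)) auto
  then show ?case by (simp only: e(2))
qed

lemma path_cell_Cell: "\<lbrakk>g \<in> cells_above k None; set ts \<subseteq> transitions k; net.fires k (g k Minus) ts\<rbrakk> \<Longrightarrow> path_cell k g ts \<in> all_cells"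
  using path_induct[of k "\<lambda>_. True" "Max (fst ` set ts)" g ts] by (auto simp: subset_iff)

text \<open>A firing order of the transitions of \<open>x\<close> at level \<open>k\<close> exhibits
  \<open>x\<close> as a composite along dimension \<open>k\<close> of cells of level
  \<open>k\<close>. The condition \<open>k < N\<close> keeps the new transitions, of degree
  \<open>Suc k\<close>, within dimension \<open>N\<close>.\<close>

lemma cells_above_Suc_induct:
  assumes "\<And>ob x. valid N k ob \<Longrightarrow> x \<in> cells_above k ob \<Longrightarrow> P x"
    and "\<And>x y. \<lbrakk>x \<in> all_cells; y \<in> all_cells; cface k Minus x = cface k Plus y; P x; P y\<rbrakk> \<Longrightarrow> P (ccomp k x y)"
    and "k < N" "valid N (Suc k) ob" "x \<in> cells_above (Suc k) ob"
  shows "P x"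
proof -
  note x = cells_aboveD(1)[OF assms(5)]
  obtain es where es: "set es \<subseteq> S (Suc k)" "sums k x (labels k ob es)"
    using cells_above_labels[OF assms(5,4)] by blast
  note T = labels_Tr[OF assms(4) es(1) assms(3)]
  then obtain ts where ts: "mset ts = mset (labels k ob es)" "net.fires k (x k Minus) ts"
    using sums_firing[OF x _ es(2)] by blast
  have T': "set ts \<subseteq> {t \<in> transitions k. fst t \<le> N}" using T ts(1) by (metis set_mset_mset)
  have "path_cell k (cface k Minus x) ts \<in> all_cells \<and> P (path_cell k (cface k Minus x) ts)"
  proof (rule path_induct[where P = P and N = N, OF _ _ assms(2) cface_cls[OF x] T'])
    show "P g" if "g \<in> cells_above k None" for g using assms(1) that valid_None by blast
    show "P x" if "t \<in> transitions k" "fst t \<le> N" "x \<in> cells_above k (Some t)" for t x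
      using assms(1) that valid_Some by blast
    show "net.fires k (cface k Minus x k Minus) ts" using ts(2) by (simp add: cface_def)
  qed
  moreover have "path_cell k (cface k Minus x) ts = x"
    using T' es(2) sums_mset[OF ts(1)] by (intro path_cell_eq x) auto
  ultimately show ?thesis by simp
qed

text \<open>Above degree 0 the cell agrees with the atom by definition of the class. In degree 0
  both are single basis elements and one dominates the other, so they coincide. Without a transition
  the cell is the atom of a basis element of degree 0.\<close>

lemma cls_0_atm:
  assumes "valid N 0 ob" "x \<in> cells_above 0 ob"
  shows "\<exists>p b. b \<in> S p \<and> p \<le> N \<and> x = atm p b \<and> x \<in> cells_above 0 (Some (p, b))"
proof (cases ob)
  case None
  obtain b where b: "b \<in> S 0" "x 0 Minus = single b"
    using Cell_0_single cells_aboveD(1)[OF assms(2)] by blast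
  have "x j \<alpha> = atm 0 b j \<alpha>" for j \<alpha>
    using cells_aboveD(2)[of x 0 None j \<alpha>] cells_above_None_eq[of x 0 \<alpha> Minus] assms(2) None b
    by (cases "j = 0") auto
  then have "x = atm 0 b" by blast
  then show ?thesis using b atm_cls(1) by blast
next
  case (Some t)
  then obtain p b where t: "t = (p, b)" "b \<in> S p" "0 < p" "p \<le> N"
    using assms(1) by (auto simp: valid_def transitions_def)
  have eq: "x 0 \<alpha> = atm p b 0 \<alpha>" for \<alpha>
  proof -
    obtain c c' where "x 0 \<alpha> = single c" "atm p b 0 \<alpha> = single c'"
      using Cell_0_single[OF cells_aboveD(1)[OF assms(2)], of \<alpha>] Cell_0_single[OF atm_Cell[OF t(2)], of \<alpha>]
      by auto
    moreover have "atm p b 0 \<alpha> \<le> x 0 \<alpha>"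
      using atm_le_Cell[of x 0 t \<alpha>] assms(2) Some t by (simp add: transitions_def)
    ultimately show ?thesis
      by (metis le_funD not_one_le_zero single_other single_self)
  qed
  have "x j \<alpha> = atm p b j \<alpha>" for j \<alpha>
    using cells_aboveD(2)[of x 0 ob j \<alpha>] assms(2) Some t(1) eq by (cases "j = 0") auto
  then have "x = atm p b" by blast
  then show ?thesis using t atm_cls(1) by blast
qed

text \<open>Iterating the factorization lowers the level to 0, where only atoms are left: the
  \<open>N\<close>-cells are generated by atoms under composition.\<close>

lemma cell_induct [consumes 1, case_names atm comp]:
  assumes "x \<in> cells_above N None"
    and "\<And>p b. b \<in> S p \<Longrightarrow> p \<le> N \<Longrightarrow> P (atm p b)"
    and "\<And>k x y. \<lbrakk>k < N; x \<in> cells_above N None; y \<in> cells_above N None; cface k Minus x = cface k Plus y; P x; P y\<rbrakk>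
      \<Longrightarrow> P (ccomp k x y)"
  shows "P x"
proof -
  let ?P = "\<lambda>x. x \<in> cells_above N None \<and> P x"
  have "?P x" if "valid N k ob" "x \<in> cells_above k ob" "k \<le> N" for k ob x
    using that
  proof (induction k arbitrary: ob x)
    case 0
    then obtain p b where "b \<in> S p" "p \<le> N" "x = atm p b" using cls_0_atm by blast
    then show ?case using assms(2) atm_cls(2) by blast
  next
    case (Suc k)
    show ?case
    proof (rule cells_above_Suc_induct[OF _ _ _ Suc.prems(1,2)])
      show "?P x" if "valid N k ob" "x \<in> cells_above k ob" for ob x using Suc that by simp
      show "k < N" using Suc by simp
      show "?P (ccomp k x y)"
        if "x \<in> all_cells" "y \<in> all_cells" "cface k Minus x = cface k Plus y" "?P x" "?P y" for x y
      proof -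
        have "ccomp k x y \<in> cells_above N None"
          using that \<open>k < N\<close> all_cells_ccomp by (auto simp: cells_above_def ccomp_above)
        then show ?thesis using that \<open>k < N\<close> assms(3) by blast
      qed
    qed
  qed
  then show ?thesis using assms(1) valid_None by blast
qed

section \<open>Decompositions of a cell of given level\<close>

lemma nonneg_sum_0:
  fixes f g :: "'a \<Rightarrow> int"
  assumes "0 \<le> f" "0 \<le> g" "f + g = 0"
  shows "f = 0" "g = 0"
proof -
  have "0 \<le> f z \<and> 0 \<le> g z \<and> f z + g z = 0" for z
    using assms by (auto simp: le_fun_def fun_eq_iff)
  then have "f z = 0 \<and> g z = 0" for z by (smt (verit))
  then show "f = 0" "g = 0" by (auto simp: fun_eq_iff)
qed

lemma nonneg_sum_single:
  fixes f g :: "'a \<Rightarrow> int"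
  assumes "0 \<le> f" "0 \<le> g" "f + g = single b"
  shows "f = single b \<and> g = 0 \<or> f = 0 \<and> g = single b"
proof -
  have z: "0 \<le> f z \<and> 0 \<le> g z \<and> f z + g z = single b z" for z
    using assms(1,2) fun_cong[OF assms(3), of z] by (auto simp: le_fun_def)
  have o: "f z = 0 \<and> g z = 0" if "z \<noteq> b" for z
    using z[of z] single_other[OF that] by (smt (verit))
  have "f b = 1 \<and> g b = 0 \<or> f b = 0 \<and> g b = 1" using z[of b] by auto
  then show ?thesis
  proof
    assume "f b = 1 \<and> g b = 0"
    then have "f z = single b z" "g z = 0" for z using o[of z] by (auto simp: single_def)
    then show ?thesis by (auto simp: fun_eq_iff)
  next
    assume "f b = 0 \<and> g b = 1"
    then have "f z = 0" "g z = single b z" for z using o[of z] by (auto simp: single_def)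
    then show ?thesis by (auto simp: fun_eq_iff)
  qed
qed

text \<open>The factor containing the top element \<open>b\<close> dominates the atom of
  \<open>b\<close> in each lower degree above \<open>m\<close>, by minimality of signed parts and
  descending induction from \<open>p\<close>. As the factors are nonnegative and add up to the atom,
  the other factor vanishes above \<open>m\<close>.\<close>

lemma split_atm:
  assumes "x \<in> all_cells" "y \<in> all_cells" "b \<in> S p" "m < p"
    and sum: "\<And>i \<alpha>. m < i \<Longrightarrow> x i \<alpha> + y i \<alpha> = atm p b i \<alpha>"
    and top: "\<And>\<alpha>. x p \<alpha> = single b"
  shows "x \<in> cells_above m (Some (p, b))" "y \<in> cells_above m None"
proof -
  have main: "x i \<alpha> = atm p b i \<alpha> \<and> y i \<alpha> = 0" if "m < i" for i \<alpha>
  proof (cases "i \<le> p")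
    case True
    have "m < p - n \<Longrightarrow> x (p - n) \<alpha> = atm p b (p - n) \<alpha>" for n
    proof (induction n)
      case (Suc n)
      let ?i = "p - Suc n"
      have i: "Suc ?i = p - n" "?i < p" using Suc.prems by auto
      have "signed \<alpha> (d ?i (x (Suc ?i) \<alpha>)) = atm p b ?i \<alpha>"
        using signed_d_atm[OF assms(3) i(2)] Suc i(1) by simp
      then have "atm p b ?i \<alpha> \<le> x ?i \<alpha>" using signed_le_Cell[OF assms(1), of \<alpha> ?i \<alpha>] by simp
      then have "0 \<le> x ?i \<alpha> - atm p b ?i \<alpha>" by (auto simp: le_fun_def)
      moreover have "x ?i \<alpha> - atm p b ?i \<alpha> + y ?i \<alpha> = 0"
        using sum[OF Suc.prems, of \<alpha>] by (simp add: algebra_simps)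
      ultimately have "x ?i \<alpha> - atm p b ?i \<alpha> = 0"
        using nonneg_sum_0(1) all_cells_nonneg[OF assms(2)] by blast
      then show ?case by simp
    qed (use top in simp)
    from this[of "p - i"] have "x i \<alpha> = atm p b i \<alpha>" using True that by simp
    then show ?thesis using sum[OF that, of \<alpha>] by simp
  next
    case False
    then have "x i \<alpha> + y i \<alpha> = 0" using sum[OF that, of \<alpha>] by simp
    then show ?thesis
      using False nonneg_sum_0[OF all_cells_nonneg[OF assms(1)] all_cells_nonneg[OF assms(2)]] by simp
  qed
  then show "x \<in> cells_above m (Some (p, b))" "y \<in> cells_above m None" using assms(1,2) by (auto simp: cells_above_def)
qed

lemma ccomp_id:
  assumes "cface j Minus x = cface j Plus y"
  shows "x \<in> cells_above j None \<Longrightarrow> ccomp j x y = y" "y \<in> cells_above j None \<Longrightarrow> ccomp j x y = x"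
  using cface_id[of x j j Minus] cface_id[of y j j Plus] assms ccomp_unit by auto

text \<open>A cell with at most one atom above level \<open>k\<close> can be cut along dimension
  \<open>j\<close> only so that one factor carries the whole atom. For \<open>k \<le> j\<close> the
  other factor is an identity for composition along \<open>j\<close>, so the cut is trivial; for
  \<open>j < k\<close> both factors stay in classes of level \<open>k\<close>.\<close>

lemma ccomp_split:
  assumes x: "x \<in> all_cells" and y: "y \<in> all_cells" and e: "cface j Minus x = cface j Plus y"
    and c: "ccomp j x y \<in> cells_above k ob" "valid N k ob"
  shows "x \<in> cells_above (max j k) None \<and> y \<in> cells_above k ob \<or> x \<in> cells_above k ob \<and> y \<in> cells_above (max j k) None"
proof -
  have sum: "x i \<alpha> + y i \<alpha> = opt_atom ob i \<alpha>" if "max j k < i" for i \<alpha>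
    using that cells_aboveD(2)[OF c(1), of i \<alpha>] ccomp_above[of j i x y \<alpha>] by simp
  have triv: ?thesis if "\<And>i \<alpha>. max j k < i \<Longrightarrow> opt_atom ob i \<alpha> = 0" "k \<le> j"
  proof -
    have "x i \<alpha> = 0" if "max j k < i" for i \<alpha>
      using sum[OF that, of \<alpha>] \<open>\<And>i \<alpha>. max j k < i \<Longrightarrow> opt_atom ob i \<alpha> = 0\<close>[OF that, of \<alpha>]
      by (intro nonneg_sum_0(1)[OF all_cells_nonneg[OF x] all_cells_nonneg[OF y]]) simp
    then have "x \<in> cells_above (max j k) None" using x by (simp add: cells_above_def)
    moreover from this have "ccomp j x y = y" using ccomp_id(1)[OF e] that(2) by (simp add: max_absorb1)
    ultimately show ?thesis using c(1) by simp
  qed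
  show ?thesis
  proof (cases ob)
    case None
    show ?thesis
    proof (cases "k \<le> j")
      case False
      then have "x i \<alpha> = 0 \<and> y i \<alpha> = 0" if "k < i" for i \<alpha>
        using sum[of i \<alpha>] None that nonneg_sum_0[OF all_cells_nonneg[OF x] all_cells_nonneg[OF y], of i \<alpha> i \<alpha>]
        by simp
      then have "x \<in> cells_above k None \<and> y \<in> cells_above k None" using x y by (simp add: cells_above_def)
      then show ?thesis using None False by (simp add: max_absorb2)
    qed (use None triv in simp)
  next
    case (Some t)
    then obtain p b where t: "ob = Some (p, b)" "b \<in> S p" "k < p"
      using c(2) by (cases t) (auto simp: valid_def transitions_def)
    show ?thesis
    proof (cases "p \<le> j")
      case True
      then show ?thesis using triv t by simp
    next
      case False
      then have m: "max j k < p" using t by simp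
      have "x i \<alpha> = 0 \<and> y i \<alpha> = 0" if "p < i" for i \<alpha>
        using sum[of i \<alpha>] t m that nonneg_sum_0[OF all_cells_nonneg[OF x] all_cells_nonneg[OF y], of i \<alpha> i \<alpha>]
        by simp
      then have cp: "x \<in> cells_above p None" "y \<in> cells_above p None" using x y by (auto simp: cells_above_def)
      have sum': "max j k < i \<Longrightarrow> x i \<alpha> + y i \<alpha> = atm p b i \<alpha>" 
        "max j k < i \<Longrightarrow> y i \<alpha> + x i \<alpha> = atm p b i \<alpha>" for i \<alpha>
        using sum t(1) by (auto simp: add.commute)
      have "x p Minus = single b \<or> y p Minus = single b"
        using nonneg_sum_single[OF all_cells_nonneg[OF x] all_cells_nonneg[OF y], of p Minus p Minus b]
          sum'(1)[OF m, of Minus] by auto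
      then show ?thesis
      proof
        assume "x p Minus = single b"
        then have "x \<in> cells_above (max j k) ob" and y: "y \<in> cells_above (max j k) None"
          using split_atm[OF x y t(2) m sum'(1)] cells_above_None_eq[OF cp(1)] t(1) by metis+
        moreover have "x \<in> cells_above k ob" if "k \<le> j"
          using ccomp_id(2)[OF e] y c(1) that by (simp add: max_absorb1)
        ultimately show ?thesis by (metis max.absorb2 nle_le)
      next
        assume "y p Minus = single b"
        then have "y \<in> cells_above (max j k) ob" and x: "x \<in> cells_above (max j k) None"
          using split_atm[OF y x t(2) m sum'(2)] cells_above_None_eq[OF cp(2)] t(1) by metis+
        moreover have "y \<in> cells_above k ob" if "k \<le> j"
          using ccomp_id(1)[OF e] x c(1) that by (simp add: max_absorb1)
        ultimately show ?thesis by (metis max.absorb2 nle_le)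
      qed
    qed
  qed
qed

end

section \<open>Separating two independent transitions\<close>

context steiner_complex
begin

lemma split_two:
  assumes "mset ts = add_mset u (add_mset v E)"
  shows "\<exists>a b l1 l2. ts = l1 @ l2 \<and> a \<in> set l1 \<and> b \<in> set l2 \<and> (a = u \<and> b = v \<or> a = v \<and> b = u)"
proof -
  have "u \<in> set ts" using assms by (metis set_mset_mset union_single_eq_member add_mset_add_single union_commute)
  then obtain r1 r2 where ts: "ts = r1 @ u # r2" by (meson split_list)
  have "add_mset v E = mset r1 + mset r2" using assms by (simp add: ts)
  then have "v \<in># mset r1 + mset r2" by (metis union_single_eq_member)
  then consider "v \<in> set r1" | "v \<in> set r2" by auto
  then show ?thesis
  proof cases
    case 1
    then show ?thesis using ts by (intro exI[of _ v] exI[of _ u] exI[of _ r1] exI[of _ "u # r2"]) auto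
  next
    case 2
    then show ?thesis using ts by (intro exI[of _ u] exI[of _ v] exI[of _ "r1 @ [u]"] exI[of _ r2]) auto
  qed
qed

text \<open>Two transitions enabled together at level \<open>k = Suc i\<close> can be separated along a cell of
  dimension \<open>i\<close>; which of the two comes first is decided by the order of firing at level \<open>i\<close>.\<close>

lemma two_cells:
  assumes g: "g \<in> cells_above k None" and k: "k = Suc i" and u: "u \<in> transitions k" and v: "v \<in> transitions k"
    and le: "pre k u + pre k v \<le> g k Minus"
  shows "\<exists>a b P Q. (a = u \<and> b = v \<or> a = v \<and> b = u) \<and> P \<in> cells_above k (Some b) \<and> Q \<in> cells_above k (Some a) \<and>
    cface i Minus P = cface i Plus Q \<and>
    ccomp i (cface k Minus P) Q = transition_cell k g a \<and> ccomp i P (cface k Plus Q) = transition_cell k (fire k g a) b \<and>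
    ccomp i P (cface k Minus Q) = transition_cell k g b \<and> ccomp i (cface k Plus P) Q = transition_cell k (fire k g b) a"
proof -
  note gC = cells_aboveD(1)[OF g]
  let ?c = "g k Minus - pre k u - pre k v"
  have c0: "0 \<le> ?c" using le by (auto simp: le_fun_def algebra_simps)
  have "?c \<in> chains (S k)" using all_cells_chain[OF gC] tr_chain[OF u] tr_chain[OF v]
    by (intro chains_diff) auto
  then obtain es where es: "set es \<subseteq> S k" "?c = (\<Sum>e\<leftarrow>es. single e)"
    using nonneg_chain_sum[OF _ c0] by blast
  \<comment> \<open>The source \<open>g k Minus\<close> is \<open>pre k u + pre k v\<close> plus
    basis elements \<open>es\<close>. One level lower \<open>u\<close>, \<open>v\<close> and
    \<open>es\<close> are all transitions, and together they lead from \<open>g i Minus\<close> to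
    \<open>g i Plus\<close>, so they admit a firing order.\<close>
  let ?labels = "u # v # map (Pair k) es"
  have labT: "set ?labels \<subseteq> transitions i"
    using u v k pairs_Tr[of es i] es(1) by (auto simp: transitions_Suc)
  have gk: "g k Minus = (\<Sum>t\<leftarrow>?labels. opt_atom (Some t) (Suc i) Minus)"
  proof -
    have "g k Minus = pre k u + (pre k v + ?c)" by (simp add: algebra_simps)
    then show ?thesis unfolding es(2) using sum_pairs[where k = i and j = k and es = es and \<alpha> = Minus] k by simp
  qed
  have after_lab: "net.after i (g i Minus) ?labels = g i Plus"
    unfolding net.after_def sum_d_tr[OF labT, of Minus] gk[symmetric]
    using all_cells_d[OF gC, of i Minus] k by simp
  then have "0 \<le> g i Minus + (\<Sum>t\<leftarrow>?labels. post i t - pre i t)"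
    using all_cells_nonneg[OF gC, of i Plus] by (simp only: net.after_def)
  then obtain ts where ts: "mset ts = mset ?labels" "net.fires i (g i Minus) ts"
    using net.firing_order[OF labT all_cells_nonneg[OF gC]] by blast
  have after_ts: "net.after i (g i Minus) ts = g i Plus"
    using after_lab unfolding net.after_def sum_list_mset_cong[OF ts(1), of "\<lambda>t. post i t - pre i t"] .
  have "mset ts = add_mset u (add_mset v (mset (map (Pair k) es)))" using ts(1) by simp
  from split_two[OF this] obtain a b l1 l2 where l: "ts = l1 @ l2" "a \<in> set l1" "b \<in> set l2"
    and ab: "a = u \<and> b = v \<or> a = v \<and> b = u" by blast
  let ?r1 = "remove1 a l1" and ?r2 = "remove1 b l2"
  have "mset ?labels = {#a, b#} + mset (map (Pair k) es)" using ab by (auto simp: add_mset_commute)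
  moreover have m: "mset l1 = add_mset a (mset ?r1)" "mset l2 = add_mset b (mset ?r2)"
    using l by simp_all
  have "mset ts = {#a, b#} + mset ?r1 + mset ?r2"
    unfolding l(1) mset_append m by (simp del: mset_remove1)
  ultimately have "{#a, b#} + mset (map (Pair k) es) = {#a, b#} + mset (?r1 @ ?r2)"
    using ts(1) by (simp only: mset_append add.assoc)
  then have E: "mset (map (Pair k) es) = mset (?r1 @ ?r2)" by (simp only: add_left_cancel)
  have "set (?r1 @ ?r2) \<subseteq> set (map (Pair k) es)" using E by (metis set_mset_mset order_refl)
  then have fst_r: "fst t = k" if "t \<in> set ?r1 \<union> set ?r2" for t
    using that by force
  define W where "W r = (\<Sum>t\<leftarrow>r. opt_atom (Some t) k Minus)" for r
  have sum_r: "(\<Sum>t\<leftarrow>r. opt_atom (Some t) j \<alpha>) = (if j = k then W r else 0)"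
    if "k \<le> j" "set r \<subseteq> set ?r1 \<union> set ?r2" for r j \<alpha>
    using that(2)
  proof (induction r)
    case (Cons t r)
    then have "fst t = k" using fst_r by auto
    then have "opt_atom (Some t) j \<alpha> = (if j = k then opt_atom (Some t) k Minus else 0)"
      using that(1) by (cases t) auto
    then show ?case using Cons by (auto simp: W_def)
  qed (simp add: W_def)
  let ?h = "cface i Minus g"
  have h: "?h \<in> cells_above i None" by (rule cface_cls[OF gC])
  have hi: "?h i Minus = g i Minus" by (simp add: cface_def)
  let ?s1 = "net.after i (g i Minus) l1"
  let ?h1 = "set_level i ?h ?s1"
  have T: "set l1 \<subseteq> transitions i" "set l2 \<subseteq> transitions i"
    using labT l(1) ts(1) by (metis set_append le_supE set_mset_mset)+
  have f: "net.fires i (?h i Minus) l1" "net.fires i (?h1 i Minus) l2"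
    using ts(2) by (simp_all add: l(1) net.fires_append hi) (simp add: set_level_def)
  have h1: "?h1 \<in> cells_above i None" using fires_cls[OF h T(1) f(1)] by (simp only: hi)
  \<comment> \<open>The firing order is cut between the two transitions: \<open>a\<close> lies in
    \<open>l1\<close> and \<open>b\<close> in \<open>l2\<close>. All other members of the two pieces
    have degree \<open>k\<close>, so above degree \<open>k\<close> only the atom of \<open>a\<close>
    survives in \<open>?Q\<close> and only that of \<open>b\<close> in \<open>?P\<close>.\<close>
  let ?Q = "path_cell i ?h l1" and ?P = "path_cell i ?h1 l2"
  have QC: "?Q \<in> all_cells" and PC: "?P \<in> all_cells" using path_cell_Cell h h1 T f by blast+
  have Qj: "?Q j \<alpha> = opt_atom (Some a) j \<alpha> + (if j = k then W ?r1 else 0)" if "k \<le> j" for j \<alpha>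
    using that k sum_list_map_remove1[OF l(2), of "\<lambda>t. opt_atom (Some t) j \<alpha>"] sum_r[OF that, of ?r1 \<alpha>]
    by (auto simp: path_cell_def)
  have Pj: "?P j \<alpha> = opt_atom (Some b) j \<alpha> + (if j = k then W ?r2 else 0)" if "k \<le> j" for j \<alpha>
    using that k sum_list_map_remove1[OF l(3), of "\<lambda>t. opt_atom (Some t) j \<alpha>"] sum_r[OF that, of ?r2 \<alpha>]
    by (auto simp: path_cell_def)
  have low: "?Q j \<beta> = g j \<beta>" "?P j \<beta> = g j \<beta>" if "j < i" for j \<beta>
    using that by (auto simp: path_cell_def cface_def set_level_def)
  have Qi: "?Q i Minus = g i Minus" "?Q i Plus = ?s1"
    by (simp_all add: path_cell_def hi)
  have Pi: "?P i Minus = ?s1" "?P i Plus = g i Plus"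
    using after_ts by (simp_all add: path_cell_def set_level_def l(1) net.after_append)
  have gk': "g k Minus = pre k a + pre k b + W ?r1 + W ?r2"
  proof -
    have "g k Minus = (\<Sum>t\<leftarrow>ts. opt_atom (Some t) k Minus)"
      using gk unfolding sum_list_mset_cong[OF ts(1), of "\<lambda>t. opt_atom (Some t) k Minus"] k[symmetric] .
    also have "\<dots> = (\<Sum>t\<leftarrow>l1. opt_atom (Some t) k Minus) + (\<Sum>t\<leftarrow>l2. opt_atom (Some t) k Minus)"
      by (simp add: l(1))
    finally show ?thesis
      using sum_list_map_remove1[OF l(2), of "\<lambda>t. opt_atom (Some t) k Minus"]
        sum_list_map_remove1[OF l(3), of "\<lambda>t. opt_atom (Some t) k Minus"]
      by (simp add: W_def algebra_simps)
  qed
  have ik: "i < k" using k by simp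
  have e: "cface i Minus ?P = cface i Plus ?Q"
    using low Qi Pi by (auto simp: cface_def fun_eq_iff)
  have e1: "cface i Minus (cface k \<alpha> ?P) = cface i Plus ?Q"
    and e2: "cface i Minus ?P = cface i Plus (cface k \<alpha> ?Q)" for \<alpha>
    using e ik by (simp_all add: cface_cface)
  have cells_above: "?P \<in> cells_above k (Some b)" "?Q \<in> cells_above k (Some a)" using PC QC Pj Qj by (auto simp: cells_above_def)
  have mid: "j = i \<or> j < i \<or> j = k \<or> k < j" for j using k by linarith
  have sg: "\<beta> = Minus \<or> \<beta> = Plus" for \<beta> using sign.exhaust by blast
  note simps = transition_cell_def fire_def set_level_def cface_def
  have A: "ccomp i (cface k Minus ?P) ?Q = transition_cell k g a"
    "ccomp i (cface k Plus ?P) ?Q = transition_cell k (fire k g b) a"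
  proof -
    show "ccomp i (cface k Minus ?P) ?Q = transition_cell k g a"
    proof (intro ccomp_eqI e1)
      fix j \<beta> assume "i < j"
      then show "transition_cell k g a j \<beta> = cface k Minus ?P j \<beta> + ?Q j \<beta>"
        using mid[of j] sg[of \<beta>] gk' Pj Qj by (auto simp: simps algebra_simps)
    qed (use ik low Qi Pi in \<open>auto simp: simps\<close>)
    show "ccomp i (cface k Plus ?P) ?Q = transition_cell k (fire k g b) a"
    proof (intro ccomp_eqI e1)
      fix j \<beta> assume "i < j"
      then show "transition_cell k (fire k g b) a j \<beta> = cface k Plus ?P j \<beta> + ?Q j \<beta>"
        using mid[of j] sg[of \<beta>] gk' Pj Qj by (auto simp: simps algebra_simps)
    qed (use ik low Qi Pi in \<open>auto simp: simps\<close>)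
  qed
  have B: "ccomp i ?P (cface k Plus ?Q) = transition_cell k (fire k g a) b"
    "ccomp i ?P (cface k Minus ?Q) = transition_cell k g b"
  proof -
    show "ccomp i ?P (cface k Plus ?Q) = transition_cell k (fire k g a) b"
    proof (intro ccomp_eqI e2)
      fix j \<beta> assume "i < j"
      then show "transition_cell k (fire k g a) b j \<beta> = ?P j \<beta> + cface k Plus ?Q j \<beta>"
        using mid[of j] sg[of \<beta>] gk' Pj Qj by (auto simp: simps algebra_simps)
    qed (use ik low Qi Pi in \<open>auto simp: simps\<close>)
    show "ccomp i ?P (cface k Minus ?Q) = transition_cell k g b"
    proof (intro ccomp_eqI e2)
      fix j \<beta> assume "i < j"
      then show "transition_cell k g b j \<beta> = ?P j \<beta> + cface k Minus ?Q j \<beta>"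
        using mid[of j] sg[of \<beta>] gk' Pj Qj by (auto simp: simps algebra_simps)
    qed (use ik low Qi Pi in \<open>auto simp: simps\<close>)
  qed
  show ?thesis using ab cells_above e A B by blast
qed

lemma fire_commute: "fire k (fire k g u) v = fire k (fire k g v) u"
  by (simp add: fire_def set_level_def fun_eq_iff)

lemma atm_cls_valid:
  assumes "b \<in> S p" "atm p b \<in> cells_above k ob" "valid N k ob"
  shows "p \<le> k \<and> ob = None \<or> k < p \<and> ob = Some (p, b)"
proof (cases ob)
  case None
  then show ?thesis using cells_aboveD(2)[OF assms(2), of p Minus] by (cases "k < p") auto
next
  case (Some t)
  then obtain q c where t: "ob = Some (q, c)" "k < q" using assms(3) by (cases t) (auto simp: valid_def transitions_def)
  have "atm p b q Minus = single c" using cells_aboveD(2)[OF assms(2) t(2), of Minus] t by simp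
  then have "q \<le> p" by (metis atm_above linorder_not_le single_neq_0)
  then have "atm q c p Minus = single b" using cells_aboveD(2)[OF assms(2), of p Minus] t by simp
  then have "p \<le> q" by (metis atm_above linorder_not_le single_neq_0)
  then show ?thesis using \<open>q \<le> p\<close> \<open>atm p b q Minus = single c\<close> t by auto
qed

end

section \<open>Freeness of the cells on the atoms\<close>

text \<open>A strict \<open>N\<close>-category in single-sorted form: cells of all dimensions are
  represented by their units in \<open>Y\<close>, and \<open>s k \<alpha>\<close> is the face
  regarded as an \<open>N\<close>-cell again. For \<open>k \<ge> N\<close> it is the identity, which
  spares case distinctions on dimension.\<close>

locale n_category =
  fixes N :: nat and Y :: "'c set" and s :: "nat \<Rightarrow> sign \<Rightarrow> 'c \<Rightarrow> 'c" and m :: "nat \<Rightarrow> 'c \<Rightarrow> 'c \<Rightarrow> 'c"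
  assumes s_Y: "y \<in> Y \<Longrightarrow> s k \<alpha> y \<in> Y"
    and s_s: "y \<in> Y \<Longrightarrow> s j \<alpha> (s k \<beta> y) = (if j < k then s j \<alpha> y else s k \<beta> y)"
    and s_top: "y \<in> Y \<Longrightarrow> N \<le> k \<Longrightarrow> s k \<alpha> y = y"
    and m_Y: "\<lbrakk>k < N; x \<in> Y; y \<in> Y; s k Minus x = s k Plus y\<rbrakk> \<Longrightarrow> m k x y \<in> Y"
    and s_m_Minus: "\<lbrakk>k < N; x \<in> Y; y \<in> Y; s k Minus x = s k Plus y\<rbrakk> \<Longrightarrow> s k Minus (m k x y) = s k Minus y"
    and s_m_Plus: "\<lbrakk>k < N; x \<in> Y; y \<in> Y; s k Minus x = s k Plus y\<rbrakk> \<Longrightarrow> s k Plus (m k x y) = s k Plus x"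
    and s_m: "\<lbrakk>k < N; x \<in> Y; y \<in> Y; s k Minus x = s k Plus y; k < j\<rbrakk> \<Longrightarrow>
      s j \<alpha> (m k x y) = m k (s j \<alpha> x) (s j \<alpha> y)"
    and m_unit_left: "\<lbrakk>k < N; y \<in> Y\<rbrakk> \<Longrightarrow> m k (s k Plus y) y = y"
    and m_unit_right: "\<lbrakk>k < N; y \<in> Y\<rbrakk> \<Longrightarrow> m k y (s k Minus y) = y"
    and m_assoc: "\<lbrakk>k < N; x \<in> Y; y \<in> Y; z \<in> Y; s k Minus x = s k Plus y; s k Minus y = s k Plus z\<rbrakk> \<Longrightarrow>
      m k (m k x y) z = m k x (m k y z)"
    and m_interchange: "\<lbrakk>j < k; k < N; x \<in> Y; y \<in> Y; z \<in> Y; w \<in> Y;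
        s k Minus x = s k Plus y; s k Minus z = s k Plus w;
        s j Minus x = s j Plus z; s j Minus y = s j Plus w\<rbrakk> \<Longrightarrow>
      m j (m k x y) (m k z w) = m k (m j x z) (m j y w)"
begin

lemma s_m_below:
  assumes "k < N" "x \<in> Y" "y \<in> Y" "s k Minus x = s k Plus y" "j < k"
  shows "s j \<alpha> (m k x y) = s j \<alpha> y"
proof -
  have "s j \<alpha> (m k x y) = s j \<alpha> (s k Minus (m k x y))"
    using assms by (simp add: s_s m_Y)
  also have "\<dots> = s j \<alpha> y" using assms by (simp add: s_m_Minus s_s)
  finally show ?thesis .
qed

end

text \<open>\<open>g p b\<close> is the value chosen for the atom of \<open>b\<close>; by
  \<open>s_g\<close> it is a cell of dimension \<open>p\<close> raised to dimension
  \<open>N\<close>. Conditions on its lower faces enter with \<open>closed_cell_lifting\<close>,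
  because their statement uses \<open>lifts\<close>.\<close>

locale cell_lifting = steiner_complex S d aug + n_category N Y s m
  for S :: "nat \<Rightarrow> 'a set" and d aug and N and Y :: "'c set" and s m +
  fixes g :: "nat \<Rightarrow> 'a \<Rightarrow> 'c"
  assumes g_Y: "b \<in> S p \<Longrightarrow> p \<le> N \<Longrightarrow> g p b \<in> Y"
    and s_g: "b \<in> S p \<Longrightarrow> p \<le> N \<Longrightarrow> p \<le> k \<Longrightarrow> s k \<alpha> (g p b) = g p b"
begin

text \<open>Rule \<open>comp\<close> demands composability on both sides: that lifts of composable
  cells are composable is known only once the lift of the common face is unique.\<close>

inductive lifts :: "('a \<Rightarrow> int) family \<Rightarrow> 'c \<Rightarrow> bool" where
  atm: "\<lbrakk>b \<in> S p; p \<le> N\<rbrakk> \<Longrightarrow> lifts (atm p b) (g p b)"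
| comp: "\<lbrakk>lifts x y; lifts x' y'; k < N; cface k Minus x = cface k Plus x'; s k Minus y = s k Plus y'\<rbrakk>
    \<Longrightarrow> lifts (ccomp k x x') (m k y y')"

lemma lifts_Y: "lifts x y \<Longrightarrow> y \<in> Y"
  by (induction rule: lifts.induct) (auto intro: g_Y m_Y)

lemma lifts_cls: "lifts x y \<Longrightarrow> x \<in> cells_above N None"
proof (induction rule: lifts.induct)
  case (comp x y x' y' k)
  then show ?case using all_cells_ccomp by (auto simp: cells_above_def ccomp_above)
qed (rule atm_cls(2))

lemma lifts_Cell: "lifts x y \<Longrightarrow> x \<in> all_cells"
  using lifts_cls cells_aboveD(1) by blast

lemma lifts_id: "\<lbrakk>lifts x y; x \<in> cells_above k None\<rbrakk> \<Longrightarrow> s k \<alpha> y = y"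
proof (induction arbitrary: k \<alpha> rule: lifts.induct)
  case (atm b p)
  then show ?case using atm_cls_valid[of b p k None N] by (auto simp: s_g)
next
  case (comp x y x' y' j)
  note Y = lifts_Y[OF comp(1)] lifts_Y[OF comp(2)]
  have "x \<in> cells_above (max j k) None \<and> x' \<in> cells_above k None \<or> x \<in> cells_above k None \<and> x' \<in> cells_above (max j k) None"
    using comp ccomp_split[of x x' j k None] lifts_Cell by simp
  then show ?case
  proof (cases "j < k")
    case True
    then have "x \<in> cells_above k None" "x' \<in> cells_above k None"
      using \<open>_ \<or> _\<close> by (auto simp: max_absorb2)
    then show ?thesis using comp Y True by (simp add: s_m)
  next
    case False
    then consider "x \<in> cells_above j None" "x' \<in> cells_above k None" | "x \<in> cells_above k None" "x' \<in> cells_above j None"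
      using \<open>_ \<or> _\<close> by (auto simp: max_absorb1)
    then show ?thesis
    proof cases
      case 1
      then have "m j y y' = y'" using comp Y m_unit_left[of j y'] by metis
      then show ?thesis using comp 1 by simp
    next
      case 2
      then have "m j y y' = y" using comp Y m_unit_right[of j y] by metis
      then show ?thesis using comp 2 by simp
    qed
  qed
qed

lemma ccomp_identity_lift:
  assumes "lifts x y" "lifts x' y'" "j < N" "cface j Minus x = cface j Plus x'" "s j Minus y = s j Plus y'"
  shows "x \<in> cells_above j None \<Longrightarrow> ccomp j x x' = x' \<and> m j y y' = y'"
    "x' \<in> cells_above j None \<Longrightarrow> ccomp j x x' = x \<and> m j y y' = y"
proof -
  show "ccomp j x x' = x' \<and> m j y y' = y'" if "x \<in> cells_above j None"
    using ccomp_id(1)[OF assms(4) that] lifts_id[OF assms(1) that, of Minus] assms(5)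
      m_unit_left[OF assms(3) lifts_Y[OF assms(2)]] by simp
  show "ccomp j x x' = x \<and> m j y y' = y" if "x' \<in> cells_above j None"
    using ccomp_id(2)[OF assms(4) that] lifts_id[OF assms(2) that, of Plus] assms(5)
      m_unit_right[OF assms(3) lifts_Y[OF assms(1)]] by simp
qed

text \<open>Atoms are indecomposable: applied at level 0, \<open>ccomp_split\<close> says that in
  any composite equal to an atom one factor is an identity, and the other is then the atom
  itself.\<close>

lemma lifts_atm:
  assumes "lifts (atm p b) y" "b \<in> S p"
  shows "y = g p b"
proof -
  define ob where "ob = (if p = 0 then None else Some (p, b))"
  have "y = g p b" if "lifts x y" "x = atm p b" for x
    using that
  proof (induction arbitrary: rule: lifts.induct)
    case (atm b' p')
    have "atm p b p' Minus = single b'" "atm p' b' p Minus = single b" using atm(3) atm_top by metis+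
    then have "p' = p" by (metis atm_above linorder_neqE_nat single_neq_0)
    then show ?case using \<open>atm p b p' Minus = single b'\<close> by simp
  next
    case (comp x y x' y' j)
    have pN: "p \<le> N"
    proof (rule ccontr)
      assume "\<not> p \<le> N"
      then have "ccomp j x x' p Minus = 0"
        using cells_aboveD(2)[OF lifts_cls[OF comp(1)], of p] cells_aboveD(2)[OF lifts_cls[OF comp(2)], of p] comp(3)
        by (simp add: ccomp_above)
      then show False using comp.prems by simp
    qed
    have "valid N 0 ob" using assms(2) pN by (simp add: ob_def valid_def transitions_def)
    moreover have "ccomp j x x' \<in> cells_above 0 ob"
      unfolding comp.prems using atm_cls[OF assms(2)] by (auto simp: ob_def)
    ultimately have "x \<in> cells_above j None \<or> x' \<in> cells_above j None"
      using ccomp_split[OF lifts_Cell[OF comp(1)] lifts_Cell[OF comp(2)] comp(4)] by fastforce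
    then show ?case using ccomp_identity_lift[OF comp.hyps(1-5)] comp by metis
  qed
  then show ?thesis using assms(1) by blast
qed

end

text \<open>The compatibility required of generators in a free construction. The
  \<open>k\<close>-face of an atom is generated by atoms of degree at most \<open>k\<close>, so the
  condition ties \<open>g\<close> in degree \<open>p\<close> to \<open>g\<close> in lower
  degrees.\<close>

locale closed_cell_lifting = cell_lifting S d aug N Y s m g
  for S :: "nat \<Rightarrow> 'a set" and d aug and N and Y :: "'c set" and s m g +
  assumes lifts_face_g: "\<lbrakk>b \<in> S p; p \<le> N; k < p\<rbrakk> \<Longrightarrow> lifts (cface k \<alpha> (atm p b)) (s k \<alpha> (g p b))"
begin

lemma lifts_face: "lifts x y \<Longrightarrow> lifts (cface k \<alpha> x) (s k \<alpha> y)"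
proof (induction rule: lifts.induct)
  case (atm b p)
  then show ?case
    using lifts_face_g[of b p k \<alpha>] cface_id[OF atm_cls(2)[of b p p], of k \<alpha>] s_g[of b p k \<alpha>] lifts.atm[of b p]
    by (cases "k < p") auto
next
  case (comp x y x' y' j)
  note Y = lifts_Y[OF comp(1)] lifts_Y[OF comp(2)]
  show ?case
  proof (cases k j rule: linorder_cases)
    case less
    then show ?thesis using comp Y by (simp add: cface_ccomp s_m_below)
  next
    case equal
    then show ?thesis using comp Y by (cases \<alpha>) (simp_all add: cface_ccomp s_m_Minus s_m_Plus)
  next
    case greater
    have "lifts (ccomp j (cface k \<alpha> x) (cface k \<alpha> x')) (m j (s k \<alpha> y) (s k \<alpha> y'))"
      using comp Y greater by (intro lifts.comp) (simp_all add: cface_cface s_s)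
    then show ?thesis using comp Y greater by (simp add: cface_ccomp s_m)
  qed
qed

section \<open>Uniqueness of lifts, level by level\<close>

definition unique_lifts :: "nat \<Rightarrow> bool" where
  "unique_lifts k \<longleftrightarrow> (\<forall>ob x. valid N k ob \<longrightarrow> x \<in> cells_above k ob \<longrightarrow> (\<exists>!y. lifts x y))"

lemma unique_liftsD:
  "\<lbrakk>unique_lifts k; valid N k ob; x \<in> cells_above k ob\<rbrakk> \<Longrightarrow> \<exists>y. lifts x y"
  "\<lbrakk>unique_lifts k; valid N k ob; x \<in> cells_above k ob; lifts x y; lifts x y'\<rbrakk> \<Longrightarrow> y = y'"
  unfolding unique_lifts_def by blast+

lemma lifts_composable:
  assumes "unique_lifts k" "lifts x y" "lifts x' y'" "cface i Minus x = cface i Plus x'" "i \<le> k"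
  shows "s i Minus y = s i Plus y'"
proof -
  have "lifts (cface i Minus x) (s i Minus y)" "lifts (cface i Minus x) (s i Plus y')"
    using lifts_face[OF assms(2)] lifts_face[OF assms(3)] assms(4) by metis+
  moreover have "cface i Minus x \<in> cells_above k None"
    using cface_cls[OF lifts_Cell[OF assms(2)]] cells_above_None_mono assms(5) by blast
  ultimately show ?thesis using unique_liftsD(2)[OF assms(1) valid_None] by blast
qed

lemma lifts_ccomp:
  assumes "unique_lifts k" "lifts x y" "lifts x' y'" "cface i Minus x = cface i Plus x'" "i \<le> k" "k < N"
  shows "lifts (ccomp i x x') (m i y y')"
  using assms lifts_composable[OF assms(1-5)] by (intro lifts.comp) auto

text \<open>The cells \<open>P\<close> and \<open>Q\<close> of \<open>two_cells\<close> have unique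
  lifts \<open>p\<close> and \<open>q\<close> by the assumption at level \<open>k\<close>. The
  composite \<open>m i p q\<close> can be expanded by the interchange law in two ways, which are the
  two orders of firing.\<close>

lemma lifts_exchange:
  assumes U: "unique_lifts k" and kN: "k < N" and g: "g' \<in> cells_above k None"
    and u: "u \<in> transitions k" "fst u \<le> N" and v: "v \<in> transitions k" "fst v \<le> N" and le: "pre k u + pre k v \<le> g' k Minus"
    and y: "lifts (transition_cell k g' u) y1" "lifts (transition_cell k (fire k g' u) v) y2"
  shows "\<exists>z1 z2. lifts (transition_cell k g' v) z1 \<and> lifts (transition_cell k (fire k g' v) u) z2 \<and> m k y2 y1 = m k z2 z1"
proof (cases k)
  case 0
  \<comment> \<open>At level 0 a cell carries a single token, and two transitions cannot both claim
    it.\<close>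
  obtain b where b: "g' 0 Minus = single b" using Cell_0_single cells_aboveD(1)[OF g] by blast
  obtain c c' where "pre 0 u = single c" "pre 0 v = single c'"
    using u(1) v(1) 0 Cell_0_single[OF atm_Cell] by (auto simp: transitions_def) metis
  then have le': "single c z + single c' z \<le> single b z" for z
    using le 0 b by (auto simp: le_fun_def)
  then have False using le'[of c] le'[of c'] by (auto simp: single_def split: if_splits)
  then show ?thesis ..
next
  case (Suc i)
  obtain a b P Q where ab: "a = u \<and> b = v \<or> a = v \<and> b = u"
    and PQ: "P \<in> cells_above k (Some b)" "Q \<in> cells_above k (Some a)" and e: "cface i Minus P = cface i Plus Q"
    and eqs: "ccomp i (cface k Minus P) Q = transition_cell k g' a" "ccomp i P (cface k Plus Q) = transition_cell k (fire k g' a) b"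
      "ccomp i P (cface k Minus Q) = transition_cell k g' b" "ccomp i (cface k Plus P) Q = transition_cell k (fire k g' b) a"
    using two_cells[OF g Suc u(1) v(1) le] by blast
  have val: "valid N k (Some b)" "valid N k (Some a)" using ab u v by (auto simp: valid_Some)
  obtain p q where p: "lifts P p" and q: "lifts Q q"
    using unique_liftsD(1)[OF U val(1) PQ(1)] unique_liftsD(1)[OF U val(2) PQ(2)] by blast
  have Y: "p \<in> Y" "q \<in> Y" using p q lifts_Y by blast+
  have ik: "i < k" "i \<le> k" using Suc by auto
  have c: "s i Minus p = s i Plus q" using lifts_composable[OF U p q e ik(2)] .
  have L: "lifts (transition_cell k g' a) (m i (s k Minus p) q)" "lifts (transition_cell k (fire k g' a) b) (m i p (s k Plus q))"
    "lifts (transition_cell k g' b) (m i p (s k Minus q))" "lifts (transition_cell k (fire k g' b) a) (m i (s k Plus p) q)"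
    unfolding eqs[symmetric] using p q ik kN e
    by (auto intro!: lifts_ccomp[OF U] lifts_face simp: cface_cface)
  have c': "s i \<alpha> (s k \<beta> p) = s i \<alpha> p" "s i \<alpha> (s k \<beta> q) = s i \<alpha> q" for \<alpha> \<beta>
    using Y ik by (simp_all add: s_s)
  have kk: "s k \<alpha> (s k \<beta> p) = s k \<beta> p" "s k \<alpha> (s k \<beta> q) = s k \<beta> q" for \<alpha> \<beta>
    using Y by (simp_all add: s_s)
  have "m k (m i p (s k Plus q)) (m i (s k Minus p) q) = m i (m k p (s k Minus p)) (m k (s k Plus q) q)"
    using Y kN ik c c' kk by (intro m_interchange[symmetric]) (auto simp: s_Y)
  also have "\<dots> = m i p q" using Y kN by (simp add: m_unit_left m_unit_right)
  also have "\<dots> = m i (m k (s k Plus p) p) (m k q (s k Minus q))"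
    using Y kN by (simp add: m_unit_left m_unit_right)
  also have "\<dots> = m k (m i (s k Plus p) q) (m i p (s k Minus q))"
    using Y kN ik c c' kk by (intro m_interchange) (auto simp: s_Y)
  finally have eq: "m k (m i p (s k Plus q)) (m i (s k Minus p) q) = m k (m i (s k Plus p) q) (m i p (s k Minus q))" .
  have tc: "transition_cell k h t \<in> cells_above k (Some t)" if "lifts (transition_cell k h t) z" for h t z
    using lifts_Cell[OF that] by (auto simp: cells_above_def transition_cell_def)
  have un: "z = z'" if "lifts (transition_cell k h t) z" "lifts (transition_cell k h t) z'" "t = u \<or> t = v" for h t z z'
    using unique_liftsD(2)[OF U _ tc[OF that(1)] that(1,2)] that(3) u v by (auto simp: valid_Some)
  show ?thesis
  proof (cases "a = u \<and> b = v")
    case True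
    then have "y1 = m i (s k Minus p) q" "y2 = m i p (s k Plus q)" using un L y by auto
    then show ?thesis using eq L True by blast
  next
    case False
    then have "a = v \<and> b = u" using ab by blast
    moreover from this have "y1 = m i p (s k Minus q)" "y2 = m i (s k Plus p) q" using un L y by auto
    ultimately show ?thesis using eq L by (metis (no_types, lifting))
  qed
qed

text \<open>\<open>chain k h ts y\<close> says that \<open>y\<close> is a composite along dimension \<open>k\<close> of lifts of cells with one transition
  each, starting from the \<open>k\<close>-cell \<open>h\<close>. The head of \<open>ts\<close> fires first and is the last factor of the composite.\<close>

inductive chain :: "nat \<Rightarrow> ('a \<Rightarrow> int) family \<Rightarrow> (nat \<times> 'a) list \<Rightarrow> 'c \<Rightarrow> bool" for k where
  Nil: "\<lbrakk>h \<in> cells_above k None; lifts h y\<rbrakk> \<Longrightarrow> chain k h [] y"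
| Cons: "\<lbrakk>h \<in> cells_above k None; t \<in> transitions k; fst t \<le> N; pre k t \<le> h k Minus; lifts (transition_cell k h t) y1;
    chain k (fire k h t) ts y2\<rbrakk> \<Longrightarrow> chain k h (t # ts) (m k y2 y1)"

inductive_cases chain_NilE: "chain k h [] y"
inductive_cases chain_ConsE: "chain k h (t # ts) y"

lemma chain_basic:
  assumes "unique_lifts k" "k < N" "chain k h ts y"
  shows "h \<in> cells_above k None \<and> set ts \<subseteq> transitions k \<and> y \<in> Y \<and> net.fires k (h k Minus) ts \<and> lifts h (s k Minus y) \<and>
    lifts (set_level k h (net.after k (h k Minus) ts)) (s k Plus y)"
  using assms(3)
proof (induction rule: chain.induct)
  case (Nil h y)
  then show ?case using lifts_id[of h y k] by (simp add: set_level_id lifts_Y)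
next
  case (Cons h t y1 ts y2)
  have f: "lifts (fire k h t) (s k Plus y1)" "lifts h (s k Minus y1)"
    using lifts_face[OF Cons(5), of k Plus] lifts_face[OF Cons(5), of k Minus] cface_tcell[OF Cons(1)] by simp_all
  have Y: "y1 \<in> Y" "y2 \<in> Y" using Cons lifts_Y by blast+
  have "fire k h t \<in> cells_above k None" using Cons by blast
  then have e: "s k Minus y2 = s k Plus y1"
    using unique_liftsD(2)[OF assms(1) valid_None] Cons f by blast
  then have "m k y2 y1 \<in> Y" "s k Minus (m k y2 y1) = s k Minus y1" "s k Plus (m k y2 y1) = s k Plus y2"
    using Y assms(2) by (simp_all add: m_Y s_m_Minus s_m_Plus)
  then show ?case using Cons f by (simp add: fire_at set_level_fire)
qed

lemma chain_Cons_composable: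
  assumes "unique_lifts k" "k < N" "h \<in> cells_above k None" "lifts (transition_cell k h t) y1" "chain k (fire k h t) ts y2"
  shows "s k Minus y2 = s k Plus y1"
proof -
  have "lifts (fire k h t) (s k Plus y1)"
    using lifts_face[OF assms(4), of k Plus] cface_tcell[OF assms(3)] by simp
  then show ?thesis
    using unique_liftsD(2)[OF assms(1) valid_None] chain_basic[OF assms(1,2,5)] by blast
qed

lemma chain_swap:
  assumes U: "unique_lifts k" "k < N" and c: "chain k h (a # b # ts) y" and nf: "(a, b) \<notin> net.feeds k"
  shows "chain k h (b # a # ts) y"
proof -
  from c obtain y1 y23 where a: "h \<in> cells_above k None" "a \<in> transitions k" "fst a \<le> N" "pre k a \<le> h k Minus"
    "lifts (transition_cell k h a) y1" "chain k (fire k h a) (b # ts) y23" "y = m k y23 y1"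
    by (auto elim: chain_ConsE)
  from a(6) obtain y2 y3 where b: "b \<in> transitions k" "fst b \<le> N" "pre k b \<le> fire k h a k Minus"
    "lifts (transition_cell k (fire k h a) b) y2" "chain k (fire k (fire k h a) b) ts y3" "y23 = m k y3 y2"
    "fire k h a \<in> cells_above k None"
    by (auto elim: chain_ConsE)
  have le: "pre k a + pre k b \<le> h k Minus"
    using net.independent_enabled[OF a(2) b(1) nf a(4)] b(3) by (simp add: fire_at)
  then have le': "pre k a z + pre k b z \<le> h k Minus z" for z by (auto simp: le_fun_def)
  have nn: "0 \<le> pre k t z" "0 \<le> post k t z" for t z
    using tr_nonneg[of t k Minus] tr_nonneg[of t k Plus] by (auto simp: le_fun_def)
  obtain z1 z2 where z: "lifts (transition_cell k h b) z1" "lifts (transition_cell k (fire k h b) a) z2" "m k y2 y1 = m k z2 z1"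
    using lifts_exchange[OF U a(1-3) b(1,2) le a(5) b(4)] by blast
  have en: "pre k b \<le> h k Minus" "pre k a \<le> fire k h b k Minus"
    using le' nn by (auto simp: le_fun_def fire_at net.step_apply; smt (verit))+
  have cl: "fire k h b \<in> cells_above k None" using fire_cls a(1) b(1) en(1) by blast
  have c3: "chain k (fire k (fire k h b) a) ts y3" using b(5) by (simp add: fire_commute)
  have Y: "y1 \<in> Y" "y2 \<in> Y" "y3 \<in> Y" "z1 \<in> Y" "z2 \<in> Y"
    using a b z lifts_Y chain_basic[OF U b(5)] by blast+
  have e: "s k Minus y3 = s k Plus y2" "s k Minus y3 = s k Plus z2"
    using chain_Cons_composable[OF U b(7,4,5)] chain_Cons_composable[OF U cl z(2) c3] .
  have e1: "s k Minus y2 = s k Plus y1" "s k Minus z2 = s k Plus z1"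
    using lifts_composable[OF U(1) b(4) a(5), of k] lifts_composable[OF U(1) z(2) z(1), of k]
      cface_tcell a(1) b(7) cl by simp_all
  have "y = m k (m k y3 y2) y1" using a(7) b(6) by simp
  also have "\<dots> = m k y3 (m k z2 z1)" using Y U e e1 z(3) by (simp add: m_assoc)
  also have "\<dots> = m k (m k y3 z2) z1" using Y U e e1 by (simp add: m_assoc)
  finally have "y = m k (m k y3 z2) z1" .
  moreover have "chain k (fire k h b) (a # ts) (m k y3 z2)"
    using cl a en z c3 by (intro chain.Cons) auto
  ultimately show ?thesis using a b en z by (auto intro: chain.Cons)
qed

lemma chain_move:
  assumes "unique_lifts k" "k < N" "\<And>a. a \<in> set as \<Longrightarrow> (a, b) \<notin> net.feeds k" "chain k h (as @ b # ts) y"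
  shows "chain k h (b # as @ ts) y"
  using assms(3,4)
proof (induction as arbitrary: h y)
  case (Cons a as)
  from Cons.prems(2) obtain y1 y2 where a: "h \<in> cells_above k None" "a \<in> transitions k" "fst a \<le> N" "pre k a \<le> h k Minus"
    "lifts (transition_cell k h a) y1" "chain k (fire k h a) (as @ b # ts) y2" "y = m k y2 y1"
    by (auto elim: chain_ConsE)
  then have "chain k h (a # b # as @ ts) y" using Cons by (auto intro: chain.Cons)
  then show ?case using chain_swap[OF assms(1,2)] Cons.prems(1) by simp
qed simp

text \<open>The head \<open>e\<close> of the second sequence is enabled at \<open>h\<close>. By
  safety no transition before \<open>e\<close> in the first sequence feeds it, so \<open>e\<close>
  can be moved to the front there without changing the value \<open>y\<close>, and the remainders
  are compared by induction.\<close>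

lemma chain_unique:
  assumes U: "unique_lifts k" "k < N"
  shows "\<lbrakk>chain k h ts y; chain k h ts' y'; mset ts = mset ts'\<rbrakk> \<Longrightarrow> y = y'"
proof (induction ts' arbitrary: h ts y y')
  case Nil
  then have "lifts h y" "lifts h y'" "h \<in> cells_above k None" by (auto elim: chain_NilE)
  then show ?case using unique_liftsD(2)[OF U(1) valid_None] by blast
next
  case (Cons e us)
  obtain y1' y2' where e: "h \<in> cells_above k None" "e \<in> transitions k" "fst e \<le> N" "pre k e \<le> h k Minus"
    "lifts (transition_cell k h e) y1'" "chain k (fire k h e) us y2'" "y' = m k y2' y1'"
    using Cons.prems(2) by (auto elim: chain_ConsE)
  have "e \<in> set ts" using Cons.prems(3) by (metis list.set_intros(1) set_mset_mset)
  then obtain as bs where ts: "ts = as @ e # bs" by (meson split_list)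
  note B = chain_basic[OF U Cons.prems(1)]
  have "(a, e) \<notin> net.feeds k" if "a \<in> set as" for a
    using net.not_fed_of_enabled[of k "h k Minus" ts e a] cell_safe e B that ts by auto
  then have "chain k h (e # as @ bs) y" using chain_move[OF U] Cons.prems(1) ts by blast
  then obtain y1 y2 where y: "lifts (transition_cell k h e) y1" "chain k (fire k h e) (as @ bs) y2" "y = m k y2 y1"
    by (auto elim: chain_ConsE)
  have "y1 = y1'"
    using unique_liftsD(2)[OF U(1) _ transition_cell_cls[OF e(1,2,4)] y(1) e(5)] e(2,3) by (simp add: valid_Some)
  moreover have "y2 = y2'" using Cons.IH[OF y(2) e(6)] Cons.prems(3) ts by simp
  ultimately show ?case using y(3) e(7) by simp
qed

section \<open>Composing and whiskering chains\<close>

lemma chain_append: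
  assumes U: "unique_lifts k" "k < N" and c: "chain k h ts y" "chain k h' ts' y'"
    and "h' = set_level k h (net.after k (h k Minus) ts)"
  shows "chain k h (ts @ ts') (m k y' y)"
  using c(1) assms(5)
proof (induction rule: chain.induct)
  case (Nil h y)
  then have "h' = h" by (simp add: set_level_id)
  moreover have "s k Minus y' = y"
    using unique_liftsD(2)[OF U(1) valid_None Nil(1) _ Nil(2)] chain_basic[OF U c(2)] \<open>h' = h\<close> by blast
  ultimately show ?case using c(2) m_unit_right[of k y'] chain_basic[OF U c(2)] U(2) by auto
next
  case (Cons h t y1 ts y2)
  have c2: "chain k (fire k h t) (ts @ ts') (m k y' y2)"
    using Cons by (simp add: fire_at set_level_fire)
  have e1: "s k Minus y2 = s k Plus y1" using chain_Cons_composable[OF U] Cons by blast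
  have "lifts h' (s k Plus y2)" "lifts h' (s k Minus y')" "h' \<in> cells_above k None"
    using chain_basic[OF U Cons(6)] chain_basic[OF U c(2)] Cons.prems by (simp_all add: fire_at set_level_fire)
  then have e2: "s k Minus y' = s k Plus y2" using unique_liftsD(2)[OF U(1) valid_None] by blast
  have "y1 \<in> Y" "y2 \<in> Y" "y' \<in> Y"
    using lifts_Y Cons(5) chain_basic[OF U Cons(6)] chain_basic[OF U c(2)] by blast+
  then have "m k y' (m k y2 y1) = m k (m k y' y2) y1" using e1 e2 U(2) by (simp add: m_assoc)
  then show ?case using chain.Cons[OF Cons(1-5) c2] by simp
qed

text \<open>Whiskering with a \<open>k\<close>-cell \<open>c\<close> along \<open>j < k\<close>
  changes neither the transitions nor their order. In \<open>Y\<close> the value \<open>z\<close>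
  equals \<open>m k z z\<close>, so interchange distributes it over the factors of the
  chain.\<close>

lemma chain_whisker_right:
  assumes U: "unique_lifts k" "k < N" and z: "c \<in> cells_above k None" "lifts c z" and "j < k"
    and "chain k h ts y" "cface j Minus h = cface j Plus c"
  shows "chain k (ccomp j h c) ts (m j y z)"
  using assms(6,7)
proof (induction rule: chain.induct)
  case (Nil h y)
  have "ccomp j h c \<in> cells_above k None"
    using Nil z all_cells_ccomp \<open>j < k\<close> by (auto simp: cells_above_def ccomp_above)
  then show ?case using Nil z U \<open>j < k\<close> by (intro chain.Nil lifts_ccomp) auto
next
  case (Cons h t y1 ts y2)
  have e: "cface j Minus (transition_cell k h t) = cface j Plus c" "cface j Minus (fire k h t) = cface j Plus c"
    using Cons.prems cface_tcell(3)[OF Cons(1) \<open>j < k\<close>] cface_cface[of j Minus k Plus "transition_cell k h t"] \<open>j < k\<close>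
      cface_tcell(2)[OF Cons(1)] by simp_all
  have cz: "c i \<alpha> = 0" if "k < i" for i \<alpha> using cells_aboveD(2)[OF z(1) that] by simp
  have ck: "c k Plus = c k Minus" by (rule cells_above_None_eq[OF z(1)])
  have t: "transition_cell k (ccomp j h c) t = ccomp j (transition_cell k h t) c"
  proof (rule ccomp_eqI[OF e(1), symmetric])
    show "transition_cell k (ccomp j h c) t i \<beta> = transition_cell k h t i \<beta> + c i \<beta>" if "j < i" for i \<beta>
      using that cz ck by (cases i k rule: linorder_cases; cases \<beta>) (auto simp: transition_cell_def ccomp_above algebra_simps)
  qed (use \<open>j < k\<close> Cons.prems in \<open>auto simp: transition_cell_def ccomp_below ccomp_Minus ccomp_Plus\<close>)
  have f: "fire k (ccomp j h c) t = ccomp j (fire k h t) c"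
  proof (rule ccomp_eqI[OF e(2), symmetric])
    show "fire k (ccomp j h c) t i \<beta> = fire k h t i \<beta> + c i \<beta>" if "j < i" for i \<beta>
      using that ck by (cases "i = k"; cases \<beta>) (auto simp: fire_def set_level_def ccomp_above algebra_simps)
  qed (use \<open>j < k\<close> Cons.prems in \<open>auto simp: fire_def set_level_def ccomp_below ccomp_Minus ccomp_Plus\<close>)
  have "ccomp j h c \<in> cells_above k None"
    using Cons z all_cells_ccomp \<open>j < k\<close> by (auto simp: cells_above_def ccomp_above)
  moreover have "pre k t \<le> ccomp j h c k Minus"
    using Cons(4) all_cells_nonneg[OF cells_aboveD(1)[OF z(1)], of k Minus] \<open>j < k\<close>
    by (auto simp: ccomp_above le_fun_def add_increasing2)
  moreover have "lifts (transition_cell k (ccomp j h c) t) (m j y1 z)"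
    unfolding t using Cons z U \<open>j < k\<close> e by (intro lifts_ccomp) auto
  moreover have "chain k (fire k (ccomp j h c) t) ts (m j y2 z)" unfolding f using Cons.IH e(2) .
  ultimately have "chain k (ccomp j h c) (t # ts) (m k (m j y2 z) (m j y1 z))"
    using Cons by (intro chain.Cons) auto
  moreover have "m k (m j y2 z) (m j y1 z) = m j (m k y2 y1) z"
  proof -
    have Y: "y1 \<in> Y" "y2 \<in> Y" "z \<in> Y"
      using lifts_Y Cons(5) z(2) chain_basic[OF U Cons(6)] by blast+
    have zz: "s k \<alpha> z = z" for \<alpha> using lifts_id[OF z(2,1)] .
    have e1: "s k Minus y2 = s k Plus y1" using chain_Cons_composable[OF U] Cons by blast
    have e2: "s j Minus y1 = s j Plus z"
      using lifts_composable[OF U(1) Cons(5) z(2) e(1)] \<open>j < k\<close> by simp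
    have "s j Minus y2 = s j Minus (s k Minus y2)" using Y \<open>j < k\<close> by (simp add: s_s)
    then have e3: "s j Minus y2 = s j Plus z" using e1 e2 Y \<open>j < k\<close> by (simp add: s_s)
    have "m j (m k y2 y1) (m k z z) = m k (m j y2 z) (m j y1 z)"
      using Y zz e1 e2 e3 \<open>j < k\<close> U by (intro m_interchange) auto
    then show ?thesis using m_unit_left[of k z] zz Y U by simp
  qed
  ultimately show ?case by simp
qed

lemma chain_whisker_left:
  assumes U: "unique_lifts k" "k < N" and z: "c \<in> cells_above k None" "lifts c z" and "j < k"
    and "chain k h ts y" "cface j Minus c = cface j Plus h"
  shows "chain k (ccomp j c h) ts (m j z y)"
  using assms(6,7)
proof (induction rule: chain.induct)
  case (Nil h y)
  have "ccomp j c h \<in> cells_above k None"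
    using Nil z all_cells_ccomp \<open>j < k\<close> by (auto simp: cells_above_def ccomp_above)
  then show ?case using Nil z U \<open>j < k\<close> by (intro chain.Nil lifts_ccomp) auto
next
  case (Cons h t y1 ts y2)
  have e: "cface j Minus c = cface j Plus (transition_cell k h t)" "cface j Minus c = cface j Plus (fire k h t)"
    using Cons.prems cface_tcell(3)[OF Cons(1) \<open>j < k\<close>] cface_cface[of j Plus k Plus "transition_cell k h t"] \<open>j < k\<close>
      cface_tcell(2)[OF Cons(1)] by simp_all
  have cz: "c i \<alpha> = 0" if "k < i" for i \<alpha> using cells_aboveD(2)[OF z(1) that] by simp
  have ck: "c k Plus = c k Minus" by (rule cells_above_None_eq[OF z(1)])
  have t: "transition_cell k (ccomp j c h) t = ccomp j c (transition_cell k h t)"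
  proof (rule ccomp_eqI[OF e(1), symmetric])
    show "transition_cell k (ccomp j c h) t i \<beta> = c i \<beta> + transition_cell k h t i \<beta>" if "j < i" for i \<beta>
      using that cz ck by (cases i k rule: linorder_cases; cases \<beta>) (auto simp: transition_cell_def ccomp_above algebra_simps)
  qed (use \<open>j < k\<close> Cons.prems in \<open>auto simp: transition_cell_def ccomp_below ccomp_Minus ccomp_Plus\<close>)
  have f: "fire k (ccomp j c h) t = ccomp j c (fire k h t)"
  proof (rule ccomp_eqI[OF e(2), symmetric])
    show "fire k (ccomp j c h) t i \<beta> = c i \<beta> + fire k h t i \<beta>" if "j < i" for i \<beta>
      using that ck by (cases "i = k"; cases \<beta>) (auto simp: fire_def set_level_def ccomp_above algebra_simps)
  qed (use \<open>j < k\<close> Cons.prems in \<open>auto simp: fire_def set_level_def ccomp_below ccomp_Minus ccomp_Plus\<close>)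
  have "ccomp j c h \<in> cells_above k None"
    using Cons z all_cells_ccomp \<open>j < k\<close> by (auto simp: cells_above_def ccomp_above)
  moreover have "pre k t \<le> ccomp j c h k Minus"
    using Cons(4) all_cells_nonneg[OF cells_aboveD(1)[OF z(1)], of k Minus] \<open>j < k\<close>
    by (auto simp: ccomp_above le_fun_def add_increasing)
  moreover have "lifts (transition_cell k (ccomp j c h) t) (m j z y1)"
    unfolding t using Cons z U \<open>j < k\<close> e by (intro lifts_ccomp) auto
  moreover have "chain k (fire k (ccomp j c h) t) ts (m j z y2)" unfolding f using Cons.IH e(2) .
  ultimately have "chain k (ccomp j c h) (t # ts) (m k (m j z y2) (m j z y1))"
    using Cons by (intro chain.Cons) auto
  moreover have "m k (m j z y2) (m j z y1) = m j z (m k y2 y1)"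
  proof -
    have Y: "y1 \<in> Y" "y2 \<in> Y" "z \<in> Y"
      using lifts_Y Cons(5) z(2) chain_basic[OF U Cons(6)] by blast+
    have zz: "s k \<alpha> z = z" for \<alpha> using lifts_id[OF z(2,1)] .
    have e1: "s k Minus y2 = s k Plus y1" using chain_Cons_composable[OF U] Cons by blast
    have e2: "s j Minus z = s j Plus y1"
      using lifts_composable[OF U(1) z(2) Cons(5) e(1)] \<open>j < k\<close> by simp
    have "s j Plus y2 = s j Plus (s k Minus y2)" using Y \<open>j < k\<close> by (simp add: s_s)
    then have e3: "s j Minus z = s j Plus y2" using e1 e2 Y \<open>j < k\<close> by (simp add: s_s)
    have "m j (m k z z) (m k y2 y1) = m k (m j z y2) (m j z y1)"
      using Y zz e1 e2 e3 \<open>j < k\<close> U by (intro m_interchange) auto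
    then show ?thesis using m_unit_left[of k z] zz Y U by simp
  qed
  ultimately show ?case by simp
qed

text \<open>For \<open>j = k\<close> the sequences are concatenated. For \<open>j < k\<close> the
  transitions of \<open>x'\<close> fire while \<open>x\<close> rests at its source, and those of
  \<open>x\<close> while \<open>x'\<close> rests at its target; interchange identifies this
  composite along \<open>k\<close> with \<open>m j y y'\<close>.\<close>

lemma chain_ccomp:
  assumes U: "unique_lifts k" "k < N" and x: "lifts x y" and x': "lifts x' y'" and jk: "j \<le> k"
    and e: "cface j Minus x = cface j Plus x'" and e': "s j Minus y = s j Plus y'"
    and c: "chain k (cface k Minus x) ts y" "sums k x ts"
    and c': "chain k (cface k Minus x') ts' y'" "sums k x' ts'"
  shows "chain k (cface k Minus (ccomp j x x')) (ts' @ ts) (m j y y')" "sums k (ccomp j x x') (ts' @ ts)"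
proof -
  have T: "set ts \<subseteq> transitions k" "set ts' \<subseteq> transitions k" using chain_basic[OF U] c c' by blast+
  have C: "x \<in> all_cells" "x' \<in> all_cells" using x x' lifts_Cell by blast+
  have Y: "y \<in> Y" "y' \<in> Y" using x x' lifts_Y by blast+
  show "sums k (ccomp j x x') (ts' @ ts)"
    using c(2) c'(2) jk by (simp add: sums_def ccomp_above add.commute)
  have end': "net.after k (cface k Minus x' k Minus) ts' = x' k Plus"
    using sums_after[OF C(2) T(2) c'(2)] by (simp add: cface_def)
  show "chain k (cface k Minus (ccomp j x x')) (ts' @ ts) (m j y y')"
  proof (cases "j = k")
    case True
    have "cface k Minus x = set_level k (cface k Minus x') (x' k Plus)"
      using e True by (auto simp: cface_def set_level_def fun_eq_iff)
    then show ?thesis using chain_append[OF U c'(1) c(1)] end' e True by (simp add: cface_ccomp)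
  next
    case False
    then have jk: "j < k" using jk by simp
    let ?x = "cface k Minus x" and ?x' = "cface k Plus x'"
    have k: "lifts ?x (s k Minus y)" "lifts ?x' (s k Plus y')"
      "?x \<in> cells_above k None" "?x' \<in> cells_above k None"
      using lifts_face x x' cface_cls C by blast+
    have w1: "chain k (ccomp j ?x (cface k Minus x')) ts' (m j (s k Minus y) y')"
      using e jk by (intro chain_whisker_left[OF U k(3,1) jk c'(1)]) (simp add: cface_cface)
    have w2: "chain k (ccomp j ?x ?x') ts (m j y (s k Plus y'))"
      using e jk by (intro chain_whisker_right[OF U k(4,2) jk c(1)]) (simp add: cface_cface)
    have ej: "cface j Minus (cface k \<alpha> x) = cface j Plus (cface k \<beta> x')" for \<alpha> \<beta>
      using e jk by (simp add: cface_cface)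
    have "ccomp j ?x ?x' = set_level k (ccomp j ?x (cface k Minus x'))
        (net.after k (ccomp j ?x (cface k Minus x') k Minus) ts')"
    proof -
      have "net.after k (ccomp j ?x (cface k Minus x') k Minus) ts'
          = x k Minus + net.after k (cface k Minus x' k Minus) ts'"
        using jk by (simp add: net.after_def ccomp_above cface_def algebra_simps)
      then have a: "net.after k (ccomp j ?x (cface k Minus x') k Minus) ts' = x k Minus + x' k Plus"
        using end' by simp
      show ?thesis unfolding a
      proof (rule ccomp_eqI[OF ej])
        show "set_level k (ccomp j ?x (cface k Minus x')) (x k Minus + x' k Plus) i \<beta> = ?x i \<beta> + ?x' i \<beta>"
          if "j < i" for i \<beta>
          using that by (cases i k rule: linorder_cases) (auto simp: set_level_def cface_def ccomp_above)
      qed (use jk in \<open>auto simp: set_level_def ccomp_below[OF ej] ccomp_Minus ccomp_Plus[OF ej]\<close>,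
          use jk in \<open>auto simp: cface_def\<close>)
    qed
    then have ch: "chain k (ccomp j ?x (cface k Minus x')) (ts' @ ts) (m k (m j y (s k Plus y')) (m j (s k Minus y) y'))"
      using chain_append[OF U w1 w2] by blast
    have "m k (m j y (s k Plus y')) (m j (s k Minus y) y') = m j (m k y (s k Minus y)) (m k (s k Plus y') y')"
      using Y U jk e' by (intro m_interchange[symmetric]) (auto simp: s_Y s_s)
    also have "\<dots> = m j y y'" using Y U by (simp add: m_unit_left m_unit_right)
    finally show ?thesis using ch e jk by (simp add: cface_ccomp)
  qed
qed

lemma chain_single:
  assumes "k < N" "lifts x y" "x \<in> cells_above k (Some t)" "t \<in> transitions k" "fst t \<le> N"
  shows "chain k (cface k Minus x) [t] y"
proof -
  let ?h = "cface k Minus x"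
  have h: "?h \<in> cells_above k None" using cface_cls cells_aboveD(1)[OF assms(3)] by blast
  note t = transition_cell_eq[OF assms(3,4)]
  have f: "fire k ?h t = cface k Plus x" using cface_tcell(2)[OF h] t(1) by metis
  have "chain k (fire k ?h t) [] (s k Plus y)"
    unfolding f using cface_cls cells_aboveD(1)[OF assms(3)] lifts_face[OF assms(2)] by (intro chain.Nil) auto
  moreover have "lifts (transition_cell k ?h t) y" using t(1) assms(2) by simp
  ultimately have "chain k ?h [t] (m k (s k Plus y) y)" using h assms t(2) by (intro chain.Cons) auto
  then show ?thesis using m_unit_left[OF assms(1) lifts_Y[OF assms(2)]] by simp
qed

text \<open>Normal form of a lift: however it was built, it is also the value of a chain along
  dimension \<open>k\<close>. Composites along \<open>j \<le> k\<close> combine chains; in a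
  composite along \<open>j > k\<close> one factor is an identity and disappears.\<close>

lemma lifts_chain:
  assumes U: "unique_lifts k" "k < N"
  shows "\<lbrakk>lifts x y; valid N (Suc k) ob; x \<in> cells_above (Suc k) ob\<rbrakk> \<Longrightarrow>
    \<exists>ts es. chain k (cface k Minus x) ts y \<and> sums k x ts \<and> mset ts = mset (labels k ob es)"
proof (induction arbitrary: ob rule: lifts.induct)
  case (atm b p)
  have L: "lifts (atm p b) (g p b)" using atm by (intro lifts.atm)
  consider "p \<le> k" "ob = None" | "p = Suc k" "ob = None" | "Suc k < p" "ob = Some (p, b)"
    using atm_cls_valid[OF atm(1,4,3)] by fastforce
  then show ?case
  proof cases
    case 1
    then have "chain k (cface k Minus (atm p b)) [] (g p b)"
      using atm_cls(2)[OF atm(1)] cface_id[OF atm_cls(2)[OF atm(1)], of k k] L by (intro chain.Nil) auto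
    moreover have "sums k (atm p b) []" using 1 by (auto simp: sums_def)
    ultimately show ?thesis using 1 by (intro exI[of _ "[]"] exI[of _ "[]"]) (auto simp: labels_def)
  next
    case 2
    then have "chain k (cface k Minus (atm p b)) [(p, b)] (g p b)"
      using atm U L by (intro chain_single atm_cls(1)) (auto simp: transitions_def)
    moreover have "sums k (atm p b) [(p, b)]" by (auto simp: sums_def)
    ultimately show ?thesis using 2
      by (intro exI[of _ "[(p, b)]"] exI[of _ "[b]"]) (auto simp: labels_def)
  next
    case 3
    then have "chain k (cface k Minus (atm p b)) [(p, b)] (g p b)"
      using atm U L by (intro chain_single atm_cls(1)) (auto simp: transitions_def)
    moreover have "sums k (atm p b) [(p, b)]" by (auto simp: sums_def)
    ultimately show ?thesis using 3
      by (intro exI[of _ "[(p, b)]"] exI[of _ "[]"]) (auto simp: labels_def)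
  qed
next
  case (comp x y x' y' j)
  note sp = ccomp_split[OF lifts_Cell[OF comp(1)] lifts_Cell[OF comp(2)] comp(4) comp.prems(2,1)]
  note id = ccomp_identity_lift[OF comp(1,2,3,4,5)]
  show ?case
  proof (cases "j \<le> k")
    case True
    have combine: ?thesis if w: "valid N (Suc k) o1" "valid N (Suc k) o2" "x \<in> cells_above (Suc k) o1" "x' \<in> cells_above (Suc k) o2"
      "o1 = None \<and> o2 = ob \<or> o1 = ob \<and> o2 = None" for o1 o2
    proof -
      obtain ts es ts' es' where c: "chain k (cface k Minus x) ts y" "sums k x ts" "mset ts = mset (labels k o1 es)"
        and c': "chain k (cface k Minus x') ts' y'" "sums k x' ts'" "mset ts' = mset (labels k o2 es')"
        using comp.IH(1)[OF w(1,3)] comp.IH(2)[OF w(2,4)] by blast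
      have "mset (ts' @ ts) = mset (labels k ob (es' @ es))"
        using c(3) c'(3) w(5) by (auto simp: labels_def ac_simps split: option.splits)
      then show ?thesis
        using chain_ccomp[OF U comp(1,2) True comp(4,5) c(1,2) c'(1,2)] by blast
    qed
    show ?thesis using sp combine[of None ob] combine[of ob None] comp.prems(1) True
      by (auto simp: max_absorb2)
  next
    case False
    then consider "x \<in> cells_above j None" "x' \<in> cells_above (Suc k) ob" | "x \<in> cells_above (Suc k) ob" "x' \<in> cells_above j None"
      using sp by (auto simp: max_absorb1)
    then show ?thesis using id comp.IH comp.prems by cases auto
  qed
qed

lemma unique_lifts_0: "unique_lifts 0"
  unfolding unique_lifts_def
proof (intro allI impI)
  fix ob x assume "valid N 0 ob" "x \<in> cells_above 0 ob"
  then obtain p b where "b \<in> S p" "p \<le> N" "x = atm p b" using cls_0_atm by blast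
  then show "\<exists>!y. lifts x y" using lifts.atm lifts_atm by metis
qed

text \<open>Existence is the factorization along \<open>k\<close>. For uniqueness, two lifts become
  values of chains, and the multiset of labels is read off from the entries of \<open>x\<close> in
  degree \<open>Suc k\<close>, so it is the same for both.\<close>

lemma unique_lifts_Suc:
  assumes U: "unique_lifts k" "k < N"
  shows "unique_lifts (Suc k)"
  unfolding unique_lifts_def
proof (intro allI impI)
  fix ob x assume v: "valid N (Suc k) ob" and x: "x \<in> cells_above (Suc k) ob"
  have "\<exists>y. lifts x y"
  proof (rule cells_above_Suc_induct[OF _ _ U(2) v x])
    show "\<exists>y. lifts x y" if "valid N k ob" "x \<in> cells_above k ob" for ob x using unique_liftsD(1)[OF U(1) that] .
    show "\<exists>y. lifts (ccomp k x x') y"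
      if "cface k Minus x = cface k Plus x'" "\<exists>y. lifts x y" "\<exists>y. lifts x' y" for x x'
      using that lifts_ccomp[OF U(1) _ _ that(1) order_refl U(2)] by blast
  qed
  moreover have "y = y'" if y: "lifts x y" "lifts x y'" for y y'
  proof -
    obtain ts es ts' es' where c: "chain k (cface k Minus x) ts y" "sums k x ts" "mset ts = mset (labels k ob es)"
      and c': "chain k (cface k Minus x) ts' y'" "sums k x ts'" "mset ts' = mset (labels k ob es')"
      using lifts_chain[OF U y(1) v x] lifts_chain[OF U y(2) v x] by blast
    have "sums k x (labels k ob es)" "sums k x (labels k ob es')"
      using c c' sums_mset by blast+
    then have "(\<Sum>e\<leftarrow>es. single e) = (\<Sum>e\<leftarrow>es'. single e)"
      using labels_sums[OF x] by (metis add_left_cancel)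
    then have "mset es = mset es'" by (rule sum_single_mset)
    then have "mset ts = mset ts'" using c(3) c'(3) by (simp add: labels_def)
    then show ?thesis using chain_unique[OF U c(1) c'(1)] by blast
  qed
  ultimately show "\<exists>!y. lifts x y" by blast
qed

theorem cells_free:
  assumes "x \<in> cells_above N None"
  shows "\<exists>!y. lifts x y"
proof -
  have "k \<le> N \<Longrightarrow> unique_lifts k" for k
    by (induction k) (auto intro: unique_lifts_0 unique_lifts_Suc)
  then show ?thesis using assms valid_None unfolding unique_lifts_def by blast
qed

end

section \<open>Strict omega-categories\<close>

context omega_category
begin

lemma iter_unit_cell: "x \<in> cells C k \<Longrightarrow> iter_unit C k n x \<in> cells C (k + n)"
  by (induction n) (auto intro: unit_cell)

lemma iter_unit_add: "iter_unit C k (a + b) x = iter_unit C (k + a) b (iter_unit C k a x)"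
  by (induction b) (auto simp: add.assoc)

lemma face_iter_unit:
  "\<lbrakk>x \<in> cells C k; j < k + n\<rbrakk> \<Longrightarrow>
    face C (k + n) j \<alpha> (iter_unit C k n x) = (if j < k then face C k j \<alpha> x else iter_unit C k (j - k) x)"
proof (induction n)
  case (Suc n)
  let ?z = "iter_unit C k n x"
  have z: "?z \<in> cells C (k + n)" using iter_unit_cell Suc.prems by blast
  show ?case
  proof (cases "j = k + n")
    case True
    then show ?thesis using face_unit[OF z] by simp
  next
    case False
    then have j: "j < k + n" using Suc.prems by simp
    have "face C (Suc (k + n)) j \<alpha> (unit_cell C (k + n) ?z) = face C (k + n) j \<alpha> ?z"
      using face_face[of j "k + n" "Suc (k + n)" "unit_cell C (k + n) ?z" \<alpha> \<alpha>] j unit_cell[OF z] face_unit[OF z]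
      by simp
    then show ?thesis using Suc.IH[OF Suc.prems(1) j] by simp
  qed
qed simp

lemma iter_unit_comp:
  assumes "composable C k j x y"
  shows "composable C (k + n) j (iter_unit C k n x) (iter_unit C k n y) \<and>
    iter_unit C k n (composite C k j x y) = composite C (k + n) j (iter_unit C k n x) (iter_unit C k n y)"
proof (induction n)
  case (Suc n)
  have "j < k" "x \<in> cells C k" "y \<in> cells C k" "face C k j Minus x = face C k j Plus y"
    using assms by (auto simp: composable_def)
  then have "composable C (k + Suc n) j (iter_unit C k (Suc n) x) (iter_unit C k (Suc n) y)"
    using face_iter_unit[of x k j "Suc n"] face_iter_unit[of y k j "Suc n"]
      iter_unit_cell[of x k "Suc n"] iter_unit_cell[of y k "Suc n"]
    by (simp add: composable_def)
  then show ?case using Suc unit_comp by simp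
qed (use assms in simp)

text \<open>Faces raised back to dimension \<open>n\<close> by units, as the single-sorted form
  requires.\<close>

definition sface :: "nat \<Rightarrow> nat \<Rightarrow> sign \<Rightarrow> 'c \<Rightarrow> 'c" where
  "sface n k \<alpha> x = (if k < n then iter_unit C k (n - k) (face C n k \<alpha> x) else x)"

lemma face_sface:
  assumes "x \<in> cells C n" "j < n" "k < n"
  shows "face C n j \<alpha> (sface n k \<beta> x) =
    (if j < k then face C n j \<alpha> x else iter_unit C k (j - k) (face C n k \<beta> x))"
  using face_iter_unit[of "face C n k \<beta> x" k j "n - k" \<alpha>] face_cell[OF assms(3,1)] face_face assms
  by (auto simp: sface_def)

lemma sface_eq_iff:
  assumes "k < n" "x \<in> cells C n" "y \<in> cells C n"
  shows "sface n k \<alpha> x = sface n k \<beta> y \<longleftrightarrow> face C n k \<alpha> x = face C n k \<beta> y"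
proof
  assume "sface n k \<alpha> x = sface n k \<beta> y"
  then show "face C n k \<alpha> x = face C n k \<beta> y"
    using face_sface[OF assms(2,1,1), of Plus \<alpha>] face_sface[OF assms(3,1,1), of Plus \<beta>] by simp
qed (simp add: sface_def assms(1))

lemma n_category_cells: "n_category n (cells C n) (sface n) (composite C n)"
proof
  have comp_iff: "composable C n k x y \<longleftrightarrow> sface n k Minus x = sface n k Plus y"
    if "k < n" "x \<in> cells C n" "y \<in> cells C n" for k x y
    using that sface_eq_iff by (simp add: composable_def)
  show "sface n k \<alpha> y \<in> cells C n" if "y \<in> cells C n" for y k \<alpha>
    using that face_cell[of k n y \<alpha>] iter_unit_cell[of "face C n k \<alpha> y" k "n - k"] by (auto simp: sface_def)
  show "sface n j \<alpha> (sface n k \<beta> y) = (if j < k then sface n j \<alpha> y else sface n k \<beta> y)"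
    if "y \<in> cells C n" for y j k \<alpha> \<beta>
  proof (cases "j < n \<and> k < n")
    case True
    then show ?thesis
      using face_sface[OF that, of j k \<alpha> \<beta>] iter_unit_add[of k "j - k" "n - j" "face C n k \<beta> y"]
      by (auto simp: sface_def)
  qed (auto simp: sface_def)
  show "sface n k \<alpha> y = y" if "n \<le> k" for y k \<alpha> using that by (simp add: sface_def)
  fix k x y assume k: "k < n" and xy: "x \<in> cells C n" "y \<in> cells C n"
  show "composite C n k (sface n k Plus y) y = y" "composite C n k y (sface n k Minus y) = y"
    using k xy comp_unit_left comp_unit_right by (simp_all add: sface_def)
  assume e: "sface n k Minus x = sface n k Plus y"
  then have c: "composable C n k x y" using comp_iff k xy by blast
  then show "composite C n k x y \<in> cells C n" by (rule comp_cell)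
  show "sface n k Minus (composite C n k x y) = sface n k Minus y"
    "sface n k Plus (composite C n k x y) = sface n k Plus x"
    using source_comp[OF c] target_comp[OF c] k by (simp_all add: sface_def)
  show "sface n j \<alpha> (composite C n k x y) = composite C n k (sface n j \<alpha> x) (sface n j \<alpha> y)"
    if "k < j" for j \<alpha>
  proof (cases "j < n")
    case True
    have "composable C j k (face C n j \<alpha> x) (face C n j \<alpha> y)"
      using c True that by (auto simp: composable_def face_cell face_face)
    then show ?thesis using True iter_unit_comp[of j k _ _ "n - j"] face_comp[OF c that True]
      by (simp add: sface_def)
  qed (simp add: sface_def)
  show "composite C n k (composite C n k x y) z = composite C n k x (composite C n k y z)"
    if "z \<in> cells C n" "sface n k Minus y = sface n k Plus z" for z
    using comp_assoc[OF c] that comp_iff k xy by blast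
  show "composite C n j (composite C n k x y) (composite C n k z w) =
      composite C n k (composite C n j x z) (composite C n j y w)"
    if "j < k" "z \<in> cells C n" "w \<in> cells C n" "sface n k Minus z = sface n k Plus w"
      "sface n j Minus x = sface n j Plus z" "sface n j Minus y = sface n j Plus w" for j z w
    using interchange[OF \<open>j < k\<close> c] that comp_iff k xy by auto
qed

lemma sface_Suc_unit:
  assumes "x \<in> cells C n" "k < Suc n"
  shows "sface (Suc n) k \<alpha> (unit_cell C n x) = unit_cell C n (sface n k \<alpha> x)"
proof (cases "k = n")
  case True
  then show ?thesis using face_unit[OF assms(1)] by (simp add: sface_def)
next
  case False
  then have k: "k < n" using assms by simp
  have "face C (Suc n) k \<alpha> (unit_cell C n x) = face C n k \<alpha> x"
    using face_face[of k n "Suc n" "unit_cell C n x" \<alpha> \<alpha>] k unit_cell[OF assms(1)] face_unit[OF assms(1)] by simp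
  then show ?thesis using k by (simp add: sface_def Suc_diff_le)
qed

end

lemma omega_functor_iter_unit:
  assumes "omega_functor C D F" "x \<in> cells C k"
  shows "F (k + n) (iter_unit C k n x) = iter_unit D k n (F k x)"
proof (induction n)
  case (Suc n)
  interpret C: omega_category C using assms(1) by (simp add: omega_functor_def)
  have "iter_unit C k n x \<in> cells C (k + n)" using C.iter_unit_cell assms(2) by blast
  then show ?case using Suc assms(1) by (simp add: omega_functor_def)
qed simp

section \<open>Augmented directed complexes and their cells\<close>

lemma nu_simps [simp]:
  "cells (nu K) = nu_cells K" "face (nu K) n = nu_face K" "unit_cell (nu K) n x = x"
  "composite (nu K) n = nu_comp K"
  by (simp_all add: nu_def)

lemma iter_unit_nu [simp]: "iter_unit (nu K) k n x = x"
  by (induction n) auto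

lemma (in aug_dir_complex) group_facts:
  shows grp_comm_group: "comm_group (grp K n)"
    and grp_group: "group (grp K n)"
  using comm_group_grp[of n] by (auto simp: comm_group_def)

context aug_dir_complex
begin

lemma pos_carrier: "x \<in> pos K n \<Longrightarrow> x \<in> carrier (grp K n)"
  using pos_submonoid[of n] by (meson submonoid.subset subsetD)

lemma pos_one: "\<one>\<^bsub>grp K n\<^esub> \<in> pos K n"
  using pos_submonoid[of n] by (rule submonoid.one_closed)

lemma pos_mult: "x \<in> pos K n \<Longrightarrow> y \<in> pos K n \<Longrightarrow> x \<otimes>\<^bsub>grp K n\<^esub> y \<in> pos K n"
  using pos_submonoid[of n] by (rule submonoid.m_closed)

lemma bd_carrier: "x \<in> carrier (grp K (Suc n)) \<Longrightarrow> bd K n x \<in> carrier (grp K n)"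
  using bd_hom[of n] by (auto simp: hom_def)

lemma bd_mult: "\<lbrakk>x \<in> carrier (grp K (Suc n)); y \<in> carrier (grp K (Suc n))\<rbrakk> \<Longrightarrow>
    bd K n (x \<otimes>\<^bsub>grp K (Suc n)\<^esub> y) = bd K n x \<otimes>\<^bsub>grp K n\<^esub> bd K n y"
  using bd_hom[of n] by (auto simp: hom_def)

lemma bd_group_hom: "group_hom (grp K (Suc n)) (grp K n) (bd K n)"
  using grp_group bd_hom by (simp add: group_hom_def group_hom_axioms_def)

lemma bd_one: "bd K n \<one>\<^bsub>grp K (Suc n)\<^esub> = \<one>\<^bsub>grp K n\<^esub>"
  using bd_group_hom by (rule group_hom.hom_one)

lemma aug_mult: "\<lbrakk>x \<in> carrier (grp K 0); y \<in> carrier (grp K 0)\<rbrakk> \<Longrightarrow>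
    aug K (x \<otimes>\<^bsub>grp K 0\<^esub> y) = aug K x + aug K y"
  using aug_hom by (auto simp: hom_def integer_group_def)

lemma nu_cellsD:
  assumes "x \<in> nu_cells K n"
  shows "x k \<alpha> \<in> pos K k" "n < k \<Longrightarrow> x k \<alpha> = \<one>\<^bsub>grp K k\<^esub>" "x n \<alpha> = x n \<beta>"
    "bd K k (x (Suc k) \<alpha>) = x k Plus \<otimes>\<^bsub>grp K k\<^esub> inv\<^bsub>grp K k\<^esub> (x k Minus)" "aug K (x 0 \<alpha>) = 1"
    "x k \<alpha> \<in> carrier (grp K k)"
proof -
  have top: "x n Minus = x n Plus" and above: "\<And>k \<alpha>. n < k \<Longrightarrow> x k \<alpha> = \<one>\<^bsub>grp K k\<^esub>"
    using assms by (auto simp: nu_cells_def)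
  show p: "x k \<alpha> \<in> pos K k" for k \<alpha>
    using assms pos_one by (cases "k \<le> n") (auto simp: nu_cells_def)
  then show c: "x k \<alpha> \<in> carrier (grp K k)" for k \<alpha> using pos_carrier by blast
  show "n < k \<Longrightarrow> x k \<alpha> = \<one>\<^bsub>grp K k\<^esub>" "aug K (x 0 \<alpha>) = 1" using assms by (auto simp: nu_cells_def)
  show "x n \<alpha> = x n \<beta>" using top by (cases \<alpha>; cases \<beta>) auto
  show "bd K k (x (Suc k) \<alpha>) = x k Plus \<otimes>\<^bsub>grp K k\<^esub> inv\<^bsub>grp K k\<^esub> (x k Minus)"
  proof (cases "k < n")
    case True
    then show ?thesis using assms by (auto simp: nu_cells_def)
  next
    case False
    then have "x k Minus = x k Plus" using top above[of k] by (cases "k = n") auto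
    then show ?thesis using False above[of "Suc k"] bd_one c group.r_inv[OF grp_group] by simp
  qed
qed

text \<open>In degrees from \<open>n\<close> on the boundary condition holds automatically for a
  cell; conversely, in degree \<open>n\<close> it forces the two top entries to agree. This gives a
  description by unbounded quantifiers, parallel to \<open>all_cells\<close>.\<close>

lemma nu_cells_iff:
  "x \<in> nu_cells K n \<longleftrightarrow> (\<forall>k \<alpha>. x k \<alpha> \<in> pos K k) \<and> (\<forall>k \<alpha>. n < k \<longrightarrow> x k \<alpha> = \<one>\<^bsub>grp K k\<^esub>) \<and>
     (\<forall>k \<alpha>. bd K k (x (Suc k) \<alpha>) = x k Plus \<otimes>\<^bsub>grp K k\<^esub> inv\<^bsub>grp K k\<^esub> (x k Minus)) \<and> (\<forall>\<alpha>. aug K (x 0 \<alpha>) = 1)"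
  (is "_ \<longleftrightarrow> ?R")
proof
  assume r: ?R
  have "x (Suc n) Plus = \<one>\<^bsub>grp K (Suc n)\<^esub>" using r by blast
  then have "bd K n (x (Suc n) Plus) = \<one>\<^bsub>grp K n\<^esub>" using bd_one by simp
  then have "x n Plus \<otimes>\<^bsub>grp K n\<^esub> inv\<^bsub>grp K n\<^esub> (x n Minus) = \<one>\<^bsub>grp K n\<^esub>" using r by metis
  then have "x n Minus = x n Plus"
    using r pos_carrier group.inv_equality[OF grp_group] group.inv_inv[OF grp_group] group.inv_closed[OF grp_group]
    by metis
  then show "x \<in> nu_cells K n" using r by (auto simp: nu_cells_def)
qed (use nu_cellsD in blast)


lemma nu_face_face: "nu_face K j \<alpha> (nu_face K k \<beta> x) = (if j < k then nu_face K j \<alpha> x else nu_face K k \<beta> x)"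
  by (auto simp: nu_face_def fun_eq_iff)

lemma nu_face_eqD:
  assumes "nu_face K k Minus x = nu_face K k Plus y"
  shows "j < k \<Longrightarrow> x j \<beta> = y j \<beta>" "x k Minus = y k Plus"
  using fun_cong[OF fun_cong[OF assms, of j], of \<beta>] fun_cong[OF fun_cong[OF assms, of k], of Plus]
  by (auto simp: nu_face_def)

text \<open>The bare typing condition under which composites can be computed entrywise; unlike
  membership in \<open>nu_cells\<close> it carries no dimension.\<close>

definition entries :: "'a family \<Rightarrow> bool" where
  "entries x \<longleftrightarrow> (\<forall>j \<beta>. x j \<beta> \<in> carrier (grp K j))"

lemma entriesD: "entries x \<Longrightarrow> x j \<beta> \<in> carrier (grp K j)"
  by (simp add: entries_def)

lemma nu_cells_entries: "x \<in> nu_cells K n \<Longrightarrow> entries x"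
  using nu_cellsD(6) by (auto simp: entries_def)

lemma nu_comp_apply:
  assumes "nu_face K k Minus x = nu_face K k Plus y" "entries x" "entries y"
  shows "j < k \<Longrightarrow> nu_comp K k x y j \<beta> = y j \<beta>" "nu_comp K k x y k Minus = y k Minus"
    "nu_comp K k x y k Plus = x k Plus" "k < j \<Longrightarrow> nu_comp K k x y j \<beta> = x j \<beta> \<otimes>\<^bsub>grp K j\<^esub> y j \<beta>"
proof -
  note e = nu_face_eqD[OF assms(1)]
  note c = entriesD[OF assms(2)] entriesD[OF assms(3)]
  note g = group.r_inv[OF grp_group] monoid.l_one[OF group.is_monoid[OF grp_group]]
    monoid.r_one[OF group.is_monoid[OF grp_group]] monoid.inv_one[OF group.is_monoid[OF grp_group]]
  show "j < k \<Longrightarrow> nu_comp K k x y j \<beta> = y j \<beta>" "nu_comp K k x y k Minus = y k Minus"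
    "k < j \<Longrightarrow> nu_comp K k x y j \<beta> = x j \<beta> \<otimes>\<^bsub>grp K j\<^esub> y j \<beta>"
    using e c g by (simp_all add: nu_comp_def nu_face_def)
  have "nu_comp K k x y k Plus = x k Plus \<otimes>\<^bsub>grp K k\<^esub> (inv\<^bsub>grp K k\<^esub> (y k Plus) \<otimes>\<^bsub>grp K k\<^esub> y k Plus)"
    using e c monoid.m_assoc[OF group.is_monoid[OF grp_group]] group.inv_closed[OF grp_group]
    by (simp add: nu_comp_def nu_face_def)
  also have "\<dots> = x k Plus" using c g group.l_inv[OF grp_group] by simp
  finally show "nu_comp K k x y k Plus = x k Plus" .
qed

lemma nu_comp_eqI:
  assumes "nu_face K k Minus x = nu_face K k Plus y" "entries x" "entries y"
    and "\<And>j \<beta>. j < k \<Longrightarrow> z j \<beta> = y j \<beta>" "z k Minus = y k Minus" "z k Plus = x k Plus"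
    and "\<And>j \<beta>. k < j \<Longrightarrow> z j \<beta> = x j \<beta> \<otimes>\<^bsub>grp K j\<^esub> y j \<beta>"
  shows "nu_comp K k x y = z"
proof (intro ext)
  fix j \<beta>
  show "nu_comp K k x y j \<beta> = z j \<beta>"
    using nu_comp_apply[OF assms(1-3)] assms(4-)
    by (cases j k rule: linorder_cases; cases \<beta>) auto
qed

lemma nu_face_cell: "x \<in> nu_cells K n \<Longrightarrow> nu_face K k \<alpha> x \<in> nu_cells K k"
proof -
  assume x: "x \<in> nu_cells K n"
  note g = group.r_inv[OF grp_group] monoid.l_one[OF group.is_monoid[OF grp_group]]
    monoid.r_one[OF group.is_monoid[OF grp_group]] monoid.inv_one[OF group.is_monoid[OF grp_group]]
  show ?thesis using nu_cellsD[OF x] pos_one by (auto simp: nu_cells_def nu_face_def)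
qed

lemma nu_comp_cell:
  assumes "k < n" and x: "x \<in> nu_cells K n" and y: "y \<in> nu_cells K n"
    and e: "nu_face K k Minus x = nu_face K k Plus y"
  shows "nu_comp K k x y \<in> nu_cells K n"
proof -
  note a = nu_comp_apply[OF e nu_cells_entries[OF x] nu_cells_entries[OF y]]
  note f = nu_face_eqD[OF e]
  note dx = nu_cellsD[OF x] and dy = nu_cellsD[OF y]
  note m = monoid.r_one[OF group.is_monoid[OF grp_group]]
  let ?c = "nu_comp K k x y"
  have p: "?c j \<beta> \<in> pos K j" for j \<beta>
    using a dx(1) dy(1) pos_mult by (cases j k rule: linorder_cases; cases \<beta>) auto
  have one: "?c j \<beta> = \<one>\<^bsub>grp K j\<^esub>" if "n < j" for j \<beta>
    using that a(4)[of j \<beta>] dx(2) dy(2) assms(1) m monoid.one_closed[OF group.is_monoid[OF grp_group]] by simp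
  have b: "bd K j (?c (Suc j) \<beta>) = ?c j Plus \<otimes>\<^bsub>grp K j\<^esub> inv\<^bsub>grp K j\<^esub> (?c j Minus)" for j \<beta>
  proof (cases "Suc j" k rule: linorder_cases)
    case less
    then show ?thesis using a dy(4) by simp
  next
    case equal
    then have k: "k = Suc j" by simp
    show ?thesis
      using a(1)[of j] a(2,3) f(1)[of j] dx(4)[of j] dy(4)[of j] unfolding k by (cases \<beta>) auto
  next
    case greater
    interpret G: comm_group "grp K j" by (rule grp_comm_group)
    have "bd K j (?c (Suc j) \<beta>) = (x j Plus \<otimes>\<^bsub>grp K j\<^esub> inv\<^bsub>grp K j\<^esub> (x j Minus)) \<otimes>\<^bsub>grp K j\<^esub>
        (y j Plus \<otimes>\<^bsub>grp K j\<^esub> inv\<^bsub>grp K j\<^esub> (y j Minus))"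
      using greater a(4)[of "Suc j" \<beta>] bd_mult[OF dx(6) dy(6)] dx(4) dy(4) by simp
    also have "\<dots> = (x j Plus \<otimes>\<^bsub>grp K j\<^esub> y j Plus) \<otimes>\<^bsub>grp K j\<^esub> inv\<^bsub>grp K j\<^esub> (x j Minus \<otimes>\<^bsub>grp K j\<^esub> y j Minus)"
      using dx(6) dy(6) by (simp add: G.inv_mult G.m_ac)
    finally have 1: "bd K j (?c (Suc j) \<beta>) = \<dots>" .
    show ?thesis
    proof (cases "j = k")
      case True
      have "x j Minus = y j Plus" using f(2) True by simp
      then have "(x j Plus \<otimes>\<^bsub>grp K j\<^esub> y j Plus) \<otimes>\<^bsub>grp K j\<^esub> inv\<^bsub>grp K j\<^esub> (x j Minus \<otimes>\<^bsub>grp K j\<^esub> y j Minus)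
          = x j Plus \<otimes>\<^bsub>grp K j\<^esub> ((y j Plus \<otimes>\<^bsub>grp K j\<^esub> inv\<^bsub>grp K j\<^esub> (y j Plus)) \<otimes>\<^bsub>grp K j\<^esub> inv\<^bsub>grp K j\<^esub> (y j Minus))"
        using dx(6) dy(6) by (simp only: G.inv_mult G.m_assoc G.inv_closed G.m_closed)
      also have "\<dots> = x j Plus \<otimes>\<^bsub>grp K j\<^esub> inv\<^bsub>grp K j\<^esub> (y j Minus)" using dx(6) dy(6) by simp
      finally show ?thesis using 1 a(2,3) True by simp
    next
      case False
      then have "k < j" using greater by simp
      then show ?thesis using 1 a(4) by simp
    qed
  qed
  have "aug K (?c 0 \<alpha>) = 1" for \<alpha>
  proof (cases "k = 0")
    case True
    then show ?thesis using a(2,3) dx(5) dy(5) by (cases \<alpha>) auto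
  next
    case False
    then show ?thesis using a(1)[of 0 \<alpha>] dy(5) by simp
  qed
  then show ?thesis using p one b unfolding nu_cells_iff by blast
qed

lemma nu_face_comp:
  assumes e: "nu_face K k Minus x = nu_face K k Plus y" and en: "entries x" "entries y"
  shows "nu_face K k Minus (nu_comp K k x y) = nu_face K k Minus y"
    "nu_face K k Plus (nu_comp K k x y) = nu_face K k Plus x"
    "k < j \<Longrightarrow> nu_face K j \<alpha> (nu_comp K k x y) = nu_comp K k (nu_face K j \<alpha> x) (nu_face K j \<alpha> y)"
proof -
  note a = nu_comp_apply[OF e en] and f = nu_face_eqD[OF e]
  show "nu_face K k Minus (nu_comp K k x y) = nu_face K k Minus y"
    "nu_face K k Plus (nu_comp K k x y) = nu_face K k Plus x"
    using a f by (auto simp: nu_face_def fun_eq_iff)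
  assume "k < j"
  note g = monoid.l_one[OF group.is_monoid[OF grp_group]] monoid.inv_one[OF group.is_monoid[OF grp_group]]
     monoid.one_closed[OF group.is_monoid[OF grp_group]]
  show "nu_face K j \<alpha> (nu_comp K k x y) = nu_comp K k (nu_face K j \<alpha> x) (nu_face K j \<alpha> y)"
    using \<open>k < j\<close> g by (auto simp: nu_comp_def nu_face_def fun_eq_iff)
qed

lemma nu_face_id: "x \<in> nu_cells K n \<Longrightarrow> n \<le> k \<Longrightarrow> nu_face K k \<alpha> x = x"
  using nu_cellsD(2,3)[of x n] by (auto simp: nu_face_def fun_eq_iff le_less)

lemma nu_comp_unit:
  assumes "entries x"
  shows "nu_comp K k (nu_face K k Plus x) x = x" "nu_comp K k x (nu_face K k Minus x) = x"
proof -
  have en: "entries (nu_face K k \<alpha> x)" for \<alpha>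
    using assms monoid.one_closed[OF group.is_monoid[OF grp_group]] by (auto simp: entries_def nu_face_def)
  note g = monoid.l_one[OF group.is_monoid[OF grp_group]] monoid.r_one[OF group.is_monoid[OF grp_group]]
  note c = entriesD[OF assms]
  show "nu_comp K k (nu_face K k Plus x) x = x" "nu_comp K k x (nu_face K k Minus x) = x"
    using assms en g c by (intro nu_comp_eqI; simp add: nu_face_face; simp add: nu_face_def)+
qed

lemma composable_nu: "composable (nu K) n k x y \<longleftrightarrow>
    k < n \<and> x \<in> nu_cells K n \<and> y \<in> nu_cells K n \<and> nu_face K k Minus x = nu_face K k Plus y"
  by (simp add: composable_def)

lemma omega_category_nu: "omega_category (nu K)"
proof
  fix n k x
  show "face (nu K) n k \<alpha> x \<in> cells (nu K) k" if "x \<in> cells (nu K) n" for \<alpha>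
    using that nu_face_cell by simp
  show "face (nu K) k j \<alpha> (face (nu K) n k \<beta> x) = face (nu K) n j \<alpha> x" if "j < k" for j \<alpha> \<beta>
    using that by (simp add: nu_face_face)
  show "unit_cell (nu K) n x \<in> cells (nu K) (Suc n)" if "x \<in> cells (nu K) n"
    using that by (auto simp: nu_cells_iff)
  show "face (nu K) (Suc n) n \<alpha> (unit_cell (nu K) n x) = x" if "x \<in> cells (nu K) n" for \<alpha>
    using that nu_face_id by simp
  show "composite (nu K) n k (iter_unit (nu K) k (n - k) (face (nu K) n k Plus x)) x = x"
    "composite (nu K) n k x (iter_unit (nu K) k (n - k) (face (nu K) n k Minus x)) = x"
    if "x \<in> cells (nu K) n"
    using that nu_comp_unit nu_cells_entries by simp_all
  fix y assume "composable (nu K) n k x y"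
  then have c: "k < n" "x \<in> nu_cells K n" "y \<in> nu_cells K n" and e: "nu_face K k Minus x = nu_face K k Plus y"
    by (auto simp: composable_nu)
  note en = nu_cells_entries[OF c(2)] nu_cells_entries[OF c(3)]
  note a = nu_comp_apply[OF e en]
  show "composite (nu K) n k x y \<in> cells (nu K) n" using nu_comp_cell[OF c e] by simp
  show "face (nu K) n k Minus (composite (nu K) n k x y) = face (nu K) n k Minus y"
    "face (nu K) n k Plus (composite (nu K) n k x y) = face (nu K) n k Plus x"
    using nu_face_comp[OF e en] by simp_all
  show "face (nu K) n j \<alpha> (composite (nu K) n k x y) =
      composite (nu K) j k (face (nu K) n j \<alpha> x) (face (nu K) n j \<alpha> y)" if "k < j" for j \<alpha>
    using nu_face_comp(3)[OF e en that] by simp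
  show "unit_cell (nu K) n (composite (nu K) n k x y) =
      composite (nu K) (Suc n) k (unit_cell (nu K) n x) (unit_cell (nu K) n y)"
    by simp
  have cen: "entries (nu_comp K k x y)" using nu_cells_entries nu_comp_cell[OF c e] by blast
  show "composite (nu K) n k (composite (nu K) n k x y) z = composite (nu K) n k x (composite (nu K) n k y z)"
    if "composable (nu K) n k y z" for z
  proof -
    have z: "z \<in> nu_cells K n" and ez: "nu_face K k Minus y = nu_face K k Plus z"
      using that by (auto simp: composable_nu)
    note ez' = nu_cells_entries[OF z]
    have yz: "entries (nu_comp K k y z)" using nu_cells_entries nu_comp_cell[OF c(1,3) z ez] by blast
    note b = nu_comp_apply[OF ez en(2) ez']
    have e1: "nu_face K k Minus (nu_comp K k x y) = nu_face K k Plus z"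
      "nu_face K k Minus x = nu_face K k Plus (nu_comp K k y z)"
      using nu_face_comp[OF e en] nu_face_comp[OF ez en(2) ez'] e ez by simp_all
    note r = nu_comp_apply[OF e1(2) en(1) yz]
    have "nu_comp K k (nu_comp K k x y) z = nu_comp K k x (nu_comp K k y z)"
    proof (intro nu_comp_eqI e1 cen ez')
      fix j \<beta> assume "k < j"
      then show "nu_comp K k x (nu_comp K k y z) j \<beta> = nu_comp K k x y j \<beta> \<otimes>\<^bsub>grp K j\<^esub> z j \<beta>"
        using a b r entriesD[OF en(1)] entriesD[OF en(2)] entriesD[OF ez']
          monoid.m_assoc[OF group.is_monoid[OF grp_group]] by simp
    qed (use a b r in auto)
    then show ?thesis by simp
  qed
  show "composite (nu K) n j (composite (nu K) n k x y) (composite (nu K) n k z w) =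
      composite (nu K) n k (composite (nu K) n j x z) (composite (nu K) n j y w)"
    if jk: "j < k" and "composable (nu K) n k z w" "composable (nu K) n j x z" "composable (nu K) n j y w" for j z w
  proof -
    have zw: "z \<in> nu_cells K n" "w \<in> nu_cells K n" "j < n" and ezw: "nu_face K k Minus z = nu_face K k Plus w"
      and exz: "nu_face K j Minus x = nu_face K j Plus z" and eyw: "nu_face K j Minus y = nu_face K j Plus w"
      using that by (auto simp: composable_nu)
    note en' = nu_cells_entries[OF zw(1)] nu_cells_entries[OF zw(2)]
    have en2: "entries (nu_comp K k z w)" "entries (nu_comp K j x z)" "entries (nu_comp K j y w)"
      using nu_comp_cell[OF c(1) zw(1,2) ezw] nu_comp_cell[OF zw(3) c(2) zw(1) exz] nu_comp_cell[OF zw(3) c(3) zw(2) eyw]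
        nu_cells_entries by blast+
    note azw = nu_comp_apply[OF ezw en'] and axz = nu_comp_apply[OF exz en(1) en'(1)]
      and ayw = nu_comp_apply[OF eyw en(2) en'(2)]
    have e1: "nu_face K j Minus (nu_comp K k x y) = nu_face K j Plus (nu_comp K k z w)"
    proof -
      have "nu_face K j \<alpha> (nu_comp K k u v) = nu_face K j \<alpha> v"
        if "nu_face K k Minus u = nu_face K k Plus v" "entries u" "entries v" for u v \<alpha>
        using nu_comp_apply[OF that] jk by (auto simp: nu_face_def fun_eq_iff)
      then show ?thesis using e ezw en en' eyw by simp
    qed
    have e2: "nu_face K k Minus (nu_comp K j x z) = nu_face K k Plus (nu_comp K j y w)"
      using nu_face_comp(3)[OF exz en(1) en'(1) jk] nu_face_comp(3)[OF eyw en(2) en'(2) jk] e ezw by simp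
    note r = nu_comp_apply[OF e2 en2(2,3)]
    have "nu_comp K j (nu_comp K k x y) (nu_comp K k z w) = nu_comp K k (nu_comp K j x z) (nu_comp K j y w)"
    proof (intro nu_comp_eqI e1 cen en2)
      fix i \<beta> assume "j < i"
      interpret G: comm_group "grp K i" by (rule grp_comm_group)
      show "nu_comp K k (nu_comp K j x z) (nu_comp K j y w) i \<beta> = nu_comp K k x y i \<beta> \<otimes>\<^bsub>grp K i\<^esub> nu_comp K k z w i \<beta>"
        using \<open>j < i\<close> a r azw axz ayw
          entriesD[OF en(1), of i] entriesD[OF en(2), of i] entriesD[OF en'(1), of i] entriesD[OF en'(2), of i]
        by (cases i k rule: linorder_cases; cases \<beta>) (auto simp: G.m_ac)
    qed (use jk a r azw axz ayw in auto)
    then show ?thesis by simp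
  qed
qed

end

section \<open>Coefficients with respect to a basis\<close>

locale based_group = comm_group G for G (structure) +
  fixes S
  assumes basis: "group_basis G S"
begin

lemma basis_carrier: "S \<subseteq> carrier G"
  using basis by (simp add: group_basis_def)

lemma chains_carrier: "c \<in> chains S \<Longrightarrow> c b \<noteq> 0 \<Longrightarrow> b \<in> carrier G"
  using basis_carrier by (auto simp: chains_def)

lemma lincomb_superset:
  assumes "finite A" "A \<subseteq> carrier G" "{b. c b \<noteq> 0} \<subseteq> A"
  shows "lincomb G c = (\<Otimes>b\<in>A. b [^] c b)"
  unfolding lincomb_def
  using assms by (intro finprod_mono_neutral_cong_left) auto

lemma lincomb_closed: "c \<in> chains S \<Longrightarrow> lincomb G c \<in> carrier G"
  unfolding lincomb_def using chains_carrier by (intro finprod_closed) auto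

lemma lincomb_add:
  assumes "c \<in> chains S" "c' \<in> chains S"
  shows "lincomb G (c + c') = lincomb G c \<otimes> lincomb G c'"
proof -
  let ?A = "{b. c b \<noteq> 0} \<union> {b. c' b \<noteq> 0}"
  have A: "finite ?A" "?A \<subseteq> carrier G"
    using assms basis_carrier by (auto simp: chains_def)
  have "lincomb G (c + c') = (\<Otimes>b\<in>?A. b [^] (c b + c' b))"
    using lincomb_superset[OF A, of "c + c'"] by (auto simp: subset_iff)
  also have "\<dots> = (\<Otimes>b\<in>?A. b [^] c b \<otimes> b [^] c' b)"
    using A by (intro finprod_cong') (auto simp: int_pow_mult)
  also have "\<dots> = (\<Otimes>b\<in>?A. b [^] c b) \<otimes> (\<Otimes>b\<in>?A. b [^] c' b)"
    using A by (intro finprod_multf) auto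
  also have "\<dots> = lincomb G c \<otimes> lincomb G c'"
    using lincomb_superset[OF A, of c] lincomb_superset[OF A, of c'] by auto
  finally show ?thesis .
qed

lemma lincomb_0 [simp]: "lincomb G 0 = \<one>"
  by (simp add: lincomb_def)

lemma lincomb_single: "b \<in> S \<Longrightarrow> lincomb G (single b) = b"
  using lincomb_superset[of "{b}" "single b"] basis_carrier by (auto simp: single_def)

lemma coeff_unique_ex:
  "x \<in> carrier G \<Longrightarrow> \<exists>!c. finite {b. c b \<noteq> 0} \<and> {b. c b \<noteq> 0} \<subseteq> S \<and> x = lincomb G c"
  using basis by (simp add: group_basis_def)

lemma coeff_chain: "x \<in> carrier G \<Longrightarrow> coeff G S x \<in> chains S"
  and lincomb_coeff: "x \<in> carrier G \<Longrightarrow> lincomb G (coeff G S x) = x"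
  using theI'[OF coeff_unique_ex] unfolding coeff_def chains_def by auto

lemma coeff_lincomb: "c \<in> chains S \<Longrightarrow> coeff G S (lincomb G c) = c"
  unfolding coeff_def using coeff_unique_ex[OF lincomb_closed, of c]
  by (intro the1_equality) (auto simp: chains_def)

lemma coeff_mult:
  assumes "x \<in> carrier G" "y \<in> carrier G"
  shows "coeff G S (x \<otimes> y) = coeff G S x + coeff G S y"
  using coeff_lincomb[of "coeff G S x + coeff G S y"] lincomb_add[of "coeff G S x" "coeff G S y"] assms
  by (simp add: coeff_chain chains_add lincomb_coeff)

lemma coeff_one [simp]: "coeff G S \<one> = 0"
  using coeff_lincomb[of 0] by simp

lemma coeff_inv: "x \<in> carrier G \<Longrightarrow> coeff G S (inv x) = - coeff G S x"
  using coeff_mult[of x "inv x"] by (simp add: eq_neg_iff_add_eq_0 add.commute)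

lemma coeff_inject: "\<lbrakk>x \<in> carrier G; y \<in> carrier G\<rbrakk> \<Longrightarrow> coeff G S x = coeff G S y \<longleftrightarrow> x = y"
  using lincomb_coeff by metis

lemma coeff_basis: "b \<in> S \<Longrightarrow> coeff G S b = single b"
  using coeff_lincomb[OF chains_single] lincomb_single by metis

text \<open>By uniqueness of integer coefficients, the natural coefficients given by the monoid
  basis are the integer ones. Conversely, a nonnegative combination of basis elements stays in the
  submonoid.\<close>

lemma coeff_nonneg_iff:
  assumes "monoid_basis G P S" "submonoid P G" "x \<in> carrier G"
  shows "0 \<le> coeff G S x \<longleftrightarrow> x \<in> P"
proof
  assume x: "x \<in> P"
  obtain c :: "'a \<Rightarrow> nat" where c: "finite {b. c b \<noteq> 0}" "{b. c b \<noteq> 0} \<subseteq> S" "x = lincomb G (\<lambda>b. int (c b))"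
    using assms(1) x unfolding monoid_basis_def by blast
  then have "coeff G S x = (\<lambda>b. int (c b))" using coeff_lincomb by (auto simp: chains_def)
  then show "0 \<le> coeff G S x" by (auto simp: le_fun_def)
next
  interpret P: submonoid P G by (rule assms(2))
  assume "0 \<le> coeff G S x"
  then obtain es where es: "set es \<subseteq> S" "coeff G S x = (\<Sum>e\<leftarrow>es. single e)"
    using nonneg_chain_sum coeff_chain assms(3) by blast
  have "lincomb G (\<Sum>e\<leftarrow>es. single e) \<in> P"
    using es(1)
  proof (induction es)
    case (Cons e es)
    have "e \<in> P" using Cons.prems assms(1) by (auto simp: monoid_basis_def)
    moreover have "lincomb G (single e + (\<Sum>e\<leftarrow>es. single e)) = e \<otimes> lincomb G (\<Sum>e\<leftarrow>es. single e)"
      using Cons.prems by (simp add: lincomb_add chains_single chains_sum_list lincomb_single subset_iff)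
    ultimately have "lincomb G (single e + (\<Sum>e\<leftarrow>es. single e)) \<in> P" using Cons by simp
    then show ?case by (simp only: list.map sum_list.Cons)
  qed simp
  then show "x \<in> P" using lincomb_coeff[OF assms(3)] es(2) by simp
qed

lemma coeff_sign_part: "x \<in> carrier G \<Longrightarrow> coeff G S (sign_part G S \<alpha> x) = signed \<alpha> (coeff G S x)"
  and sign_part_closed: "x \<in> carrier G \<Longrightarrow> sign_part G S \<alpha> x \<in> carrier G"
proof -
  assume "x \<in> carrier G"
  then have "signed \<alpha> (coeff G S x) \<in> chains S" by (intro chains_signed coeff_chain)
  moreover have "sign_part G S \<alpha> x = lincomb G (signed \<alpha> (coeff G S x))" by (cases \<alpha>) auto
  ultimately show "coeff G S (sign_part G S \<alpha> x) = signed \<alpha> (coeff G S x)" "sign_part G S \<alpha> x \<in> carrier G"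
    using coeff_lincomb lincomb_closed by simp_all
qed

text \<open>Multiples of one basis element already form a copy of the integers. The carrier type is
  hence large enough for test complexes encoded by pairs of integers.\<close>

lemma basis_infinite:
  assumes "b \<in> S"
  shows "infinite (carrier G)"
proof -
  have ch: "(\<lambda>x. k * single b x) \<in> chains S" for k
    using assms by (auto simp: chains_def single_def)
  have "inj (\<lambda>k. lincomb G (\<lambda>x. k * single b x))"
  proof (rule injI)
    fix k l assume "lincomb G (\<lambda>x. k * single b x) = lincomb G (\<lambda>x. l * single b x)"
    then have "(\<lambda>x. k * single b x) = (\<lambda>x. l * single b x)" using coeff_lincomb[OF ch] by metis
    from fun_cong[OF this, of b] show "k = l" by simp
  qed
  moreover have "range (\<lambda>k. lincomb G (\<lambda>x. k * single b x)) \<subseteq> carrier G"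
    using lincomb_closed[OF ch] by blast
  ultimately show ?thesis
    by (meson finite_imageD finite_subset infinite_UNIV_int)
qed

end

locale steiner_adc = aug_dir_complex K for K :: "'a adc" +
  fixes B :: "nat \<Rightarrow> 'a set"
  assumes basis: "unitary_loop_free_basis K B"
begin

sublocale grp: based_group "grp K n" "B n" for n
  using basis grp_comm_group
  by (simp add: based_group_def based_group_axioms_def unitary_loop_free_basis_def adc_basis_def)

lemma basis_pos: "b \<in> B n \<Longrightarrow> b \<in> pos K n"
  using basis by (auto simp: unitary_loop_free_basis_def adc_basis_def monoid_basis_def)

lemma basis_carrier: "b \<in> B n \<Longrightarrow> b \<in> carrier (grp K n)"
  using basis_pos pos_carrier by blast

definition cf :: "nat \<Rightarrow> 'a \<Rightarrow> 'a \<Rightarrow> int" where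
  "cf n = coeff (grp K n) (B n)"

definition cd :: "nat \<Rightarrow> ('a \<Rightarrow> int) \<Rightarrow> 'a \<Rightarrow> int" where
  "cd n f = cf n (bd K n (lincomb (grp K (Suc n)) f))"

definition caug :: "('a \<Rightarrow> int) \<Rightarrow> int" where
  "caug f = aug K (lincomb (grp K 0) f)"

lemma cf_bd: "x \<in> carrier (grp K (Suc n)) \<Longrightarrow> cf n (bd K n x) = cd n (cf (Suc n) x)"
  by (simp add: cd_def cf_def grp.lincomb_coeff)

lemma caug_cf: "x \<in> carrier (grp K 0) \<Longrightarrow> caug (cf 0 x) = aug K x"
  by (simp add: caug_def cf_def grp.lincomb_coeff)

lemma pos_iff: "x \<in> carrier (grp K n) \<Longrightarrow> x \<in> pos K n \<longleftrightarrow> 0 \<le> cf n x"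
  using grp.coeff_nonneg_iff[OF _ pos_submonoid] basis
  by (simp add: cf_def unitary_loop_free_basis_def adc_basis_def)

sublocale chain_complex B cd caug
proof
  fix n f g
  assume f: "f \<in> chains (B (Suc n))"
  show "cd n f \<in> chains (B n)"
    using f by (simp add: cd_def cf_def grp.coeff_chain bd_carrier grp.lincomb_closed)
  show "cd n (f + g) = cd n f + cd n g" if "g \<in> chains (B (Suc n))"
    using f that by (simp add: cd_def cf_def grp.lincomb_add grp.lincomb_closed bd_mult bd_carrier grp.coeff_mult)
next
  fix n f
  assume f: "f \<in> chains (B (Suc (Suc n)))"
  have "cd n (cd (Suc n) f) = cf n (bd K n (bd K (Suc n) (lincomb (grp K (Suc (Suc n))) f)))"
    unfolding cd_def[of "Suc n"] using f by (subst cf_bd) (auto intro: bd_carrier grp.lincomb_closed)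
  then show "cd n (cd (Suc n) f) = 0" using f by (simp add: bd_bd grp.lincomb_closed cf_def)
next
  fix f g assume "f \<in> chains (B 0)" "g \<in> chains (B 0)"
  then show "caug (f + g) = caug f + caug g"
    by (simp add: caug_def grp.lincomb_add grp.lincomb_closed aug_mult)
next
  fix f assume f: "f \<in> chains (B 1)"
  then have "caug (cd 0 f) = aug K (bd K 0 (lincomb (grp K 1) f))"
    unfolding cd_def using bd_carrier[OF grp.lincomb_closed, of f 0] by (simp add: caug_cf)
  then show "caug (cd 0 f) = 0" using f aug_bd grp.lincomb_closed by simp
qed

lemma atom_carrier_cf:
  assumes "b \<in> B n"
  shows "atom K B n b k \<alpha> \<in> carrier (grp K k) \<and> cf k (atom K B n b k \<alpha>) = atm n b k \<alpha>"
proof (induction "n - k" arbitrary: k)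
  case 0
  then have "atom K B n b k \<alpha> = (if k = n then b else \<one>\<^bsub>grp K k\<^esub>)" by (subst atom.simps) simp
  then show ?case using 0 assms basis_carrier by (cases "k = n") (auto simp: cf_def grp.coeff_basis)
next
  case (Suc m)
  then have k: "k < n" by simp
  then have "atom K B n b (Suc k) \<alpha> \<in> carrier (grp K (Suc k)) \<and>
      cf (Suc k) (atom K B n b (Suc k) \<alpha>) = atm n b (Suc k) \<alpha>"
    using Suc by (intro Suc.hyps(1)) simp
  moreover have "atom K B n b k \<alpha> = sign_part (grp K k) (B k) \<alpha> (bd K k (atom K B n b (Suc k) \<alpha>))"
    using k by (subst atom.simps) (simp add: bd_sign_def)
  moreover have "atm n b k \<alpha> = signed \<alpha> (cd k (atm n b (Suc k) \<alpha>))"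
    using k by (subst atm.simps) simp
  ultimately show ?case
    using bd_carrier[of "atom K B n b (Suc k) \<alpha>" k] cf_bd[of "atom K B n b (Suc k) \<alpha>" k]
      grp.sign_part_closed[of "bd K k (atom K B n b (Suc k) \<alpha>)" k \<alpha>]
      grp.coeff_sign_part[of "bd K k (atom K B n b (Suc k) \<alpha>)" k \<alpha>]
    by (simp add: cf_def)
qed

lemma atom_carrier: "b \<in> B n \<Longrightarrow> atom K B n b k \<alpha> \<in> carrier (grp K k)"
  and cf_atom: "b \<in> B n \<Longrightarrow> cf k (atom K B n b k \<alpha>) = atm n b k \<alpha>"
  using atom_carrier_cf by blast+

lemma cf_meet:
  assumes "x \<in> carrier (grp K n)" "y \<in> carrier (grp K n)"
  shows "meet (grp K n) (B n) x y = \<one>\<^bsub>grp K n\<^esub> \<longleftrightarrow> (\<forall>b. min (cf n x b) (cf n y b) = 0)"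
proof -
  let ?m = "\<lambda>b. min (cf n x b) (cf n y b)"
  have "cf n x \<in> chains (B n)" "cf n y \<in> chains (B n)" using assms grp.coeff_chain by (simp_all add: cf_def)
  moreover have "{b. ?m b \<noteq> 0} \<subseteq> {b. cf n x b \<noteq> 0} \<union> {b. cf n y b \<noteq> 0}" by (auto simp: min_def)
  ultimately have m: "?m \<in> chains (B n)" unfolding chains_def by (auto intro: finite_subset)
  have "meet (grp K n) (B n) x y = lincomb (grp K n) ?m" by (simp add: meet_def cf_def)
  moreover have "lincomb (grp K n) ?m = \<one>\<^bsub>grp K n\<^esub> \<longleftrightarrow> ?m = 0"
  proof
    assume "lincomb (grp K n) ?m = \<one>\<^bsub>grp K n\<^esub>"
    then show "?m = 0" using grp.coeff_lincomb[OF m] by simp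
  qed (simp only: grp.lincomb_0)
  ultimately show ?thesis by (auto simp: fun_eq_iff)
qed

text \<open>The relation \<open>odot_gen\<close> runs against feeding: if \<open>t\<close> feeds
  \<open>t'\<close>, the target of \<open>t\<close> meets the source of \<open>t'\<close>. In a
  cycle two successive members would be equal by antisymmetry of \<open>odot\<close>, but source and
  target of an atom are disjoint, so nothing feeds itself.\<close>

sublocale steiner_complex B cd caug
proof
  show "caug (atm p b 0 \<alpha>) = 1" if "b \<in> B p" for b p \<alpha>
    using that basis atom_carrier[OF that] cf_atom[OF that] caug_cf
    by (cases \<alpha>) (metis unitary_loop_free_basis_def unitary_def)+
  fix k
  let ?r = "{(t, t'). t \<in> transitions k \<and> t' \<in> transitions k \<and> (\<exists>f. 0 < post k t f \<and> 0 < pre k t' f)}"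
  have sub: "(t', t) \<in> odot_gen K B k" if r: "(t, t') \<in> ?r" for t t'
  proof -
    obtain q b p a where tt: "t = (q, b)" "t' = (p, a)" by (cases t, cases t') blast
    obtain f where "k < q" "k < p" "a \<in> B p" "b \<in> B q" "0 < atm q b k Plus f" "0 < atm p a k Minus f"
      using r unfolding tt by (auto simp: transitions_def)
    note t = tt this
    have "min (cf k (atom K B p a k Minus) f) (cf k (atom K B q b k Plus) f) \<noteq> 0"
      using t by (simp add: cf_atom)
    then show ?thesis using t cf_meet[OF atom_carrier atom_carrier, of a p b q k]
      by (auto simp: odot_gen_def)
  qed
  have anti: "t = t'" if "(t, t') \<in> (odot_gen K B k)\<^sup>*" "(t', t) \<in> (odot_gen K B k)\<^sup>*"
    "t \<in> Sigma UNIV B" "t' \<in> Sigma UNIV B" for t t'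
  proof -
    have "antisym (odot K B k)" using basis
      by (auto simp: unitary_loop_free_basis_def loop_free_def partial_order_on_def)
    then show ?thesis using that by (auto simp: odot_def antisym_def)
  qed
  show "acyclic ?r"
    unfolding acyclic_def
  proof
    fix t
    show "(t, t) \<notin> ?r\<^sup>+"
    proof
      assume "(t, t) \<in> ?r\<^sup>+"
      then obtain u where u: "(t, u) \<in> ?r" "(u, t) \<in> ?r\<^sup>*" by (meson tranclD)
      have "(v, w) \<in> (odot_gen K B k)\<^sup>*" if "(w, v) \<in> ?r\<^sup>*" for v w
        using that
      proof (induction rule: rtrancl_induct)
        case (step y z)
        then show ?case using sub[OF step(2)] by (meson converse_rtrancl_into_rtrancl)
      qed simp
      then have "(t, u) \<in> (odot_gen K B k)\<^sup>*" using u(2) .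
      moreover have "(u, t) \<in> (odot_gen K B k)\<^sup>*" using sub[OF u(1)] by blast
      moreover have "t \<in> Sigma UNIV B" "u \<in> Sigma UNIV B" using u(1) by (auto simp: transitions_def)
      ultimately have "u = t" using anti by blast
      then obtain f where "t \<in> transitions k" "0 < post k t f" "0 < pre k t f" using u(1) by blast
      then show False using atm_disjoint[of "snd t" "fst t" k f] by (cases t) (auto simp: transitions_def)
    qed
  qed
qed

section \<open>Translation between cells and their coefficients\<close>

definition enc :: "'a family \<Rightarrow> nat \<Rightarrow> sign \<Rightarrow> 'a \<Rightarrow> int" where
  "enc x = (\<lambda>k \<alpha>. cf k (x k \<alpha>))"

definition dec :: "('a \<Rightarrow> int) family \<Rightarrow> 'a family" where
  "dec z = (\<lambda>k \<alpha>. lincomb (grp K k) (z k \<alpha>))"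

lemma cf_chain: "x \<in> carrier (grp K n) \<Longrightarrow> cf n x \<in> chains (B n)"
  by (simp add: cf_def grp.coeff_chain)

lemma cf_mult: "\<lbrakk>x \<in> carrier (grp K n); y \<in> carrier (grp K n)\<rbrakk> \<Longrightarrow> cf n (x \<otimes>\<^bsub>grp K n\<^esub> y) = cf n x + cf n y"
  by (simp add: cf_def grp.coeff_mult)

lemma cf_inv: "x \<in> carrier (grp K n) \<Longrightarrow> cf n (inv\<^bsub>grp K n\<^esub> x) = - cf n x"
  by (simp add: cf_def grp.coeff_inv)

lemma cf_one [simp]: "cf n \<one>\<^bsub>grp K n\<^esub> = 0"
  by (simp add: cf_def)

lemma cf_inject: "\<lbrakk>x \<in> carrier (grp K n); y \<in> carrier (grp K n)\<rbrakk> \<Longrightarrow> cf n x = cf n y \<longleftrightarrow> x = y"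
  by (simp add: cf_def grp.coeff_inject)

lemma dec_enc: "entries x \<Longrightarrow> dec (enc x) = x"
  by (simp add: dec_def enc_def entries_def cf_def grp.lincomb_coeff)

lemma enc_dec: "x \<in> all_cells \<Longrightarrow> enc (dec x) = x"
  using all_cells_chain by (simp add: dec_def enc_def cf_def grp.coeff_lincomb)

lemma dec_entries: "x \<in> all_cells \<Longrightarrow> entries (dec x)"
  using all_cells_chain by (simp add: dec_def entries_def grp.lincomb_closed)

lemma enc_cell_iff:
  assumes "entries x"
  shows "enc x \<in> cells_above n None \<longleftrightarrow> x \<in> nu_cells K n"
proof -
  note e = entriesD[OF assms]
  have 1: "(\<forall>k \<alpha>. enc x k \<alpha> \<in> chains (B k) \<and> 0 \<le> enc x k \<alpha>) \<longleftrightarrow> (\<forall>k \<alpha>. x k \<alpha> \<in> pos K k)"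
    using e by (simp add: enc_def cf_chain pos_iff)
  have 2: "(\<forall>k \<alpha>. cd k (enc x (Suc k) \<alpha>) = enc x k Plus - enc x k Minus) \<longleftrightarrow>
      (\<forall>k \<alpha>. bd K k (x (Suc k) \<alpha>) = x k Plus \<otimes>\<^bsub>grp K k\<^esub> inv\<^bsub>grp K k\<^esub> (x k Minus))"
  proof -
    have "cf k (x k Plus \<otimes>\<^bsub>grp K k\<^esub> inv\<^bsub>grp K k\<^esub> (x k Minus)) = enc x k Plus - enc x k Minus" for k
      using e by (simp add: enc_def cf_mult cf_inv)
    moreover have "x k Plus \<otimes>\<^bsub>grp K k\<^esub> inv\<^bsub>grp K k\<^esub> (x k Minus) \<in> carrier (grp K k)" for k
      using e by simp
    ultimately show ?thesis using e cf_bd[OF e] cf_inject[OF bd_carrier[OF e]]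
      by (metis enc_def)
  qed
  have 3: "(\<forall>k \<alpha>. n < k \<longrightarrow> enc x k \<alpha> = 0) \<longleftrightarrow> (\<forall>k \<alpha>. n < k \<longrightarrow> x k \<alpha> = \<one>\<^bsub>grp K k\<^esub>)"
    using e cf_inject cf_one by (metis enc_def grp.one_closed)
  have 4: "(\<forall>\<alpha>. caug (enc x 0 \<alpha>) = 1) \<longleftrightarrow> (\<forall>\<alpha>. aug K (x 0 \<alpha>) = 1)"
    using e by (simp add: enc_def caug_cf)
  show ?thesis unfolding cells_above_def all_cells_def nu_cells_iff using 1 2 3 4 by auto
qed

lemma enc_cells: "x \<in> nu_cells K n \<Longrightarrow> enc x \<in> cells_above n None"
  using enc_cell_iff nu_cells_entries by blast

lemma dec_cells: "x \<in> cells_above n None \<Longrightarrow> dec x \<in> nu_cells K n"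
  using enc_cell_iff[OF dec_entries] enc_dec cells_aboveD(1) by metis

lemma enc_face: "entries x \<Longrightarrow> enc (nu_face K k \<alpha> x) = cface k \<alpha> (enc x)"
  by (auto simp: enc_def nu_face_def cface_def fun_eq_iff)

lemma entries_face: "entries x \<Longrightarrow> entries (nu_face K k \<alpha> x)"
  by (auto simp: entries_def nu_face_def)

lemma entries_comp: "entries x \<Longrightarrow> entries y \<Longrightarrow> entries (nu_comp K k x y)"
  using entries_face by (auto simp: entries_def nu_comp_def)

lemma enc_comp: "entries x \<Longrightarrow> entries y \<Longrightarrow> enc (nu_comp K k x y) = ccomp k (enc x) (enc y)"
  using entriesD entries_face[of x k Minus]
  by (simp add: ccomp_def flip: enc_face) (auto simp: enc_def nu_comp_def fun_eq_iff cf_mult cf_inv entries_def)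

lemma enc_inject: "entries x \<Longrightarrow> entries y \<Longrightarrow> enc x = enc y \<longleftrightarrow> x = y"
  using dec_enc by metis

lemma entries_atom: "b \<in> B n \<Longrightarrow> entries (atom K B n b)"
  by (simp add: entries_def atom_carrier)

lemma enc_atom: "b \<in> B n \<Longrightarrow> enc (atom K B n b) = atm n b"
  by (auto simp: enc_def cf_atom fun_eq_iff)

lemma dec_atm: "b \<in> B n \<Longrightarrow> dec (atm n b) = atom K B n b"
  using dec_enc[OF entries_atom] enc_atom by metis

lemma atom_cell: "b \<in> B n \<Longrightarrow> n \<le> k \<Longrightarrow> atom K B n b \<in> nu_cells K k"
  using enc_cell_iff[OF entries_atom] enc_atom atm_cls(2) by metis

lemma nu_cell_induct [consumes 1, case_names atom comp]:
  assumes "x \<in> nu_cells K n"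
    and "\<And>p b. b \<in> B p \<Longrightarrow> p \<le> n \<Longrightarrow> P (atom K B p b)"
    and "\<And>k x y. \<lbrakk>k < n; x \<in> nu_cells K n; y \<in> nu_cells K n; nu_face K k Minus x = nu_face K k Plus y; P x; P y\<rbrakk>
      \<Longrightarrow> P (nu_comp K k x y)"
  shows "P x"
proof -
  have "P (dec (enc x))"
    using enc_cells[OF assms(1)]
  proof (induction rule: cell_induct)
    case (atm p b)
    then show ?case using assms(2) by (simp add: dec_atm)
  next
    case (comp k x y)
    have c: "dec x \<in> nu_cells K n" "dec y \<in> nu_cells K n" using comp dec_cells by blast+
    note en = nu_cells_entries[OF c(1)] nu_cells_entries[OF c(2)]
    have e: "enc (dec x) = x" "enc (dec y) = y" using comp enc_dec cells_aboveD(1) by blast+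
    have "nu_face K k Minus (dec x) = nu_face K k Plus (dec y)"
      using enc_inject[OF entries_face[OF en(1)] entries_face[OF en(2)]] comp(4) en e by (simp add: enc_face)
    then have "P (nu_comp K k (dec x) (dec y))" using assms(3) comp c by blast
    moreover have "nu_comp K k (dec x) (dec y) = dec (ccomp k x y)"
      using dec_enc[OF entries_comp[OF en]] enc_comp[OF en] e by metis
    ultimately show ?case by simp
  qed
  then show ?thesis using dec_enc nu_cells_entries[OF assms(1)] by simp
qed

end

section \<open>Morphisms and pushouts of augmented directed complexes\<close>

lemma adc_morD:
  assumes "adc_mor K L f"
  shows "aug_dir_complex K" "aug_dir_complex L" "f n \<in> hom (grp K n) (grp L n)"
    "x \<in> carrier (grp K n) \<Longrightarrow> f n x \<in> carrier (grp L n)"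
    "\<lbrakk>x \<in> carrier (grp K n); y \<in> carrier (grp K n)\<rbrakk> \<Longrightarrow>
      f n (x \<otimes>\<^bsub>grp K n\<^esub> y) = f n x \<otimes>\<^bsub>grp L n\<^esub> f n y"
    "x \<in> carrier (grp K (Suc n)) \<Longrightarrow> f n (bd K n x) = bd L n (f (Suc n) x)"
    "x \<in> carrier (grp K 0) \<Longrightarrow> aug L (f 0 x) = aug K x"
    "x \<in> pos K n \<Longrightarrow> f n x \<in> pos L n"
    "f n \<one>\<^bsub>grp K n\<^esub> = \<one>\<^bsub>grp L n\<^esub>"
    "x \<in> carrier (grp K n) \<Longrightarrow> f n (inv\<^bsub>grp K n\<^esub> x) = inv\<^bsub>grp L n\<^esub> (f n x)"
proof -
  show a: "aug_dir_complex K" "aug_dir_complex L" "f n \<in> hom (grp K n) (grp L n)"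
    using assms by (simp_all add: adc_mor_def)
  interpret group_hom "grp K n" "grp L n" "f n"
    using a aug_dir_complex.grp_group[of K n] aug_dir_complex.grp_group[of L n]
    by (auto simp: group_hom_def group_hom_axioms_def)
  show "x \<in> carrier (grp K n) \<Longrightarrow> f n x \<in> carrier (grp L n)"
    "\<lbrakk>x \<in> carrier (grp K n); y \<in> carrier (grp K n)\<rbrakk> \<Longrightarrow>
      f n (x \<otimes>\<^bsub>grp K n\<^esub> y) = f n x \<otimes>\<^bsub>grp L n\<^esub> f n y"
    "f n \<one>\<^bsub>grp K n\<^esub> = \<one>\<^bsub>grp L n\<^esub>"
    "x \<in> carrier (grp K n) \<Longrightarrow> f n (inv\<^bsub>grp K n\<^esub> x) = inv\<^bsub>grp L n\<^esub> (f n x)"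
    by simp_all
  show "x \<in> carrier (grp K (Suc n)) \<Longrightarrow> f n (bd K n x) = bd L n (f (Suc n) x)"
    "x \<in> carrier (grp K 0) \<Longrightarrow> aug L (f 0 x) = aug K x"
    "x \<in> pos K n \<Longrightarrow> f n x \<in> pos L n"
    using assms unfolding adc_mor_def by blast+
qed

lemma nu_map_cell:
  assumes "adc_mor K L f" "x \<in> nu_cells K n"
  shows "nu_map f m x \<in> nu_cells L n"
proof -
  note f = adc_morD[OF assms(1)]
  interpret K: aug_dir_complex K by (rule f)
  interpret L: aug_dir_complex L by (rule f)
  interpret Kg: group "grp K q" for q by (rule K.grp_group)
  note x = K.nu_cellsD[OF assms(2)]
  have "bd L k (f (Suc k) (x (Suc k) \<alpha>)) = f k (x k Plus) \<otimes>\<^bsub>grp L k\<^esub> inv\<^bsub>grp L k\<^esub> (f k (x k Minus))" for k \<alpha>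
    using x(4)[of k \<alpha>] x(6) f(5,6,10) by (metis Kg.inv_closed)
  then show ?thesis unfolding L.nu_cells_iff using x f by (simp add: nu_map_def)
qed

lemma nu_map_face: "adc_mor K L f \<Longrightarrow> nu_map f n (nu_face K k \<alpha> x) = nu_face L k \<alpha> (nu_map f m x)"
  using adc_morD(9)[of K L f] by (auto simp: nu_map_def nu_face_def fun_eq_iff)

lemma nu_map_comp:
  assumes "adc_mor K L f" "\<And>j \<beta>. x j \<beta> \<in> carrier (grp K j)" "\<And>j \<beta>. y j \<beta> \<in> carrier (grp K j)"
  shows "nu_map f n (nu_comp K k x y) = nu_comp L k (nu_map f n x) (nu_map f n y)"
proof -
  note f = adc_morD[OF assms(1)]
  interpret K: aug_dir_complex K by (rule f)
  interpret Kg: group "grp K q" for q by (rule K.grp_group)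
  have c: "nu_face K k Minus x j \<beta> \<in> carrier (grp K j)" for j \<beta>
    using assms by (simp add: nu_face_def)
  have face: "f j (nu_face K k Minus x j \<beta>) = nu_face L k Minus (nu_map f n x) j \<beta>" for j \<beta>
    using fun_cong[OF fun_cong[OF nu_map_face[OF assms(1)]]] by (simp add: nu_map_def)
  have hom: "f j (a \<otimes>\<^bsub>grp K j\<^esub> inv\<^bsub>grp K j\<^esub> b \<otimes>\<^bsub>grp K j\<^esub> c) = f j a \<otimes>\<^bsub>grp L j\<^esub> inv\<^bsub>grp L j\<^esub> (f j b) \<otimes>\<^bsub>grp L j\<^esub> f j c"
    if "a \<in> carrier (grp K j)" "b \<in> carrier (grp K j)" "c \<in> carrier (grp K j)" for j a b c
    using that f(5)[of "a \<otimes>\<^bsub>grp K j\<^esub> inv\<^bsub>grp K j\<^esub> b" j c] f(5)[of a j "inv\<^bsub>grp K j\<^esub> b"] f(10)[of b j] by simp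
  show ?thesis
  proof (intro ext)
    fix j \<beta>
    have "f j (nu_comp K k x y j \<beta>) = nu_comp L k (nu_map f n x) (nu_map f n y) j \<beta>"
      unfolding nu_comp_def hom[OF assms(2) c assms(3)] face by (simp only: nu_map_def)
    then show "nu_map f n (nu_comp K k x y) j \<beta> = nu_comp L k (nu_map f n x) (nu_map f n y) j \<beta>"
      by (simp only: nu_map_def)
  qed
qed

lemma omega_functor_nu:
  assumes "adc_mor K L f"
  shows "omega_functor (nu K) (nu L) (nu_map f)"
proof -
  interpret K: aug_dir_complex K by (rule adc_morD[OF assms])
  interpret L: aug_dir_complex L by (rule adc_morD[OF assms])
  have "nu_map f n (nu_comp K k x y) = nu_comp L k (nu_map f n x) (nu_map f n y)"
    if "composable (nu K) n k x y" for n k x y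
    using that K.nu_cellsD(6) by (intro nu_map_comp assms) (auto simp: composable_def)
  then show ?thesis
    unfolding omega_functor_def
    using K.omega_category_nu L.omega_category_nu nu_map_cell[OF assms] nu_map_face[OF assms]
    by (auto simp: nu_map_def)
qed

section \<open>Consequences of the universal property of a pushout of complexes\<close>

lemma pushoutD:
  assumes "adc_pushout TYPE('x) K M0 M1 M k0 k1 l0 l1"
  shows "adc_mor K M0 k0" "adc_mor K M1 k1" "adc_mor M0 M l0" "adc_mor M1 M l1"
    "\<forall>n. \<forall>x\<in>carrier (grp K n). l0 n (k0 n x) = l1 n (k1 n x)"
proof -
  show "adc_mor K M0 k0" "adc_mor K M1 k1" "adc_mor M0 M l0" "adc_mor M1 M l1"
    using assms unfolding adc_pushout_def by blast+
  have "adc_mor_eq K (\<lambda>n. l0 n \<circ> k0 n) (\<lambda>n. l1 n \<circ> k1 n)"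
    using assms unfolding adc_pushout_def by blast
  then show "\<forall>n. \<forall>x\<in>carrier (grp K n). l0 n (k0 n x) = l1 n (k1 n x)"
    by (simp add: adc_mor_eq_def)
qed

lemma pushout_universal:
  fixes X :: "'x adc"
  assumes "adc_pushout TYPE('x) K M0 M1 M k0 k1 l0 l1" "adc_mor M0 X g0" "adc_mor M1 X g1"
    and "\<forall>n. \<forall>x\<in>carrier (grp K n). g0 n (k0 n x) = g1 n (k1 n x)"
  shows "\<exists>h. adc_mor M X h \<and> (\<forall>n. \<forall>x\<in>carrier (grp M0 n). h n (l0 n x) = g0 n x) \<and>
     (\<forall>n. \<forall>x\<in>carrier (grp M1 n). h n (l1 n x) = g1 n x) \<and>
     (\<forall>h'. adc_mor M X h' \<and> (\<forall>n. \<forall>x\<in>carrier (grp M0 n). h' n (l0 n x) = g0 n x) \<and>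
       (\<forall>n. \<forall>x\<in>carrier (grp M1 n). h' n (l1 n x) = g1 n x) \<longrightarrow>
       (\<forall>n. \<forall>x\<in>carrier (grp M n). h' n x = h n x))"
proof -
  have "adc_mor_eq K (\<lambda>n. g0 n \<circ> k0 n) (\<lambda>n. g1 n \<circ> k1 n)"
    using assms(4) by (simp add: adc_mor_eq_def)
  then have "\<exists>h. adc_mor M X h \<and>
      adc_mor_eq M0 (\<lambda>n. h n \<circ> l0 n) g0 \<and> adc_mor_eq M1 (\<lambda>n. h n \<circ> l1 n) g1 \<and>
      (\<forall>h'. adc_mor M X h' \<and> adc_mor_eq M0 (\<lambda>n. h' n \<circ> l0 n) g0 \<and> adc_mor_eq M1 (\<lambda>n. h' n \<circ> l1 n) g1 \<longrightarrow>
        adc_mor_eq M h' h)"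
    using assms(1-3) unfolding adc_pushout_def by blast
  then show ?thesis unfolding adc_mor_eq_def comp_def .
qed

lemma adc_mor_id: "aug_dir_complex M \<Longrightarrow> adc_mor M M (\<lambda>n x. x)"
  by (auto simp: adc_mor_def hom_def)

text \<open>\<open>h\<close> and the identity both mediate from the square to the cocone formed by
  \<open>l0\<close> and \<open>l1\<close>.\<close>

lemma pushout_endomorphism:
  fixes M :: "'x adc"
  assumes po: "adc_pushout TYPE('x) K M0 M1 M k0 k1 l0 l1" and h: "adc_mor M M h"
    and "\<And>n x. x \<in> carrier (grp M0 n) \<Longrightarrow> h n (l0 n x) = l0 n x"
    and "\<And>n x. x \<in> carrier (grp M1 n) \<Longrightarrow> h n (l1 n x) = l1 n x"
    and x: "x \<in> carrier (grp M n)"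
  shows "h n x = x"
proof -
  note pob = pushoutD[OF po]
  let ?U = "\<lambda>h. adc_mor M M h \<and> (\<forall>n. \<forall>x\<in>carrier (grp M0 n). h n (l0 n x) = l0 n x) \<and>
      (\<forall>n. \<forall>x\<in>carrier (grp M1 n). h n (l1 n x) = l1 n x)"
  have "\<exists>h0. \<forall>h'. ?U h' \<longrightarrow> (\<forall>n. \<forall>x\<in>carrier (grp M n). h' n x = h0 n x)"
    using pushout_universal[OF po pob(3,4,5)] by (elim exE conjE) (rule exI)
  then obtain h0 where h0: "\<forall>h'. ?U h' \<longrightarrow> (\<forall>n. \<forall>x\<in>carrier (grp M n). h' n x = h0 n x)" ..
  have "?U h" using h assms(3,4) by blast
  from h0[THEN spec, THEN mp, OF this] have "h n x = h0 n x" using x by blast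
  moreover have "?U (\<lambda>n x. x)" using adc_mor_id[OF adc_morD(1)[OF h]] by blast
  from h0[THEN spec, THEN mp, OF this] have "x = h0 n x" using x by blast
  ultimately show ?thesis by simp
qed

text \<open>The sums of images of positive chains already satisfy the universal property of the positive chains
  of the pushout.\<close>

lemma pushout_pos:
  fixes M :: "'x adc"
  assumes po: "adc_pushout TYPE('x) K M0 M1 M k0 k1 l0 l1" and x: "x \<in> pos M n"
  shows "\<exists>y\<in>pos M0 n. \<exists>z\<in>pos M1 n. x = l0 n y \<otimes>\<^bsub>grp M n\<^esub> l1 n z"
proof -
  define Q where "Q n = {l0 n y \<otimes>\<^bsub>grp M n\<^esub> l1 n z | y z. y \<in> pos M0 n \<and> z \<in> pos M1 n}" for n
  define M' where "M' = M\<lparr>pos := Q\<rparr>"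
  have M': "grp M' = grp M" "bd M' = bd M" "aug M' = aug M" "pos M' = Q" by (simp_all add: M'_def)
  note l0 = adc_morD[OF pushoutD(3)[OF po]] and l1 = adc_morD[OF pushoutD(4)[OF po]]
  interpret M: aug_dir_complex M by (rule l0)
  interpret M0: aug_dir_complex M0 by (rule l0)
  interpret M1: aug_dir_complex M1 by (rule l1)
  interpret Mg: comm_group "grp M q" for q by (rule M.grp_comm_group)
  have Q_pos: "Q n \<subseteq> pos M n" for n
    unfolding Q_def using M.pos_mult[OF l0(8) l1(8)] by blast
  have Q_mult: "a \<otimes>\<^bsub>grp M n\<^esub> b \<in> Q n" if ab: "a \<in> Q n" "b \<in> Q n" for a b n
  proof -
    obtain y z y' z' where a: "a = l0 n y \<otimes>\<^bsub>grp M n\<^esub> l1 n z" "y \<in> pos M0 n" "z \<in> pos M1 n"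
      and b: "b = l0 n y' \<otimes>\<^bsub>grp M n\<^esub> l1 n z'" "y' \<in> pos M0 n" "z' \<in> pos M1 n"
      using ab unfolding Q_def by blast
    note c = M0.pos_carrier[OF a(2)] M0.pos_carrier[OF b(2)] M1.pos_carrier[OF a(3)] M1.pos_carrier[OF b(3)]
    have "a \<otimes>\<^bsub>grp M n\<^esub> b = l0 n (y \<otimes>\<^bsub>grp M0 n\<^esub> y') \<otimes>\<^bsub>grp M n\<^esub> l1 n (z \<otimes>\<^bsub>grp M1 n\<^esub> z')"
      unfolding a(1) b(1) l0(5)[OF c(1,2)] l1(5)[OF c(3,4)]
      using l0(4)[OF c(1)] l0(4)[OF c(2)] l1(4)[OF c(3)] l1(4)[OF c(4)] by (simp add: Mg.m_ac)
    then show ?thesis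
      unfolding Q_def using M0.pos_mult[OF a(2) b(2)] M1.pos_mult[OF a(3) b(3)] by blast
  qed
  have Q0: "l0 n y \<in> Q n" if "y \<in> pos M0 n" for y n
  proof -
    have "l0 n y = l0 n y \<otimes>\<^bsub>grp M n\<^esub> l1 n \<one>\<^bsub>grp M1 n\<^esub>"
      unfolding l1(9) using l0(4)[OF M0.pos_carrier[OF that]] by (rule Mg.r_one[symmetric])
    then show ?thesis using that M1.pos_one unfolding Q_def by blast
  qed
  have Q1: "l1 n z \<in> Q n" if "z \<in> pos M1 n" for z n
  proof -
    have "l1 n z = l0 n \<one>\<^bsub>grp M0 n\<^esub> \<otimes>\<^bsub>grp M n\<^esub> l1 n z"
      unfolding l0(9) using l1(4)[OF M1.pos_carrier[OF that]] by (rule Mg.l_one[symmetric])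
    then show ?thesis using that M0.pos_one unfolding Q_def by blast
  qed
  have "\<one>\<^bsub>grp M n\<^esub> \<in> Q n" for n using Q0[OF M0.pos_one] unfolding l0(9) .
  then have sub: "submonoid (Q n) (grp M n)" for n
    using Q_mult Q_pos M.pos_carrier by (intro submonoid.intro) blast+
  have "aug_dir_complex M'"
    by (rule aug_dir_complex.intro)
      (simp_all only: M' M.grp_comm_group M.bd_hom M.bd_bd M.aug_hom M.aug_bd sub)
  then have "adc_mor M0 M' l0" "adc_mor M1 M' l1"
    using pushoutD(3)[OF po] pushoutD(4)[OF po] Q0 Q1 by (simp_all add: adc_mor_def M' image_subset_iff)
  from pushout_universal[OF po this pushoutD(5)[OF po]]
  obtain h where h: "adc_mor M M' h" "\<And>n x. x \<in> carrier (grp M0 n) \<Longrightarrow> h n (l0 n x) = l0 n x"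
    "\<And>n x. x \<in> carrier (grp M1 n) \<Longrightarrow> h n (l1 n x) = l1 n x" by blast
  \<comment> \<open>\<open>M'\<close> differs from \<open>M\<close> only by its smaller sets of
    positive chains, so the mediating morphism into \<open>M'\<close> is also an endomorphism of
    \<open>M\<close>, hence the identity; its values on positive chains nevertheless lie in
    \<open>Q\<close>.\<close>
  have hM: "adc_mor M M h" using h(1) M.aug_dir_complex_axioms subsetD[OF Q_pos]
    by (simp add: adc_mor_def M' image_subset_iff)
  have "x = h n x" using pushout_endomorphism[OF po hM h(2,3)] M.pos_carrier[OF x] by simp
  also have "\<dots> \<in> Q n" using adc_morD(8)[OF h(1) x] by (simp add: M')
  finally show ?thesis by (auto simp: Q_def)
qed

text \<open>A functional on the group of degree \<open>n\<close> is a morphism to a complex with a copy of the integers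
  in the degrees \<open>n\<close> and \<open>Suc n\<close>, connected by the identity, and one more in degree 0 for the
  augmentation. Pairs of integers, encoded in the carrier type by \<open>i\<close>, have room for both.\<close>

definition disk :: "(int \<times> int \<Rightarrow> 'x) \<Rightarrow> nat \<Rightarrow> 'x adc" where
  "disk i n = \<lparr>
    grp = \<lambda>_. \<lparr>carrier = range i,
      monoid.mult = \<lambda>x y. i (fst (inv_into UNIV i x) + fst (inv_into UNIV i y), snd (inv_into UNIV i x) + snd (inv_into UNIV i y)),
      one = i (0, 0)\<rparr>,
    bd = \<lambda>k x. if k = n then i (0, fst (inv_into UNIV i x)) else i (0, 0),
    aug = \<lambda>x. fst (inv_into UNIV i x), pos = \<lambda>_. range i\<rparr>"

text \<open>\<open>p\<close> may be nonzero on boundaries, so degree \<open>Suc n\<close> has to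
  carry \<open>p (bd L n x)\<close>. It sits in the first component there and is moved by the
  boundary into the second one, away from the first component of degree 0, which the augmentation
  reads. This keeps the two apart for \<open>n = 0\<close>.\<close>

definition disk_map :: "(int \<times> int \<Rightarrow> 'x) \<Rightarrow> nat \<Rightarrow> 'y adc \<Rightarrow> ('y \<Rightarrow> int) \<Rightarrow> nat \<Rightarrow> 'y \<Rightarrow> 'x" where
  "disk_map i n L p k x = i (if k = 0 then aug L x else if k = Suc n then p (bd L n x) else 0,
    if k = n then p x else 0)"

lemma disk_simps:
  assumes "inj i"
  shows "carrier (grp (disk i n) k) = range i"
    "i u \<otimes>\<^bsub>grp (disk i n) k\<^esub> i v = i (fst u + fst v, snd u + snd v)"
    "\<one>\<^bsub>grp (disk i n) k\<^esub> = i (0, 0)"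
    "bd (disk i n) k (i u) = (if k = n then i (0, fst u) else i (0, 0))"
    "aug (disk i n) (i u) = fst u" "pos (disk i n) k = range i"
  using assms by (simp_all add: disk_def)

lemma disk_adc:
  assumes "inj i"
  shows "aug_dir_complex (disk i n)"
proof -
  note D = disk_simps[OF assms]
  have cg: "comm_group (grp (disk i n) k)" for k
  proof (rule comm_groupI)
    show "\<exists>y\<in>carrier (grp (disk i n) k). y \<otimes>\<^bsub>grp (disk i n) k\<^esub> x = \<one>\<^bsub>grp (disk i n) k\<^esub>"
      if x: "x \<in> carrier (grp (disk i n) k)" for x
    proof -
      obtain u where u: "x = i u" using x by (auto simp: D(1))
      have "i (- fst u, - snd u) \<otimes>\<^bsub>grp (disk i n) k\<^esub> i u = \<one>\<^bsub>grp (disk i n) k\<^esub>" by (simp add: D)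
      then show ?thesis using u by (intro bexI[of _ "i (- fst u, - snd u)"]) (auto simp: D(1))
    qed
  qed (auto simp: D ac_simps)
  show ?thesis
  proof (rule aug_dir_complex.intro)
    show "bd (disk i n) k \<in> hom (grp (disk i n) (Suc k)) (grp (disk i n) k)" for k by (auto simp: hom_def D)
    show "aug (disk i n) \<in> hom (grp (disk i n) 0) integer_group"
      by (auto simp: hom_def D integer_group_def)
    show "submonoid (pos (disk i n) k) (grp (disk i n) k)" for k by (rule submonoid.intro) (auto simp: D)
  qed (use cg in \<open>auto simp: D\<close>)
qed

lemma disk_map_mor:
  assumes i: "inj i" and L: "aug_dir_complex L"
    and p: "\<And>x y. \<lbrakk>x \<in> carrier (grp L n); y \<in> carrier (grp L n)\<rbrakk> \<Longrightarrow> p (x \<otimes>\<^bsub>grp L n\<^esub> y) = p x + p y"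
  shows "adc_mor L (disk i n) (disk_map i n L p)"
proof -
  interpret L: aug_dir_complex L by (rule L)
  interpret G: group "grp L q" for q by (rule L.grp_group)
  note D = disk_simps[OF i]
  have "p \<one>\<^bsub>grp L n\<^esub> = 0" using p[of "\<one>\<^bsub>grp L n\<^esub>" "\<one>\<^bsub>grp L n\<^esub>"] by simp
  then show ?thesis
    unfolding adc_mor_def using L disk_adc[OF i] p
    by (auto simp: hom_def D disk_map_def L.bd_mult L.bd_carrier L.aug_mult L.bd_bd L.aug_bd)
qed

text \<open>The disk maps of \<open>p0\<close> and \<open>p1\<close> form a cocone, and the
  mediating map returns the functional as the second component in degree \<open>n\<close>.\<close>

lemma pushout_functional:
  fixes M :: "'d adc"
  assumes po: "adc_pushout TYPE('d) K M0 M1 M k0 k1 l0 l1" and inf: "infinite (UNIV :: 'd set)"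
    and p0: "\<And>x y. \<lbrakk>x \<in> carrier (grp M0 n); y \<in> carrier (grp M0 n)\<rbrakk> \<Longrightarrow> p0 (x \<otimes>\<^bsub>grp M0 n\<^esub> y) = p0 x + p0 y"
    and p1: "\<And>x y. \<lbrakk>x \<in> carrier (grp M1 n); y \<in> carrier (grp M1 n)\<rbrakk> \<Longrightarrow> p1 (x \<otimes>\<^bsub>grp M1 n\<^esub> y) = p1 x + p1 y"
    and p01: "\<And>x. x \<in> carrier (grp K n) \<Longrightarrow> p0 (k0 n x) = p1 (k1 n x)"
  shows "\<exists>p :: 'd \<Rightarrow> int. (\<forall>x\<in>carrier (grp M0 n). p (l0 n x) = p0 x) \<and> (\<forall>x\<in>carrier (grp M1 n). p (l1 n x) = p1 x)"
proof -
  obtain j :: "nat \<Rightarrow> 'd" where j: "inj j" using infinite_countable_subset[OF inf] by blast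
  define i :: "int \<times> int \<Rightarrow> 'd" where "i = j \<circ> to_nat"
  have i: "inj i" unfolding i_def by (rule inj_compose[OF j inj_to_nat])
  note pob = pushoutD[OF po]
  note k0 = adc_morD[OF pob(1)] and k1 = adc_morD[OF pob(2)]
  have bd: "bd K k x \<in> carrier (grp K k)" if "x \<in> carrier (grp K (Suc k))" for k x
    by (rule aug_dir_complex.bd_carrier[OF k0(1) that])
  have "\<forall>k. \<forall>x\<in>carrier (grp K k). disk_map i n M0 p0 k (k0 k x) = disk_map i n M1 p1 k (k1 k x)"
  proof (intro allI ballI)
    fix k x assume x: "x \<in> carrier (grp K k)"
    consider "k = 0" | "k = Suc n" | "k \<noteq> 0" "k \<noteq> Suc n" by blast
    then show "disk_map i n M0 p0 k (k0 k x) = disk_map i n M1 p1 k (k1 k x)"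
    proof cases
      case 1
      then show ?thesis using x k0(7) k1(7) p01 by (auto simp: disk_map_def)
    next
      case 2
      then have "p0 (bd M0 n (k0 k x)) = p1 (bd M1 n (k1 k x))"
        using x k0(6)[of x n] k1(6)[of x n] p01[OF bd, of x] by simp
      then show ?thesis using 2 by (simp add: disk_map_def)
    next
      case 3
      then show ?thesis using x p01 by (auto simp: disk_map_def)
    qed
  qed
  note agree = this
  have "adc_mor M0 (disk i n) (disk_map i n M0 p0)" by (rule disk_map_mor[OF i k0(2) p0])
  moreover have "adc_mor M1 (disk i n) (disk_map i n M1 p1)" by (rule disk_map_mor[OF i k1(2) p1])
  ultimately obtain h where h: "\<forall>n'. \<forall>x\<in>carrier (grp M0 n'). h n' (l0 n' x) = disk_map i n M0 p0 n' x"
    "\<forall>n'. \<forall>x\<in>carrier (grp M1 n'). h n' (l1 n' x) = disk_map i n M1 p1 n' x"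
    using pushout_universal[OF po _ _ agree] by blast
  have "\<forall>x\<in>carrier (grp M0 n). snd (inv_into UNIV i (h n (l0 n x))) = p0 x"
    "\<forall>x\<in>carrier (grp M1 n). snd (inv_into UNIV i (h n (l1 n x))) = p1 x"
    using h i by (simp_all add: disk_map_def)
  then show ?thesis by (intro exI[of _ "\<lambda>x. snd (inv_into UNIV i (h n x))"] conjI)
qed

section \<open>Additive functionals on a based group\<close>

context based_group
begin

lemma additive_eq_on_basis:
  fixes p q :: "'a \<Rightarrow> int"
  assumes p: "\<And>x y. \<lbrakk>x \<in> carrier G; y \<in> carrier G\<rbrakk> \<Longrightarrow> p (x \<otimes> y) = p x + p y"
    and q: "\<And>x y. \<lbrakk>x \<in> carrier G; y \<in> carrier G\<rbrakk> \<Longrightarrow> q (x \<otimes> y) = q x + q y"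
    and eq: "\<And>b. b \<in> S \<Longrightarrow> p b = q b" and x: "x \<in> carrier G"
  shows "p x = q x"
proof -
  have pos: "p (lincomb G f) = q (lincomb G f)" if f: "f \<in> chains S" "0 \<le> f" for f
  proof -
    obtain es where es: "set es \<subseteq> S" "f = (\<Sum>e\<leftarrow>es. single e)" using nonneg_chain_sum[OF f] by blast
    have "p (lincomb G (\<Sum>e\<leftarrow>es. single e)) = q (lincomb G (\<Sum>e\<leftarrow>es. single e))"
      using es(1)
    proof (induction es)
      case Nil
      have "p \<one> = q \<one>" using p[of \<one> \<one>] q[of \<one> \<one>] by simp
      then show ?case by (simp only: list.map sum_list.Nil lincomb_0)
    next
      case (Cons e es)
      let ?f = "\<Sum>e\<leftarrow>es. single e"
      have c: "?f \<in> chains S" "single e \<in> chains S" "e \<in> carrier G"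
        using Cons.prems basis_carrier by (auto intro!: chains_sum_list chains_single)
      have "lincomb G (single e + ?f) = e \<otimes> lincomb G ?f"
        using c Cons.prems by (simp add: lincomb_add lincomb_single)
      then have "p (lincomb G (single e + ?f)) = q (lincomb G (single e + ?f))"
        using c Cons p q eq lincomb_closed by simp
      then show ?case by (simp only: list.map sum_list.Cons)
    qed
    then show ?thesis using es(2) by simp
  qed
  let ?f = "coeff G S x"
  let ?P = "lincomb G (signed Plus ?f)" and ?M = "lincomb G (signed Minus ?f)"
  have f: "?f \<in> chains S" using coeff_chain x by blast
  have c: "signed \<alpha> ?f \<in> chains S" for \<alpha> using chains_signed[OF f] .
  have "lincomb G (signed Plus ?f) = lincomb G (?f + signed Minus ?f)"
    using signed_diff[of ?f] by (metis diff_add_cancel)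
  also have "\<dots> = x \<otimes> ?M" unfolding lincomb_add[OF f c] lincomb_coeff[OF x] ..
  finally have "?P = x \<otimes> ?M" .
  have "p ?P = p x + p ?M" "q ?P = q x + q ?M"
    using p[OF x lincomb_closed[OF c[of Minus]]] q[OF x lincomb_closed[OF c[of Minus]]] unfolding \<open>?P = x \<otimes> ?M\<close> by blast+
  moreover have "p ?P = q ?P" "p ?M = q ?M" using pos c signed_nonneg by blast+
  ultimately show ?thesis by linarith
qed

text \<open>The additive extension of the indicator function of \<open>C\<close> on the
  basis.\<close>

definition mass :: "('a \<Rightarrow> bool) \<Rightarrow> 'a \<Rightarrow> int" where
  "mass C x = (\<Sum>b | coeff G S x b \<noteq> 0. coeff G S x b * of_bool (C b))"

lemma mass_superset:
  "\<lbrakk>finite A; {b. coeff G S x b \<noteq> 0} \<subseteq> A\<rbrakk> \<Longrightarrow> mass C x = (\<Sum>b\<in>A. coeff G S x b * of_bool (C b))"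
  unfolding mass_def by (intro sum.mono_neutral_left) auto

lemma mass_mult:
  assumes "x \<in> carrier G" "y \<in> carrier G"
  shows "mass C (x \<otimes> y) = mass C x + mass C y"
proof -
  let ?A = "{b. coeff G S x b \<noteq> 0} \<union> {b. coeff G S y b \<noteq> 0}"
  have A: "finite ?A" using coeff_chain[OF assms(1)] coeff_chain[OF assms(2)] by (simp add: chains_def)
  have "mass C (x \<otimes> y) = (\<Sum>b\<in>?A. coeff G S (x \<otimes> y) b * of_bool (C b))"
    using assms by (intro mass_superset A) (auto simp: coeff_mult)
  also have "\<dots> = mass C x + mass C y"
    using assms mass_superset[OF A, of x C] mass_superset[OF A, of y C]
    by (simp add: coeff_mult distrib_right sum.distrib)
  finally show ?thesis .
qed

lemma mass_basis: "b \<in> S \<Longrightarrow> mass C b = of_bool (C b)"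
  using mass_superset[of "{b}" b C] by (auto simp: coeff_basis single_def)

end

section \<open>Quasi-rigid pushout squares\<close>

lemma quasi_rigidD:
  assumes "quasi_rigid L BL N BN f" "b \<in> BL n" "f n b \<noteq> \<one>\<^bsub>grp N n\<^esub>"
  shows "f n b \<in> BN n" "nu_map f n (atom L BL n b) = atom N BN n (f n b)"
  using assms by (auto simp: quasi_rigid_def)

text \<open>The coefficient of \<open>f n y\<close> at \<open>b\<close> is additive in
  \<open>y\<close>. If no basis element maps to \<open>b\<close>, it vanishes on the basis, because
  a quasi-rigid morphism sends each basis element to zero or to a basis element.\<close>

lemma quasi_rigid_basis_preimage:
  assumes "steiner_adc L BL" "steiner_adc N BN" and f: "quasi_rigid L BL N BN f"
    and y: "y \<in> carrier (grp L n)" and nz: "coeff (grp N n) (BN n) (f n y) b \<noteq> 0"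
  shows "\<exists>e\<in>BL n. f n e = b"
proof (rule ccontr)
  interpret L: steiner_adc L BL by (rule assms)
  interpret N: steiner_adc N BN by (rule assms)
  assume none: "\<not> ?thesis"
  have mor: "adc_mor L N f" using f by (simp add: quasi_rigid_def)
  note F = adc_morD[OF mor]
  have "N.cf n (f n y) b = 0"
  proof (rule L.grp.additive_eq_on_basis[where p = "\<lambda>x. N.cf n (f n x) b" and q = "\<lambda>_. 0" and x = y])
    show "N.cf n (f n (x \<otimes>\<^bsub>grp L n\<^esub> x')) b = N.cf n (f n x) b + N.cf n (f n x') b"
      if "x \<in> carrier (grp L n)" "x' \<in> carrier (grp L n)" for x x'
      using that F(4,5) by (simp add: N.cf_mult)
    show "N.cf n (f n e) b = 0" if e: "e \<in> BL n" for e
    proof (cases "f n e = \<one>\<^bsub>grp N n\<^esub>")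
      case False
      then have "f n e \<in> BN n" using quasi_rigidD(1)[OF f e] by simp
      then have "N.cf n (f n e) = single (f n e)" by (simp add: N.cf_def N.grp.coeff_basis)
      then show ?thesis using none e by (auto simp: single_def)
    qed simp
  qed (use y in auto)
  then show False using nz by (simp add: N.cf_def)
qed

text \<open>A cell with zero top entry is an identity on a cell of smaller dimension; for
  \<open>n = 0\<close> this conflicts with augmentation 1. So a cell whose top element is killed
  falls under an induction hypothesis on dimension.\<close>

lemma (in aug_dir_complex) nu_cells_drop:
  assumes "x \<in> nu_cells K n" "x n Plus = \<one>\<^bsub>grp K n\<^esub>"
  shows "\<exists>m<n. x \<in> nu_cells K m"
proof (cases n)
  case 0
  have "aug K \<one>\<^bsub>grp K 0\<^esub> = 0"
    using aug_mult[of "\<one>\<^bsub>grp K 0\<^esub>" "\<one>\<^bsub>grp K 0\<^esub>"] pos_carrier[OF pos_one]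
      monoid.l_one[OF group.is_monoid[OF grp_group]] by simp
  then show ?thesis using nu_cellsD(5)[OF assms(1), of Plus] assms(2) 0 by simp
next
  case (Suc m)
  have "x n \<alpha> = \<one>\<^bsub>grp K n\<^esub>" for \<alpha> using nu_cellsD(3)[OF assms(1), of \<alpha> Plus] assms(2) by simp
  then have "x j \<alpha> = \<one>\<^bsub>grp K j\<^esub>" if "m < j" for j \<alpha>
    using nu_cellsD(2)[OF assms(1), of j \<alpha>] that Suc by (cases "j = n") auto
  then have "x \<in> nu_cells K m" using assms(1) unfolding nu_cells_iff by blast
  then show ?thesis using Suc by auto
qed

locale rigid_square =
  cK: steiner_adc K BK + c0: steiner_adc M0 B0 + c1: steiner_adc M1 B1 + cM: steiner_adc M B
  for K M0 M1 M :: "'a adc" and BK B0 B1 B +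
  fixes k0 k1 l0 l1 :: "nat \<Rightarrow> 'a \<Rightarrow> 'a"
  assumes pushout: "adc_pushout TYPE('a) K M0 M1 M k0 k1 l0 l1"
    and rigid_k0: "quasi_rigid K BK M0 B0 k0"
    and rigid_k1: "quasi_rigid K BK M1 B1 k1"
    and rigid_l0: "quasi_rigid M0 B0 M B l0"
    and rigid_l1: "quasi_rigid M1 B1 M B l1"
begin

lemmas mor_k0 = pushoutD(1)[OF pushout] and mor_k1 = pushoutD(2)[OF pushout]
  and mor_l0 = pushoutD(3)[OF pushout] and mor_l1 = pushoutD(4)[OF pushout]

lemma square: "x \<in> carrier (grp K n) \<Longrightarrow> l0 n (k0 n x) = l1 n (k1 n x)"
  using pushoutD(5)[OF pushout] by blast

lemma nu_square:
  assumes "x \<in> nu_cells K n"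
  shows "nu_map l0 m (nu_map k0 m x) = nu_map l1 m (nu_map k1 m x)"
  using square cK.nu_cellsD(6)[OF assms] by (simp add: nu_map_def)

lemma basis_ne_one: "b \<in> B n \<Longrightarrow> b \<noteq> \<one>\<^bsub>grp M n\<^esub>"
  using cM.grp.coeff_basis[of b n] cM.grp.coeff_one[of n] by (metis single_neq_0)

text \<open>By \<open>pushout_pos\<close> the element is a sum of two positive images, so its
  coefficient 1 at itself comes from one of them, and quasi-rigidity pulls it back to a basis
  element.\<close>

lemma basis_image:
  assumes "b \<in> B n"
  shows "(\<exists>b'\<in>B0 n. l0 n b' = b) \<or> (\<exists>b'\<in>B1 n. l1 n b' = b)"
proof -
  obtain y z where yz: "y \<in> pos M0 n" "z \<in> pos M1 n" "b = l0 n y \<otimes>\<^bsub>grp M n\<^esub> l1 n z"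
    using pushout_pos[OF pushout cM.basis_pos[OF assms]] by blast
  have c: "y \<in> carrier (grp M0 n)" "z \<in> carrier (grp M1 n)"
    using yz c0.pos_carrier c1.pos_carrier by blast+
  note i = adc_morD(4)[OF mor_l0 c(1)] adc_morD(4)[OF mor_l1 c(2)]
  have "single b = cM.cf n (l0 n y) + cM.cf n (l1 n z)"
    using cM.cf_mult[OF i] cM.grp.coeff_basis[OF assms] yz(3) by (simp add: cM.cf_def)
  then have "cM.cf n (l0 n y) b + cM.cf n (l1 n z) b = 1" by (metis plus_fun_apply single_self)
  then consider "cM.cf n (l0 n y) b \<noteq> 0" | "cM.cf n (l1 n z) b \<noteq> 0" by fastforce
  then show ?thesis
  proof cases
    case 1
    then show ?thesis
      using quasi_rigid_basis_preimage[OF c0.steiner_adc_axioms cM.steiner_adc_axioms rigid_l0 c(1)]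
      by (simp add: cM.cf_def)
  next
    case 2
    then show ?thesis
      using quasi_rigid_basis_preimage[OF c1.steiner_adc_axioms cM.steiner_adc_axioms rigid_l1 c(2)]
      by (simp add: cM.cf_def)
  qed
qed

text \<open>A set of basis elements of \<open>M0\<close> and \<open>M1\<close> that is closed under the identifications coming from \<open>K\<close>,
  where elements identified with zero are excluded, has a characteristic functional on \<open>M\<close>.\<close>

lemma separation:
  assumes C: "\<And>c. c \<in> BK n \<Longrightarrow>
      k0 n c \<noteq> \<one>\<^bsub>grp M0 n\<^esub> \<and> C0 (k0 n c) \<longleftrightarrow> k1 n c \<noteq> \<one>\<^bsub>grp M1 n\<^esub> \<and> C1 (k1 n c)"
    and ne: "B0 n \<noteq> {} \<or> B1 n \<noteq> {}"
  shows "\<exists>p :: 'a \<Rightarrow> int. (\<forall>b\<in>B0 n. p (l0 n b) = of_bool (C0 b)) \<and> (\<forall>b\<in>B1 n. p (l1 n b) = of_bool (C1 b)) \<and>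
    p \<one>\<^bsub>grp M n\<^esub> = 0"
proof -
  let ?p0 = "c0.grp.mass n C0" and ?p1 = "c1.grp.mass n C1"
  have inf: "infinite (UNIV :: 'a set)"
    using ne c0.grp.basis_infinite c1.grp.basis_infinite by (meson ex_in_conv finite_subset subset_UNIV)
  have one: "?p0 \<one>\<^bsub>grp M0 n\<^esub> = 0" "?p1 \<one>\<^bsub>grp M1 n\<^esub> = 0"
    using c0.grp.mass_mult[of "\<one>\<^bsub>grp M0 n\<^esub>" n "\<one>\<^bsub>grp M0 n\<^esub>" C0]
      c1.grp.mass_mult[of "\<one>\<^bsub>grp M1 n\<^esub>" n "\<one>\<^bsub>grp M1 n\<^esub>" C1] by simp_all
  note K0 = adc_morD[OF mor_k0] and K1 = adc_morD[OF mor_k1]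
  have agree: "?p0 (k0 n x) = ?p1 (k1 n x)" if x: "x \<in> carrier (grp K n)" for x
  proof (rule cK.grp.additive_eq_on_basis[where p = "\<lambda>x. ?p0 (k0 n x)" and q = "\<lambda>x. ?p1 (k1 n x)", OF _ _ _ x])
    show "?p0 (k0 n (x \<otimes>\<^bsub>grp K n\<^esub> y)) = ?p0 (k0 n x) + ?p0 (k0 n y)"
      "?p1 (k1 n (x \<otimes>\<^bsub>grp K n\<^esub> y)) = ?p1 (k1 n x) + ?p1 (k1 n y)"
      if "x \<in> carrier (grp K n)" "y \<in> carrier (grp K n)" for x y
      using that K0(4,5) K1(4,5) by (simp_all add: c0.grp.mass_mult c1.grp.mass_mult)
    show "?p0 (k0 n c) = ?p1 (k1 n c)" if c: "c \<in> BK n" for c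
    proof -
      have "?p0 (k0 n c) = of_bool (k0 n c \<noteq> \<one>\<^bsub>grp M0 n\<^esub> \<and> C0 (k0 n c))"
        using quasi_rigidD(1)[OF rigid_k0 c] one(1) c0.grp.mass_basis by (cases "k0 n c = \<one>\<^bsub>grp M0 n\<^esub>") auto
      moreover have "?p1 (k1 n c) = of_bool (k1 n c \<noteq> \<one>\<^bsub>grp M1 n\<^esub> \<and> C1 (k1 n c))"
        using quasi_rigidD(1)[OF rigid_k1 c] one(2) c1.grp.mass_basis by (cases "k1 n c = \<one>\<^bsub>grp M1 n\<^esub>") auto
      ultimately show ?thesis using C[OF c] by simp
    qed
  qed
  obtain p where p: "\<And>x. x \<in> carrier (grp M0 n) \<Longrightarrow> p (l0 n x) = ?p0 x"
    "\<And>x. x \<in> carrier (grp M1 n) \<Longrightarrow> p (l1 n x) = ?p1 x"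
    using pushout_functional[OF pushout inf c0.grp.mass_mult c1.grp.mass_mult agree] by blast
  have "p \<one>\<^bsub>grp M n\<^esub> = 0" using p(1)[of "\<one>\<^bsub>grp M0 n\<^esub>"] one(1) adc_morD(9)[OF mor_l0, of n] by simp
  then show ?thesis
    using p c0.basis_carrier c1.basis_carrier c0.grp.mass_basis c1.grp.mass_basis
    by (intro exI[of _ p]) simp
qed

end

section \<open>The functor induced by a cocone\<close>

locale rigid_cocone = rigid_square K M0 M1 M BK B0 B1 B k0 k1 l0 l1
  for K M0 M1 M :: "'a adc" and BK B0 B1 B k0 k1 l0 l1 +
  fixes X :: "'c omega_cat" and H0 H1 :: "nat \<Rightarrow> 'a family \<Rightarrow> 'c"
  assumes functor_H0: "omega_functor (nu M0) X H0"
    and functor_H1: "omega_functor (nu M1) X H1"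
    and agree: "x \<in> nu_cells K n \<Longrightarrow> H0 n (nu_map k0 n x) = H1 n (nu_map k1 n x)"
begin

sublocale X: omega_category X
  using functor_H0 by (simp add: omega_functor_def)

lemma functor_simps:
  assumes "omega_functor (nu L) X F" "x \<in> nu_cells L n"
  shows "F n x \<in> cells X n" "k < n \<Longrightarrow> F k (nu_face L k \<alpha> x) = face X n k \<alpha> (F n x)"
    "n \<le> m \<Longrightarrow> F m x = iter_unit X n (m - n) (F n x)"
    "\<lbrakk>k < n; y \<in> nu_cells L n; nu_face L k Minus x = nu_face L k Plus y\<rbrakk> \<Longrightarrow>
      F n (nu_comp L k x y) = composite X n k (F n x) (F n y)"
proof -
  note F = assms(1)[unfolded omega_functor_def]
  show "F n x \<in> cells X n" using F assms(2) by auto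
  show "k < n \<Longrightarrow> F k (nu_face L k \<alpha> x) = face X n k \<alpha> (F n x)" using F assms(2) by simp
  show "n \<le> m \<Longrightarrow> F m x = iter_unit X n (m - n) (F n x)"
    using omega_functor_iter_unit[OF assms(1), of x n "m - n"] assms(2) by simp
  have "composable (nu L) n k x y \<Longrightarrow> F n (composite (nu L) n k x y) = composite X n k (F n x) (F n y)"
    using F by blast
  then show "\<lbrakk>k < n; y \<in> nu_cells L n; nu_face L k Minus x = nu_face L k Plus y\<rbrakk> \<Longrightarrow>
      F n (nu_comp L k x y) = composite X n k (F n x) (F n y)"
    using assms(2) by (simp add: composable_def)
qed

text \<open>A relation, since \<open>b\<close> can have several preimages in \<open>M0\<close> and
  \<open>M1\<close>, and each one proposes a value.\<close>

definition image_value :: "nat \<Rightarrow> 'a \<Rightarrow> 'c \<Rightarrow> bool" where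
  "image_value n b y \<longleftrightarrow> (\<exists>b'\<in>B0 n. l0 n b' = b \<and> H0 n (atom M0 B0 n b') = y) \<or>
     (\<exists>b'\<in>B1 n. l1 n b' = b \<and> H1 n (atom M1 B1 n b') = y)"

lemma atoms_agree:
  assumes "c \<in> BK n" "k0 n c \<noteq> \<one>\<^bsub>grp M0 n\<^esub>" "k1 n c \<noteq> \<one>\<^bsub>grp M1 n\<^esub>"
  shows "H0 n (atom M0 B0 n (k0 n c)) = H1 n (atom M1 B1 n (k1 n c))"
    "nu_map l0 n (atom M0 B0 n (k0 n c)) = nu_map l1 n (atom M1 B1 n (k1 n c))"
  using agree[of "atom K BK n c" n] nu_square[of "atom K BK n c" n n] cK.atom_cell[OF assms(1)]
    quasi_rigidD(2)[OF rigid_k0 assms(1,2)] quasi_rigidD(2)[OF rigid_k1 assms(1,3)] by simp_all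

text \<open>The preimages whose proposed value is \<open>y\<close> are separated from the others by
  a function on \<open>M\<close>. It is 1 at \<open>b\<close> on account of one preimage, so every
  preimage of \<open>b\<close> proposes \<open>y\<close>.\<close>

lemma image_value_unique:
  assumes b: "b \<in> B n" and y: "image_value n b y" "image_value n b y'"
  shows "y' = y"
proof -
  let ?C0 = "\<lambda>b. l0 n b \<noteq> \<one>\<^bsub>grp M n\<^esub> \<and> H0 n (atom M0 B0 n b) = y"
  let ?C1 = "\<lambda>b. l1 n b \<noteq> \<one>\<^bsub>grp M n\<^esub> \<and> H1 n (atom M1 B1 n b) = y"
  \<comment> \<open>If only one of \<open>k0 n c\<close> and \<open>k1 n c\<close> is zero, the
    square sends the other one to zero in \<open>M\<close>, and the condition of nonzero image
    excludes it. If both are nonzero, their images and values agree by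
    \<open>atoms_agree\<close>.\<close>
  have "k0 n c \<noteq> \<one>\<^bsub>grp M0 n\<^esub> \<and> ?C0 (k0 n c) \<longleftrightarrow> k1 n c \<noteq> \<one>\<^bsub>grp M1 n\<^esub> \<and> ?C1 (k1 n c)" if c: "c \<in> BK n" for c
    using square[OF cK.basis_carrier[OF c]] atoms_agree[OF c] adc_morD(9)[OF mor_l0, of n] adc_morD(9)[OF mor_l1, of n]
    by metis
  moreover have "B0 n \<noteq> {} \<or> B1 n \<noteq> {}" using y(1) by (auto simp: image_value_def)
  ultimately obtain p :: "'a \<Rightarrow> int" where p: "\<And>b. b \<in> B0 n \<Longrightarrow> p (l0 n b) = of_bool (?C0 b)"
    "\<And>b. b \<in> B1 n \<Longrightarrow> p (l1 n b) = of_bool (?C1 b)"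
    using separation[of n ?C0 ?C1] by blast
  have "p b = 1" using y(1) basis_ne_one[OF b] p by (auto simp: image_value_def)
  then show ?thesis using y(2) p by (auto simp: image_value_def of_bool_def split: if_splits)
qed

definition gen :: "nat \<Rightarrow> 'a \<Rightarrow> 'c" where
  "gen n b = (THE y. image_value n b y)"

lemma gen_eq: "b \<in> B n \<Longrightarrow> image_value n b y \<Longrightarrow> gen n b = y"
  unfolding gen_def using image_value_unique by blast

lemma gen_H0: "b \<in> B0 n \<Longrightarrow> l0 n b \<in> B n \<Longrightarrow> gen n (l0 n b) = H0 n (atom M0 B0 n b)"
  and gen_H1: "b \<in> B1 n \<Longrightarrow> l1 n b \<in> B n \<Longrightarrow> gen n (l1 n b) = H1 n (atom M1 B1 n b)"
  by (rule gen_eq; force simp: image_value_def)+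

lemma basis_cases [consumes 1]:
  assumes "b \<in> B n"
  obtains (B0) b' where "b' \<in> B0 n" "b = l0 n b'" "gen n b = H0 n (atom M0 B0 n b')"
      "atom M B n b = nu_map l0 n (atom M0 B0 n b')"
    | (B1) b' where "b' \<in> B1 n" "b = l1 n b'" "gen n b = H1 n (atom M1 B1 n b')"
      "atom M B n b = nu_map l1 n (atom M1 B1 n b')"
  using basis_image[OF assms] gen_H0 gen_H1 assms basis_ne_one[OF assms]
    quasi_rigidD(2)[OF rigid_l0] quasi_rigidD(2)[OF rigid_l1] by metis

lemma gen_cell: "b \<in> B n \<Longrightarrow> gen n b \<in> cells X n"
proof (erule basis_cases)
  show "gen n b \<in> cells X n" if "b' \<in> B0 n" "gen n b = H0 n (atom M0 B0 n b')" for b'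
    using functor_simps(1)[OF functor_H0 c0.atom_cell[OF that(1) order_refl]] that(2) by simp
  show "gen n b \<in> cells X n" if "b' \<in> B1 n" "gen n b = H1 n (atom M1 B1 n b')" for b'
    using functor_simps(1)[OF functor_H1 c1.atom_cell[OF that(1) order_refl]] that(2) by simp
qed

definition gen_unit :: "nat \<Rightarrow> nat \<Rightarrow> 'a \<Rightarrow> 'c" where
  "gen_unit n p b = iter_unit X p (n - p) (gen p b)"

sublocale L: cell_lifting B cM.cd cM.caug n "cells X n" "X.sface n" "composite X n" "gen_unit n" for n
proof (intro cell_lifting.intro cell_lifting_axioms.intro cM.steiner_complex_axioms X.n_category_cells)
  show "gen_unit n p b \<in> cells X n" if "b \<in> B p" "p \<le> n" for b p
    using X.iter_unit_cell[OF gen_cell[OF that(1)], of "n - p"] that by (simp add: gen_unit_def)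
  show "X.sface n k \<alpha> (gen_unit n p b) = gen_unit n p b" if "b \<in> B p" "p \<le> n" "p \<le> k" for b p k \<alpha>
    using X.face_iter_unit[OF gen_cell[OF that(1)], of k "n - p" \<alpha>] that
      X.iter_unit_add[of p "k - p" "n - k" "gen p b"]
    by (auto simp: gen_unit_def X.sface_def)
qed

text \<open>The relations for different \<open>n\<close> are separate; this carries a lift from one
  dimension to the next, where the cell of \<open>nu M\<close> is unchanged and its value receives a
  unit.\<close>

lemma lifts_unit: "L.lifts n x y \<Longrightarrow> L.lifts (Suc n) x (unit_cell X n y)"
proof (induction rule: L.lifts.induct)
  case (atm b p)
  then have "unit_cell X n (gen_unit n p b) = gen_unit (Suc n) p b"
    by (simp add: gen_unit_def Suc_diff_le)
  then show ?case using L.lifts.atm[of b p "Suc n"] atm by simp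
next
  case (comp x y x' y' k)
  have Y: "y \<in> cells X n" "y' \<in> cells X n" using comp L.lifts_Y by blast+
  have "composable X n k y y'"
    using comp Y X.sface_eq_iff[of k n y y'] by (simp add: composable_def)
  then have "unit_cell X n (composite X n k y y') = composite X (Suc n) k (unit_cell X n y) (unit_cell X n y')"
    by (rule X.unit_comp)
  moreover have "L.lifts (Suc n) (cM.ccomp k x x') (composite X (Suc n) k (unit_cell X n y) (unit_cell X n y'))"
    using comp Y X.sface_Suc_unit[of _ n k] by (intro L.lifts.comp) auto
  ultimately show ?case by simp
qed

lemma lifts_iter_unit:
  assumes "L.lifts k x y" "k \<le> n"
  shows "L.lifts n x (iter_unit X k (n - k) y)"
proof -
  have "L.lifts (k + m) x (iter_unit X k m y)" for m
    by (induction m) (auto intro: assms lifts_unit)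
  from this[of "n - k"] show ?thesis using assms(2) by simp
qed

lemma lifts_image_lower:
  assumes "omega_functor (nu L) X F" "y \<in> nu_cells L m" "m \<le> n"
    and "L.lifts m (cM.enc (nu_map l m y)) (F m y)"
  shows "L.lifts n (cM.enc (nu_map l n y)) (F n y)"
  using lifts_iter_unit[OF assms(4,3)] functor_simps(3)[OF assms(1-3)] by (simp add: nu_map_def)

lemma lifts_image_comp:
  assumes mor: "adc_mor L M l" and F: "omega_functor (nu L) X F" and "k < n"
    and y: "y \<in> nu_cells L n" and y': "y' \<in> nu_cells L n" and e: "nu_face L k Minus y = nu_face L k Plus y'"
    and lf: "L.lifts n (cM.enc (nu_map l n y)) (F n y)" "L.lifts n (cM.enc (nu_map l n y')) (F n y')"
  shows "L.lifts n (cM.enc (nu_map l n (nu_comp L k y y'))) (F n (nu_comp L k y y'))"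
proof -
  interpret A: aug_dir_complex L by (rule adc_morD(1)[OF mor])
  have en: "cM.entries (nu_map l n y)" "cM.entries (nu_map l n y')"
    using cM.nu_cells_entries nu_map_cell[OF mor] y y' by blast+
  have c: "cM.cface k \<alpha> (cM.enc (nu_map l n z)) = cM.enc (nu_map l n (nu_face L k \<alpha> z))"
    if "cM.entries (nu_map l n z)" for z \<alpha>
    using cM.enc_face[OF that] nu_map_face[OF mor, of n k \<alpha> z n] by simp
  have "X.sface n k Minus (F n y) = X.sface n k Plus (F n y')"
    using functor_simps(2)[OF F y \<open>k < n\<close>, of Minus] functor_simps(2)[OF F y' \<open>k < n\<close>, of Plus] e \<open>k < n\<close>
    by (simp add: X.sface_def)
  then have "L.lifts n (cM.ccomp k (cM.enc (nu_map l n y)) (cM.enc (nu_map l n y'))) (composite X n k (F n y) (F n y'))"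
    using lf \<open>k < n\<close> c en e by (intro L.lifts.comp) auto
  moreover have "cM.ccomp k (cM.enc (nu_map l n y)) (cM.enc (nu_map l n y')) = cM.enc (nu_map l n (nu_comp L k y y'))"
    using cM.enc_comp[OF en] nu_map_comp[OF mor A.nu_cellsD(6)[OF y] A.nu_cellsD(6)[OF y']] by simp
  ultimately show ?thesis using functor_simps(4)[OF F y \<open>k < n\<close> y' e] by simp
qed

text \<open>Both functors are treated together, as identifications through \<open>K\<close> pass
  from \<open>M0\<close> to \<open>M1\<close> and back. Composites reduce to atoms by generation
  alone, so that closure under faces, and with it uniqueness, can be derived from this
  lemma.\<close>

lemma lifts_image:
  shows "y \<in> nu_cells M0 n \<Longrightarrow> L.lifts n (cM.enc (nu_map l0 n y)) (H0 n y)"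
    and "y \<in> nu_cells M1 n \<Longrightarrow> L.lifts n (cM.enc (nu_map l1 n y)) (H1 n y)"
proof (induction n arbitrary: y rule: less_induct)
  case (less n)
  let ?G0 = "\<lambda>b. L.lifts n (cM.enc (nu_map l0 n (atom M0 B0 n b))) (H0 n (atom M0 B0 n b))"
  let ?G1 = "\<lambda>b. L.lifts n (cM.enc (nu_map l1 n (atom M1 B1 n b))) (H1 n (atom M1 B1 n b))"
  have low0: "L.lifts n (cM.enc (nu_map l0 n y)) (H0 n y)" if "y \<in> nu_cells M0 m" "m < n" for y m
    using lifts_image_lower[OF functor_H0 that(1)] that less(1) by simp
  have low1: "L.lifts n (cM.enc (nu_map l1 n y)) (H1 n y)" if "y \<in> nu_cells M1 m" "m < n" for y m
    using lifts_image_lower[OF functor_H1 that(1)] that less(2) by simp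
  \<comment> \<open>The set of elements whose atoms violate the claim is closed under the
    identifications, so \<open>separation\<close> gives it a functional.\<close>
  have C: "k0 n c \<noteq> \<one>\<^bsub>grp M0 n\<^esub> \<and> \<not> ?G0 (k0 n c) \<longleftrightarrow> k1 n c \<noteq> \<one>\<^bsub>grp M1 n\<^esub> \<and> \<not> ?G1 (k1 n c)"
    if c: "c \<in> BK n" for c
  proof -
    let ?c = "atom K BK n c"
    have cell: "?c \<in> nu_cells K n" using cK.atom_cell[OF c] by simp
    have "?c n \<alpha> = c" for \<alpha> by (subst atom.simps) simp
    then have top: "nu_map k0 n ?c n \<alpha> = k0 n c" "nu_map k1 n ?c n \<alpha> = k1 n c" for \<alpha>
      by (simp_all add: nu_map_def)
    have sq: "nu_map l0 n (nu_map k0 n ?c) = nu_map l1 n (nu_map k1 n ?c)"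
      "H0 n (nu_map k0 n ?c) = H1 n (nu_map k1 n ?c)"
      using nu_square[OF cell] agree[OF cell] by simp_all
    consider "k0 n c = \<one>\<^bsub>grp M0 n\<^esub>" "k1 n c = \<one>\<^bsub>grp M1 n\<^esub>" | "k0 n c \<noteq> \<one>\<^bsub>grp M0 n\<^esub>" "k1 n c \<noteq> \<one>\<^bsub>grp M1 n\<^esub>"
      | "k0 n c \<noteq> \<one>\<^bsub>grp M0 n\<^esub>" "k1 n c = \<one>\<^bsub>grp M1 n\<^esub>" | "k0 n c = \<one>\<^bsub>grp M0 n\<^esub>" "k1 n c \<noteq> \<one>\<^bsub>grp M1 n\<^esub>"
      by blast
    then show ?thesis
    proof cases
      case 2
      then show ?thesis using atoms_agree[OF c] by simp
    next
      case 3
      \<comment> \<open>\<open>k1\<close> kills \<open>c\<close>, so the image of the atom in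
        \<open>M1\<close> has smaller dimension, where the claim is known; it passes to the atom of
        \<open>k0 n c\<close> through the square.\<close>
      obtain m where "m < n" "nu_map k1 n ?c \<in> nu_cells M1 m"
        using c1.nu_cells_drop[OF nu_map_cell[OF mor_k1 cell, of n]] top(2)[of Plus] 3 by auto
      then have "L.lifts n (cM.enc (nu_map l1 n (nu_map k1 n ?c))) (H1 n (nu_map k1 n ?c))" using low1 by blast
      then have "?G0 (k0 n c)" using sq quasi_rigidD(2)[OF rigid_k0 c 3(1)] by simp
      then show ?thesis using 3 by simp
    next
      case 4
      obtain m where "m < n" "nu_map k0 n ?c \<in> nu_cells M0 m"
        using c0.nu_cells_drop[OF nu_map_cell[OF mor_k0 cell, of n]] top(1)[of Plus] 4 by auto
      then have "L.lifts n (cM.enc (nu_map l0 n (nu_map k0 n ?c))) (H0 n (nu_map k0 n ?c))" using low0 by blast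
      then have "?G1 (k1 n c)" using sq quasi_rigidD(2)[OF rigid_k1 c 4(2)] by simp
      then show ?thesis using 4 by simp
    qed simp
  qed
  have unit0: "gen_unit n n b = gen n b" for b by (simp add: gen_unit_def)
  have top0: "?G0 b" if b: "b \<in> B0 n" for b
  proof (cases "l0 n b = \<one>\<^bsub>grp M n\<^esub>")
    case True
    \<comment> \<open>\<open>p\<close> takes the value 1 at the image of a violating element, but
      here that image is zero, where \<open>p\<close> vanishes.\<close>
    obtain p :: "'a \<Rightarrow> int" where "\<forall>b\<in>B0 n. p (l0 n b) = of_bool (\<not> ?G0 b)" "p \<one>\<^bsub>grp M n\<^esub> = 0"
      using separation[OF C] b by blast
    then have "of_bool (\<not> ?G0 b) = (0 :: int)" using True b by metis
    then show ?thesis by simp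
  next
    case False
    note r = quasi_rigidD[OF rigid_l0 b False]
    show ?thesis using L.lifts.atm[OF r(1) order_refl] r cM.enc_atom[OF r(1)] gen_H0[OF b r(1)] by (simp add: unit0)
  qed
  have top1: "?G1 b" if b: "b \<in> B1 n" for b
  proof (cases "l1 n b = \<one>\<^bsub>grp M n\<^esub>")
    case True
    obtain p :: "'a \<Rightarrow> int" where "\<forall>b\<in>B1 n. p (l1 n b) = of_bool (\<not> ?G1 b)" "p \<one>\<^bsub>grp M n\<^esub> = 0"
      using separation[OF C] b by blast
    then have "of_bool (\<not> ?G1 b) = (0 :: int)" using True b by metis
    then show ?thesis by simp
  next
    case False
    note r = quasi_rigidD[OF rigid_l1 b False]
    show ?thesis using L.lifts.atm[OF r(1) order_refl] r cM.enc_atom[OF r(1)] gen_H1[OF b r(1)] by (simp add: unit0)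
  qed
  {
    case 1
    then show ?case
    proof (induction rule: c0.nu_cell_induct)
      case (atom p b)
      then show ?case using top0 low0[OF c0.atom_cell[of b p p]] by (cases "p = n") auto
    qed (rule lifts_image_comp[OF mor_l0 functor_H0])
  next
    case 2
    then show ?case
    proof (induction rule: c1.nu_cell_induct)
      case (atom p b)
      then show ?case using top1 low1[OF c1.atom_cell[of b p p]] by (cases "p = n") auto
    qed (rule lifts_image_comp[OF mor_l1 functor_H1])
  }
qed

lemma sface_gen_unit:
  assumes "b \<in> B p" "k < p" "p \<le> n"
  shows "X.sface n k \<alpha> (gen_unit n p b) = iter_unit X k (n - k) (face X p k \<alpha> (gen p b))"
  using X.face_iter_unit[OF gen_cell[OF assms(1)], of k "n - p" \<alpha>] assms
  by (simp add: X.sface_def gen_unit_def)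

lemma lifts_face_image:
  assumes mor: "adc_mor L M l" and F: "omega_functor (nu L) X F" and y: "y \<in> nu_cells L p"
    and lf: "\<And>z. z \<in> nu_cells L k \<Longrightarrow> L.lifts k (cM.enc (nu_map l k z)) (F k z)" and "k < p"
  shows "L.lifts k (cM.cface k \<alpha> (cM.enc (nu_map l p y))) (face X p k \<alpha> (F p y))"
proof -
  interpret A: aug_dir_complex L by (rule adc_morD(1)[OF mor])
  have "L.lifts k (cM.enc (nu_map l k (nu_face L k \<alpha> y))) (F k (nu_face L k \<alpha> y))"
    by (rule lf[OF A.nu_face_cell[OF y]])
  then show ?thesis
    using functor_simps(2)[OF F y \<open>k < p\<close>, of \<alpha>] nu_map_face[OF mor, of k k \<alpha> y p]
      cM.enc_face[OF cM.nu_cells_entries[OF nu_map_cell[OF mor y]], of k \<alpha> p] by simp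
qed

text \<open>An atom of \<open>M\<close> is the image of an atom of \<open>M0\<close> or
  \<open>M1\<close>, so its face is the image of a cell of lower dimension \<open>k\<close>, to
  which \<open>lifts_image\<close> applies; the value is raised by units to dimension
  \<open>n\<close>.\<close>

sublocale LC: closed_cell_lifting B cM.cd cM.caug n "cells X n" "X.sface n" "composite X n" "gen_unit n" for n
proof
  fix b p k \<alpha> assume b: "b \<in> B p" and pn: "p \<le> n" and kp: "k < p"
  from b have "L.lifts k (cM.cface k \<alpha> (cM.atm p b)) (face X p k \<alpha> (gen p b))"
  proof (cases rule: basis_cases)
    case (B0 b')
    then show ?thesis
      using lifts_face_image[OF mor_l0 functor_H0 c0.atom_cell[OF B0(1) order_refl] lifts_image(1) kp, of \<alpha>]
        cM.enc_atom[OF b] by simp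
  next
    case (B1 b')
    then show ?thesis
      using lifts_face_image[OF mor_l1 functor_H1 c1.atom_cell[OF B1(1) order_refl] lifts_image(2) kp, of \<alpha>]
        cM.enc_atom[OF b] by simp
  qed
  then show "L.lifts n (cM.cface k \<alpha> (cM.atm p b)) (X.sface n k \<alpha> (gen_unit n p b))"
    using lifts_iter_unit[of k _ _ n] sface_gen_unit[OF b kp pn] kp pn by simp
qed

definition H :: "nat \<Rightarrow> 'a family \<Rightarrow> 'c" where
  "H n x = (THE y. L.lifts n (cM.enc x) y)"

lemma lifts_H: "x \<in> nu_cells M n \<Longrightarrow> L.lifts n (cM.enc x) (H n x)"
  unfolding H_def by (rule theI') (rule LC.cells_free[OF cM.enc_cells])

lemma H_eq: "x \<in> nu_cells M n \<Longrightarrow> L.lifts n (cM.enc x) y \<Longrightarrow> H n x = y"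
  using LC.cells_free[OF cM.enc_cells] lifts_H by blast

lemma H_l0: "y \<in> nu_cells M0 n \<Longrightarrow> H n (nu_map l0 n y) = H0 n y"
  and H_l1: "y \<in> nu_cells M1 n \<Longrightarrow> H n (nu_map l1 n y) = H1 n y"
  using H_eq nu_map_cell[OF mor_l0] nu_map_cell[OF mor_l1] lifts_image by blast+

lemma functor_H: "omega_functor (nu M) X H"
  unfolding omega_functor_def
proof (intro conjI allI ballI impI)
  show "omega_category (nu M)" by (rule cM.omega_category_nu)
  show "omega_category X" by (rule X.omega_category_axioms)
  show "H n ` cells (nu M) n \<subseteq> cells X n" for n
    using L.lifts_Y[OF lifts_H] by (simp add: image_subset_iff)
  show "H k (face (nu M) n k \<alpha> x) = face X n k \<alpha> (H n x)" if "x \<in> cells (nu M) n" "k < n" for n k \<alpha> x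
  proof -
    have x: "x \<in> nu_cells M n" using that by simp
    have f: "nu_face M k \<alpha> x \<in> nu_cells M k" by (rule cM.nu_face_cell[OF x])
    let ?y = "H k (nu_face M k \<alpha> x)"
    have y: "?y \<in> cells X k" "H n x \<in> cells X n" using lifts_H[OF f] lifts_H[OF x] L.lifts_Y by blast+
    have "L.lifts n (cM.enc (nu_face M k \<alpha> x)) (X.sface n k \<alpha> (H n x))"
      using LC.lifts_face[OF lifts_H[OF x]] cM.enc_face[OF cM.nu_cells_entries[OF x]] by simp
    moreover have "L.lifts n (cM.enc (nu_face M k \<alpha> x)) (iter_unit X k (n - k) ?y)"
      using lifts_iter_unit[OF lifts_H[OF f]] that by simp
    moreover have "cM.enc (nu_face M k \<alpha> x) \<in> cM.cells_above n None"
      using cM.enc_cells[OF f] cM.cells_above_None_mono that by simp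
    ultimately have "iter_unit X k (n - k) (face X n k \<alpha> (H n x)) = iter_unit X k (n - k) ?y"
      using LC.cells_free that by (auto simp: X.sface_def)
    \<comment> \<open>Uniqueness compares the two faces as \<open>n\<close>-cells. Taking one more
      \<open>k\<close>-face, of either sign, strips the units and returns to dimension
      \<open>k\<close>.\<close>
    then have "face X n k Plus (iter_unit X k (n - k) (face X n k \<alpha> (H n x))) = face X n k Plus (iter_unit X k (n - k) ?y)"
      by simp
    then show ?thesis
      using that y X.face_cell[OF \<open>k < n\<close> y(2), of \<alpha>]
        X.face_iter_unit[of ?y k k "n - k" Plus] X.face_iter_unit[of "face X n k \<alpha> (H n x)" k k "n - k" Plus] by simp
  qed
  show "H (Suc n) (unit_cell (nu M) n x) = unit_cell X n (H n x)" if "x \<in> cells (nu M) n" for n x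
    using that lifts_unit[OF lifts_H] omega_category.unit_cell[OF cM.omega_category_nu that] by (simp add: H_eq)
  show "H n (composite (nu M) n k x y) = composite X n k (H n x) (H n y)" if "composable (nu M) n k x y" for n k x y
  proof -
    have c: "k < n" "x \<in> nu_cells M n" "y \<in> nu_cells M n" and e: "nu_face M k Minus x = nu_face M k Plus y"
      using that by (auto simp: composable_def)
    note en = cM.nu_cells_entries[OF c(2)] cM.nu_cells_entries[OF c(3)]
    note lf = lifts_H[OF c(2)] lifts_H[OF c(3)]
    have e': "cM.cface k Minus (cM.enc x) = cM.cface k Plus (cM.enc y)"
      using cM.enc_face[OF en(1)] cM.enc_face[OF en(2)] e by metis
    have id: "cM.cface k Minus (cM.enc x) \<in> cM.cells_above n None"
      using cM.cells_above_None_mono[OF cM.cface_cls[OF L.lifts_Cell[OF lf(1)]]] c(1) by simp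
    have "X.sface n k Minus (H n x) = X.sface n k Plus (H n y)"
      using LC.lifts_face[OF lf(1), of k Minus] LC.lifts_face[OF lf(2), of k Plus] LC.cells_free[OF id] e' by auto
    then have "L.lifts n (cM.enc (nu_comp M k x y)) (composite X n k (H n x) (H n y))"
      unfolding cM.enc_comp[OF en] by (intro L.lifts.comp lf c(1) e')
    then show ?thesis using H_eq[OF cM.nu_comp_cell[OF c e]] by simp
  qed
qed

text \<open>Atoms generate the cells of \<open>nu M\<close>, and each atom is an image from
  \<open>M0\<close> or \<open>M1\<close>, where both functors are prescribed.\<close>

lemma H_unique:
  assumes H': "omega_functor (nu M) X H'"
    and "\<And>n y. y \<in> nu_cells M0 n \<Longrightarrow> H' n (nu_map l0 n y) = H0 n y"
    and "\<And>n y. y \<in> nu_cells M1 n \<Longrightarrow> H' n (nu_map l1 n y) = H1 n y"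
    and "x \<in> nu_cells M n"
  shows "H' n x = H n x"
  using assms(4)
proof (induction rule: cM.nu_cell_induct)
  case (atom p b)
  have "H' p (atom M B p b) = H p (atom M B p b)"
    using atom(1)
  proof (cases rule: basis_cases)
    case (B0 b')
    then show ?thesis using assms(2) H_l0 c0.atom_cell[OF B0(1) order_refl] by simp
  next
    case (B1 b')
    then show ?thesis using assms(3) H_l1 c1.atom_cell[OF B1(1) order_refl] by simp
  qed
  then show ?case
    using functor_simps(3)[OF H' cM.atom_cell[OF atom(1) order_refl] atom(2)]
      functor_simps(3)[OF functor_H cM.atom_cell[OF atom(1) order_refl] atom(2)] by simp
next
  case (comp k x y)
  then show ?case using functor_simps(4)[OF H'] functor_simps(4)[OF functor_H] by simp
qed

end

theorem mainTheorem7: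
  fixes K M0 M1 M :: "'a adc"
    and BK B0 B1 B :: "nat \<Rightarrow> 'a set"
    and k0 k1 l0 l1 :: "nat \<Rightarrow> 'a \<Rightarrow> 'a"
  assumes "adc_pushout TYPE('a) K M0 M1 M k0 k1 l0 l1"
    and "unitary_loop_free_basis K BK"
    and "unitary_loop_free_basis M0 B0"
    and "unitary_loop_free_basis M1 B1"
    and "unitary_loop_free_basis M B"
    and "quasi_rigid K BK M0 B0 k0"
    and "quasi_rigid K BK M1 B1 k1"
    and "quasi_rigid M0 B0 M B l0"
    and "quasi_rigid M1 B1 M B l1"
  shows "omega_pushout TYPE('c) (nu K) (nu M0) (nu M1) (nu M)
           (nu_map k0) (nu_map k1) (nu_map l0) (nu_map l1)"
proof -
  note po = pushoutD[OF assms(1)]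
  have adc: "aug_dir_complex K" "aug_dir_complex M0" "aug_dir_complex M1" "aug_dir_complex M"
    using adc_morD(1,2)[OF po(1)] adc_morD(1,2)[OF po(4)] by blast+
  have square: "rigid_square K M0 M1 M BK B0 B1 B k0 k1 l0 l1"
    by (intro rigid_square.intro rigid_square_axioms.intro steiner_adc.intro steiner_adc_axioms.intro adc assms)
  have "\<exists>H. omega_functor (nu M) X H \<and>
      omega_functor_eq (nu M0) (\<lambda>n. H n \<circ> nu_map l0 n) H0 \<and> omega_functor_eq (nu M1) (\<lambda>n. H n \<circ> nu_map l1 n) H1 \<and>
      (\<forall>H'. omega_functor (nu M) X H' \<and>
        omega_functor_eq (nu M0) (\<lambda>n. H' n \<circ> nu_map l0 n) H0 \<and> omega_functor_eq (nu M1) (\<lambda>n. H' n \<circ> nu_map l1 n) H1 \<longrightarrow>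
        omega_functor_eq (nu M) H' H)"
    if "omega_functor (nu M0) X H0 \<and> omega_functor (nu M1) X H1 \<and>
      omega_functor_eq (nu K) (\<lambda>n. H0 n \<circ> nu_map k0 n) (\<lambda>n. H1 n \<circ> nu_map k1 n)"
    for X :: "'c omega_cat" and H0 H1
  proof -
    interpret rigid_cocone K M0 M1 M BK B0 B1 B k0 k1 l0 l1 X H0 H1
      using that by (intro rigid_cocone.intro rigid_cocone_axioms.intro square) (simp_all add: omega_functor_eq_def)
    have "omega_functor_eq (nu M) H' H"
      if f: "omega_functor (nu M) X H'" and e0: "omega_functor_eq (nu M0) (\<lambda>n. H' n \<circ> nu_map l0 n) H0"
        and e1: "omega_functor_eq (nu M1) (\<lambda>n. H' n \<circ> nu_map l1 n) H1" for H'
    proof -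
      have "H' n (nu_map l0 n y) = H0 n y" if "y \<in> nu_cells M0 n" for n y
        using e0 that by (simp add: omega_functor_eq_def)
      moreover have "H' n (nu_map l1 n y) = H1 n y" if "y \<in> nu_cells M1 n" for n y
        using e1 that by (simp add: omega_functor_eq_def)
      ultimately show ?thesis
        unfolding omega_functor_eq_def nu_simps using H_unique[OF f] by blast
    qed
    moreover have "omega_functor_eq (nu M0) (\<lambda>n. H n \<circ> nu_map l0 n) H0"
      "omega_functor_eq (nu M1) (\<lambda>n. H n \<circ> nu_map l1 n) H1"
      using H_l0 H_l1 by (simp_all add: omega_functor_eq_def)
    ultimately show ?thesis using functor_H by blast
  qed
  moreover have "omega_functor_eq (nu K) (\<lambda>n. nu_map l0 n \<circ> nu_map k0 n) (\<lambda>n. nu_map l1 n \<circ> nu_map k1 n)"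
    using rigid_square.nu_square[OF square] by (simp add: omega_functor_eq_def)
  ultimately show ?thesis
    unfolding omega_pushout_def using po(1-4)[THEN omega_functor_nu] by (intro conjI allI impI)
qed

end
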